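(* Let $d\in\mathbb{N}$, let $\Omega\subset\mathbb{R}^d$ be a bounded open domain with $\mathcal{C}^1$ boundary and outer unit normal $\nu$, and let $f\in\mathcal{C}^1(\mathbb{R}^d;\mathbb{R}^d)$ satisfy $\nu(x)^\top f(x)\le 0$ for all $x\in\partial\Omega$. Let $w:\Omega\to\mathbb{R}_+$ be a measurable weight with $w^{-1}\in W^{1,\infty}(\Omega)$, and assume $f_i\in \mathrm{L}^\infty_w(\Omega)\cap\mathcal{C}^1(\bar\Omega)$ for $i=1,\dots,d$ and $\operatorname{ess\,sup}_{x\in\Omega}-\frac{f(x)^\top\nabla w(x)}{w(x)}<\infty$. Let $X=\mathrm{L}^1_w(\Omega)$, $X^*=\mathrm{L}^\infty_w(\Omega)$, $H=\mathrm{L}^2_{w^2}(\Omega)$, and let $S(t)$ be the preadjoint of the composition semigroup $S^*(t)\varphi=\varphi\circ\Phi^t$. Let $g(x)=\sum_{i=1}^\infty c_i(x)^2$ ($x\in\Omega$) with $c_i\in X^*$, $\sum_{i=1}^\infty\|c_i\|_{X^*}^2<\infty$ be a nuclear cost with observation operator $C:X\to\ell_2$, $C\phi=(\langle\phi,c_i\rangle_{X,X^*})_{i\in\mathbb{N}}$. If $S(t)$ is exponentially stable over $X$, then the value bilinear form $$\langle\phi,\psi\rangle_P=\int_0^\infty\langle CS(t)\phi,CS(t)\psi\rangle_{\ell_2}\,dt,\qquad\phi,\psi\in X,$$ is the unique (bounded bilinear) extension to $X$ of the minimal solution $\langle\cdot,\cdot\rangle_P:H\times H\to\mathbb{R}$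 of the operator Lyapunov equation over $H$ $$\langle A\phi,\psi\rangle_P+\langle\phi,A\psi\rangle_P+\langle C\phi,C\psi\rangle_{\ell_2}=0\qquad\forall\,\phi,\psi\in\mathcal{D}(A)\subseteq H,$$ where $A$ is the generator of $S(t)$ on $H$.
   Context: For $z\in\bar\Omega$, $\Phi^t(z)$ denotes the value at time $t\ge 0$ of the solution of $\dot x=f(x)$, $x(0)=z$; the condition $\nu^\top f\le 0$ on $\partial\Omega$ guarantees that $\Phi^t(z)$ exists and stays in $\bar\Omega$ for all $t\ge0$. The weight $w$ is positive and finite almost everywhere; $\nabla w$ is understood almost everywhere, $\nabla w=-w^2\nabla(w^{-1})$. The weighted spaces are defined by the norms $\|\phi\|_{\mathrm{L}^p_w(\Omega)}=\big(\int_\Omega|\phi|^p w\,dx\big)^{1/p}$ for $1\le p<\infty$ and $\|\phi\|_{\mathrm{L}^\infty_w(\Omega)}=\operatorname{ess\,sup}_{x\in\Omega}|\phi(x)w(x)|$. The dual of $X=\mathrm{L}^1_w(\Omega)$ is identified with $X^*=\mathrm{L}^\infty_w(\Omega)$ through $\langle\phi,\varphi\rangle_{X,X^*}=\int_\Omega\phi\varphi w^2\,dx$; the inner product of $H=\mathrm{L}^2_{w^2}(\Omega)$ is $\int_\Omega\phi\varphi w^2\,dx$ and $H^*$ is identified with $H$; $X^*\subset H\subset X$ densely. For $Y\in\{X,H\}$, $S(t)\in\mathcal{L}(Y)$ is the preadjoint of $S^*(t)\in\mathcal{L}(Y^* )$: $\langle S(t)\rho,\varphi\rangle_{Y,Y^*}=\langle\rho,S^*(t)\varphi\rangle_{Y,Y^*}$;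 the operators on $H$ are the restrictions of those on $X$, and $S(t)$ is a strongly continuous semigroup on $H$. "Exponentially stable over $X$" means $\|S(t)\|_{\mathcal{L}(X)}\le Me^{\omega t}$ for all $t\ge0$ with some $M\ge1$, $\omega<0$ (exponential stability on $H$ is not assumed). A solution of the Lyapunov equation over $H$ is a bounded symmetric nonnegative bilinear form $Q$ on $H$ satisfying the equation with $Q$ in place of $\langle\cdot,\cdot\rangle_P$; it is minimal if $Q(\phi,\phi)\le\tilde Q(\phi,\phi)$ for every $\phi\in H$ and every other such solution $\tilde Q$. *)

theory Defs
  imports "HOL-Analysis.Analysis" "HOL-Probability.Essential_Supremum"
begin

section \<open>Functions of class $C^k$, domains with $C^1$ boundary\<close>

text \<open>\<open>S\<close> is meant to be open.\<close>

primrec Ck_on :: "nat \<Rightarrow> (real^'n) set \<Rightarrow> (real^'n \<Rightarrow> real) \<Rightarrow> bool" where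
  "Ck_on 0 S g \<longleftrightarrow> continuous_on S g"
| "Ck_on (Suc k) S g \<longleftrightarrow>
     (\<exists>D. (\<forall>x\<in>S. GDERIV g x :> D x) \<and> (\<forall>i. Ck_on k S (\<lambda>x. D x $ i)))"

text \<open>Near \<open>p\<close> the set \<open>\<Omega>\<close> is the sublevel set of a $C^1$ function without critical points; the
  gradient of such a function points out of \<open>\<Omega>\<close>.\<close>

definition local_defining_function ::
  "(real^'n) set \<Rightarrow> real^'n \<Rightarrow> (real^'n) set \<Rightarrow> (real^'n \<Rightarrow> real) \<Rightarrow> bool" where
  "local_defining_function \<Omega> p U h \<longleftrightarrow>
     open U \<and> p \<in> U \<and> Ck_on 1 U h \<and> (\<forall>x\<in>U. \<not> (GDERIV h x :> 0)) \<and> \<Omega> \<inter> U = {x\<in>U. h x < 0}"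

definition C1_boundary :: "(real^'n) set \<Rightarrow> bool" where
  "C1_boundary \<Omega> \<longleftrightarrow> (\<forall>p\<in>frontier \<Omega>. \<exists>U h. local_defining_function \<Omega> p U h)"

definition outer_unit_normal :: "(real^'n) set \<Rightarrow> real^'n \<Rightarrow> real^'n \<Rightarrow> bool" where
  "outer_unit_normal \<Omega> p n \<longleftrightarrow>
     (\<exists>U h D. local_defining_function \<Omega> p U h \<and> (GDERIV h p :> D) \<and> n = D /\<^sub>R norm D)"

section \<open>The flow\<close>

text \<open>The value at time \<open>t\<close> of the solution of the initial value problem; it is only used for
  \<open>t \<ge> 0\<close>. For $C^1$ vector fields there is at most one such value.\<close>

definition flow :: "(real^'n \<Rightarrow> real^'n) \<Rightarrow> real \<Rightarrow> real^'n \<Rightarrow> real^'n" where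
  "flow f t z = (THE y. \<exists>x. x 0 = z \<and> x t = y \<and>
      (\<forall>s\<in>{0..t}. (x has_vector_derivative f (x s)) (at s within {0..t})))"

definition composition_semigroup ::
  "(real^'n \<Rightarrow> real^'n) \<Rightarrow> real \<Rightarrow> (real^'n \<Rightarrow> real) \<Rightarrow> real^'n \<Rightarrow> real" where
  "composition_semigroup f t \<phi> = \<phi> \<circ> flow f t"

section \<open>Weighted Lebesgue spaces\<close>

text \<open>The elements of the spaces are represented by functions on the whole of $\mathbb{R}^d$ of
  which only the values almost everywhere on \<open>\<Omega>\<close> matter: no quotient is taken, and the norms
  below are seminorms on representatives.\<close>

definition Lp :: "real \<Rightarrow> (real^'n) set \<Rightarrow> (real^'n \<Rightarrow> real) \<Rightarrow> (real^'n \<Rightarrow> real) set" where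
  "Lp p \<Omega> w = {\<phi> \<in> borel_measurable (lebesgue_on \<Omega>).
                 integrable (lebesgue_on \<Omega>) (\<lambda>x. \<bar>\<phi> x\<bar> powr p * w x)}"

definition Lp_norm :: "real \<Rightarrow> (real^'n) set \<Rightarrow> (real^'n \<Rightarrow> real) \<Rightarrow> (real^'n \<Rightarrow> real) \<Rightarrow> real" where
  "Lp_norm p \<Omega> w \<phi> = (LINT x|lebesgue_on \<Omega>. \<bar>\<phi> x\<bar> powr p * w x) powr (1 / p)"

definition Linf :: "(real^'n) set \<Rightarrow> (real^'n \<Rightarrow> real) \<Rightarrow> (real^'n \<Rightarrow> real) set" where
  "Linf \<Omega> w = {\<phi> \<in> borel_measurable (lebesgue_on \<Omega>).
                 esssup (lebesgue_on \<Omega>) (\<lambda>x. ereal \<bar>\<phi> x * w x\<bar>) < \<infinity>}"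

definition Linf_norm :: "(real^'n) set \<Rightarrow> (real^'n \<Rightarrow> real) \<Rightarrow> (real^'n \<Rightarrow> real) \<Rightarrow> real" where
  "Linf_norm \<Omega> w \<phi> = real_of_ereal (esssup (lebesgue_on \<Omega>) (\<lambda>x. ereal \<bar>\<phi> x * w x\<bar>))"

abbreviation X_space where "X_space \<Omega> w \<equiv> Lp 1 \<Omega> w"
abbreviation X_norm where "X_norm \<Omega> w \<equiv> Lp_norm 1 \<Omega> w"
abbreviation H_space where "H_space \<Omega> w \<equiv> Lp 2 \<Omega> (\<lambda>x. (w x)\<^sup>2)"
abbreviation H_norm where "H_norm \<Omega> w \<equiv> Lp_norm 2 \<Omega> (\<lambda>x. (w x)\<^sup>2)"

definition pairing :: "(real^'n) set \<Rightarrow> (real^'n \<Rightarrow> real) \<Rightarrow> (real^'n \<Rightarrow> real) \<Rightarrow> (real^'n \<Rightarrow> real) \<Rightarrow> real" where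
  "pairing \<Omega> w \<phi> \<psi> = (LINT x|lebesgue_on \<Omega>. \<phi> x * \<psi> x * (w x)\<^sup>2)"

section \<open>The Sobolev space $W^{1,\infty}$\<close>

definition test_function :: "(real^'n) set \<Rightarrow> (real^'n \<Rightarrow> real) \<Rightarrow> bool" where
  "test_function \<Omega> \<theta> \<longleftrightarrow> (\<forall>k. Ck_on k UNIV \<theta>) \<and>
     compact (closure {x. \<theta> x \<noteq> 0}) \<and> closure {x. \<theta> x \<noteq> 0} \<subseteq> \<Omega>"

definition locally_integrable :: "(real^'n) set \<Rightarrow> (real^'n \<Rightarrow> real) \<Rightarrow> bool" where
  "locally_integrable \<Omega> v \<longleftrightarrow> (\<forall>K. compact K \<and> K \<subseteq> \<Omega> \<longrightarrow> integrable (lebesgue_on K) v)"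

definition weak_gradient :: "(real^'n) set \<Rightarrow> (real^'n \<Rightarrow> real) \<Rightarrow> (real^'n \<Rightarrow> real^'n) \<Rightarrow> bool" where
  "weak_gradient \<Omega> v G \<longleftrightarrow>
     locally_integrable \<Omega> v \<and> (\<forall>i. locally_integrable \<Omega> (\<lambda>x. G x $ i)) \<and>
     (\<forall>\<theta> D i. test_function \<Omega> \<theta> \<and> (\<forall>x. GDERIV \<theta> x :> D x) \<longrightarrow>
        (LINT x|lebesgue_on \<Omega>. v x * D x $ i) = - (LINT x|lebesgue_on \<Omega>. G x $ i * \<theta> x))"

definition W1inf :: "(real^'n) set \<Rightarrow> (real^'n \<Rightarrow> real) set" where
  "W1inf \<Omega> = {v \<in> Linf \<Omega> (\<lambda>_. 1).
                 \<exists>G. weak_gradient \<Omega> v G \<and> (\<forall>i. (\<lambda>x. G x $ i) \<in> Linf \<Omega> (\<lambda>_. 1))}"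

section \<open>Operators, semigroups and bilinear forms\<close>

text \<open>In this section \<open>V\<close> is one of the function spaces above and \<open>N\<close> its norm. Identities between
  elements of \<open>V\<close> hold almost everywhere on \<open>\<Omega>\<close>. An operator that is linear in this sense and
  bounded respects equality almost everywhere, and so does a bounded bilinear form.\<close>

definition bounded_operator ::
  "(real^'n) set \<Rightarrow> (real^'n \<Rightarrow> real) set \<Rightarrow> ((real^'n \<Rightarrow> real) \<Rightarrow> real) \<Rightarrow>
   ((real^'n \<Rightarrow> real) \<Rightarrow> (real^'n \<Rightarrow> real)) \<Rightarrow> bool" where
  "bounded_operator \<Omega> V N T \<longleftrightarrow>
     (\<forall>\<phi>\<in>V. T \<phi> \<in> V) \<and>
     (\<forall>\<phi>\<in>V. \<forall>\<psi>\<in>V. \<forall>a b. AE x in lebesgue_on \<Omega>.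
        T (\<lambda>y. a * \<phi> y + b * \<psi> y) x = a * T \<phi> x + b * T \<psi> x) \<and>
     (\<exists>K. \<forall>\<phi>\<in>V. N (T \<phi>) \<le> K * N \<phi>)"

definition preadjoint ::
  "(real^'n) set \<Rightarrow> (real^'n \<Rightarrow> real) \<Rightarrow> (real^'n \<Rightarrow> real) set \<Rightarrow> ((real^'n \<Rightarrow> real) \<Rightarrow> real) \<Rightarrow>
   (real^'n \<Rightarrow> real) set \<Rightarrow> ((real^'n \<Rightarrow> real) \<Rightarrow> (real^'n \<Rightarrow> real)) \<Rightarrow>
   ((real^'n \<Rightarrow> real) \<Rightarrow> (real^'n \<Rightarrow> real)) \<Rightarrow> bool" where
  "preadjoint \<Omega> w V N Vdual T Tdual \<longleftrightarrow>
     bounded_operator \<Omega> V N T \<and>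
     (\<forall>\<rho>\<in>V. \<forall>\<phi>\<in>Vdual. pairing \<Omega> w (T \<rho>) \<phi> = pairing \<Omega> w \<rho> (Tdual \<phi>))"

definition C0_semigroup ::
  "(real^'n) set \<Rightarrow> (real^'n \<Rightarrow> real) set \<Rightarrow> ((real^'n \<Rightarrow> real) \<Rightarrow> real) \<Rightarrow>
   (real \<Rightarrow> (real^'n \<Rightarrow> real) \<Rightarrow> (real^'n \<Rightarrow> real)) \<Rightarrow> bool" where
  "C0_semigroup \<Omega> V N S \<longleftrightarrow>
     (\<forall>t\<ge>0. bounded_operator \<Omega> V N (S t)) \<and>
     (\<forall>\<phi>\<in>V. AE x in lebesgue_on \<Omega>. S 0 \<phi> x = \<phi> x) \<and>
     (\<forall>s\<ge>0. \<forall>t\<ge>0. \<forall>\<phi>\<in>V. AE x in lebesgue_on \<Omega>. S (s + t) \<phi> x = S s (S t \<phi>) x) \<and>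
     (\<forall>\<phi>\<in>V. ((\<lambda>t. N (\<lambda>x. S t \<phi> x - \<phi> x)) \<longlongrightarrow> 0) (at_right 0))"

definition exponentially_stable ::
  "(real^'n \<Rightarrow> real) set \<Rightarrow> ((real^'n \<Rightarrow> real) \<Rightarrow> real) \<Rightarrow>
   (real \<Rightarrow> (real^'n \<Rightarrow> real) \<Rightarrow> (real^'n \<Rightarrow> real)) \<Rightarrow> bool" where
  "exponentially_stable V N S \<longleftrightarrow>
     (\<exists>M \<omega>. M \<ge> 1 \<and> \<omega> < 0 \<and> (\<forall>t\<ge>0. \<forall>\<phi>\<in>V. N (S t \<phi>) \<le> M * exp (\<omega> * t) * N \<phi>))"

definition is_generator_value ::
  "(real^'n \<Rightarrow> real) set \<Rightarrow> ((real^'n \<Rightarrow> real) \<Rightarrow> real) \<Rightarrow>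
   (real \<Rightarrow> (real^'n \<Rightarrow> real) \<Rightarrow> (real^'n \<Rightarrow> real)) \<Rightarrow> (real^'n \<Rightarrow> real) \<Rightarrow> (real^'n \<Rightarrow> real) \<Rightarrow> bool" where
  "is_generator_value V N S \<phi> \<eta> \<longleftrightarrow> \<phi> \<in> V \<and> \<eta> \<in> V \<and>
     ((\<lambda>t. N (\<lambda>x. (S t \<phi> x - \<phi> x) / t - \<eta> x)) \<longlongrightarrow> 0) (at_right 0)"

definition generator_domain where
  "generator_domain V N S = {\<phi>. \<exists>\<eta>. is_generator_value V N S \<phi> \<eta>}"

text \<open>The value is determined up to equality almost everywhere; a representative is chosen.\<close>

definition generator where
  "generator V N S \<phi> = (SOME \<eta>. is_generator_value V N S \<phi> \<eta>)"

definition bounded_bilinear_form ::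
  "(real^'n \<Rightarrow> real) set \<Rightarrow> ((real^'n \<Rightarrow> real) \<Rightarrow> real) \<Rightarrow>
   ((real^'n \<Rightarrow> real) \<Rightarrow> (real^'n \<Rightarrow> real) \<Rightarrow> real) \<Rightarrow> bool" where
  "bounded_bilinear_form V N B \<longleftrightarrow>
     (\<forall>\<phi>\<in>V. \<forall>\<psi>\<in>V. \<forall>\<eta>\<in>V. \<forall>a b.
        B (\<lambda>x. a * \<phi> x + b * \<psi> x) \<eta> = a * B \<phi> \<eta> + b * B \<psi> \<eta> \<and>
        B \<eta> (\<lambda>x. a * \<phi> x + b * \<psi> x) = a * B \<eta> \<phi> + b * B \<eta> \<psi>) \<and>
     (\<exists>K. \<forall>\<phi>\<in>V. \<forall>\<psi>\<in>V. \<bar>B \<phi> \<psi>\<bar> \<le> K * N \<phi> * N \<psi>)"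

section \<open>Observation, value form and Lyapunov equation\<close>

definition ell2 :: "(nat \<Rightarrow> real) set" where
  "ell2 = {a. summable (\<lambda>i. (a i)\<^sup>2)}"

definition ell2_inner :: "(nat \<Rightarrow> real) \<Rightarrow> (nat \<Rightarrow> real) \<Rightarrow> real" where
  "ell2_inner a b = (\<Sum>i. a i * b i)"

definition observation ::
  "(real^'n) set \<Rightarrow> (real^'n \<Rightarrow> real) \<Rightarrow> (nat \<Rightarrow> real^'n \<Rightarrow> real) \<Rightarrow> (real^'n \<Rightarrow> real) \<Rightarrow> nat \<Rightarrow> real" where
  "observation \<Omega> w c \<phi> = (\<lambda>i. pairing \<Omega> w \<phi> (c i))"

definition value_form ::
  "((real^'n \<Rightarrow> real) \<Rightarrow> nat \<Rightarrow> real) \<Rightarrow> (real \<Rightarrow> (real^'n \<Rightarrow> real) \<Rightarrow> (real^'n \<Rightarrow> real)) \<Rightarrow>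
   (real^'n \<Rightarrow> real) \<Rightarrow> (real^'n \<Rightarrow> real) \<Rightarrow> real" where
  "value_form C S \<phi> \<psi> = (LINT t:{0..}|lborel. ell2_inner (C (S t \<phi>)) (C (S t \<psi>)))"

definition lyapunov_solution ::
  "(real^'n \<Rightarrow> real) set \<Rightarrow> ((real^'n \<Rightarrow> real) \<Rightarrow> real) \<Rightarrow>
   (real \<Rightarrow> (real^'n \<Rightarrow> real) \<Rightarrow> (real^'n \<Rightarrow> real)) \<Rightarrow> ((real^'n \<Rightarrow> real) \<Rightarrow> nat \<Rightarrow> real) \<Rightarrow>
   ((real^'n \<Rightarrow> real) \<Rightarrow> (real^'n \<Rightarrow> real) \<Rightarrow> real) \<Rightarrow> bool" where
  "lyapunov_solution V N S C Q \<longleftrightarrow>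
     bounded_bilinear_form V N Q \<and>
     (\<forall>\<phi>\<in>V. \<forall>\<psi>\<in>V. Q \<phi> \<psi> = Q \<psi> \<phi>) \<and> (\<forall>\<phi>\<in>V. 0 \<le> Q \<phi> \<phi>) \<and>
     (\<forall>\<phi>\<in>generator_domain V N S. \<forall>\<psi>\<in>generator_domain V N S.
        Q (generator V N S \<phi>) \<psi> + Q \<phi> (generator V N S \<psi>) + ell2_inner (C \<phi>) (C \<psi>) = 0)"

definition minimal_lyapunov_solution ::
  "(real^'n \<Rightarrow> real) set \<Rightarrow> ((real^'n \<Rightarrow> real) \<Rightarrow> real) \<Rightarrow>
   (real \<Rightarrow> (real^'n \<Rightarrow> real) \<Rightarrow> (real^'n \<Rightarrow> real)) \<Rightarrow> ((real^'n \<Rightarrow> real) \<Rightarrow> nat \<Rightarrow> real) \<Rightarrow>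
   ((real^'n \<Rightarrow> real) \<Rightarrow> (real^'n \<Rightarrow> real) \<Rightarrow> real) \<Rightarrow> bool" where
  "minimal_lyapunov_solution V N S C Q \<longleftrightarrow>
     lyapunov_solution V N S C Q \<and>
     (\<forall>Q'. lyapunov_solution V N S C Q' \<longrightarrow> (\<forall>\<phi>\<in>V. Q \<phi> \<phi> \<le> Q' \<phi> \<phi>))"

text \<open>\<open>B\<close> is a bounded bilinear form on \<open>V\<close> that extends the form \<open>Q\<close> on \<open>W \<subseteq> V\<close>, and the only one.\<close>

definition unique_bounded_extension ::
  "(real^'n \<Rightarrow> real) set \<Rightarrow> (real^'n \<Rightarrow> real) set \<Rightarrow> ((real^'n \<Rightarrow> real) \<Rightarrow> real) \<Rightarrow>
   ((real^'n \<Rightarrow> real) \<Rightarrow> (real^'n \<Rightarrow> real) \<Rightarrow> real) \<Rightarrow>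
   ((real^'n \<Rightarrow> real) \<Rightarrow> (real^'n \<Rightarrow> real) \<Rightarrow> real) \<Rightarrow> bool" where
  "unique_bounded_extension W V N Q B \<longleftrightarrow>
     W \<subseteq> V \<and> bounded_bilinear_form V N B \<and> (\<forall>\<phi>\<in>W. \<forall>\<psi>\<in>W. B \<phi> \<psi> = Q \<phi> \<psi>) \<and>
     (\<forall>B'. bounded_bilinear_form V N B' \<and> (\<forall>\<phi>\<in>W. \<forall>\<psi>\<in>W. B' \<phi> \<psi> = Q \<phi> \<psi>) \<longrightarrow>
        (\<forall>\<phi>\<in>V. \<forall>\<psi>\<in>V. B' \<phi> \<psi> = B \<phi> \<psi>))"

end

theory Submission
  imports Defs
begin

text \<open>
  Write \<open>G \<phi> \<psi>\<close> for the inner product of the observations of \<open>\<phi>\<close> and \<open>\<psi>\<close>, and \<open>P\<close> for the value form,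
  the time integral of \<open>G (S t \<phi>) (S t \<psi>)\<close>. Since the squared norms of the \<open>c i\<close> are summable, \<open>G\<close> is a
  bounded bilinear form on \<open>X\<close>; exponential stability makes the integrand decay exponentially, so \<open>P\<close> is
  a bounded bilinear form on \<open>X\<close>. Everything else happens on \<open>H\<close>, where \<open>S\<close> is strongly continuous.

  \<open>P\<close> solves the Lyapunov equation because \<open>P (S h \<phi>) (S h \<psi>)\<close> is the same integral taken from \<open>h\<close> on:
  its difference quotient at \<open>h = 0\<close> tends to \<open>- G \<phi> \<psi>\<close>, and for \<open>\<phi>\<close>, \<open>\<psi>\<close> in the domain of the
  generator \<open>A\<close> it also tends to \<open>P (A \<phi>) \<psi> + P \<phi> (A \<psi>)\<close> (\<open>value_form_lyapunov_equation\<close>).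

  \<open>P\<close> is minimal because the difference \<open>D\<close> of another solution \<open>Q\<close> and \<open>P\<close> solves the homogeneous
  equation, hence is constant along the orbit of every \<open>\<phi>\<close> in the domain of \<open>A\<close>
  (\<open>homogeneous_form_constant_on_orbit\<close>). As \<open>Q\<close> is nonnegative, \<open>D \<phi> \<phi> \<ge> - P (S t \<phi>) (S t \<phi>)\<close>, and
  the right-hand side tends to \<open>0\<close> since \<open>S t \<phi>\<close> decays in the norm of \<open>X\<close>, for which \<open>P\<close> is
  bounded. The inequality \<open>D \<phi> \<phi> \<ge> 0\<close> extends to all of \<open>H\<close> because the domain of \<open>A\<close> is
  dense (\<open>generator_domain_dense\<close>). Two minimal solutions have the same diagonal, so they agree by
  polarization, and the extension to \<open>X\<close> is unique because \<open>H\<close> is dense in \<open>X\<close> (\<open>H_dense_in_X\<close>).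

  Two facts from semigroup theory are proved on the way. The operators \<open>S t\<close> are bounded on \<open>H\<close> uniformly
  for \<open>t\<close> in a bounded interval; this is the uniform boundedness principle, obtained by a gliding hump
  argument. And the means of an orbit over short time intervals lie in the domain of \<open>A\<close>; as
  elements of \<open>H\<close> are represented by functions, these means are constructed as limits of Riemann sums,
  whose convergence and whose behaviour under \<open>S t\<close> are read off from the scalar integrals obtained by
  pairing with elements of \<open>H\<close>. Both rest on the completeness of \<open>H\<close>.
\<close>

section \<open>Seminormed spaces of functions, bilinear forms and operators\<close>

text \<open>The space consists of representatives, so \<open>N\<close> takes the same value at functions that agree
  almost everywhere. Absolute homogeneity and nonnegativity follow from \<open>N_lin\<close>.\<close>

locale seminormed_function_space =
  fixes \<Omega> :: "(real^'n) set"
    and V :: "(real^'n \<Rightarrow> real) set"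
    and N :: "(real^'n \<Rightarrow> real) \<Rightarrow> real"
  assumes zero_mem: "(\<lambda>_. 0) \<in> V"
    and lin_mem: "\<phi> \<in> V \<Longrightarrow> \<psi> \<in> V \<Longrightarrow> (\<lambda>x. a * \<phi> x + b * \<psi> x) \<in> V"
    and N_lin: "\<phi> \<in> V \<Longrightarrow> \<psi> \<in> V \<Longrightarrow> N (\<lambda>x. a * \<phi> x + b * \<psi> x) \<le> \<bar>a\<bar> * N \<phi> + \<bar>b\<bar> * N \<psi>"
    and N_cong: "\<phi> \<in> V \<Longrightarrow> \<psi> \<in> V \<Longrightarrow> AE x in lebesgue_on \<Omega>. \<phi> x = \<psi> x \<Longrightarrow> N \<phi> = N \<psi>"
begin

lemma diff_mem: "\<phi> \<in> V \<Longrightarrow> \<psi> \<in> V \<Longrightarrow> (\<lambda>x. \<phi> x - \<psi> x) \<in> V"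
  using lin_mem[of \<phi> \<psi> 1 "-1"] by simp

lemma add_mem: "\<phi> \<in> V \<Longrightarrow> \<psi> \<in> V \<Longrightarrow> (\<lambda>x. \<phi> x + \<psi> x) \<in> V"
  using lin_mem[of \<phi> \<psi> 1 1] by simp

lemma scale_mem: "\<phi> \<in> V \<Longrightarrow> (\<lambda>x. a * \<phi> x) \<in> V"
  using lin_mem[of \<phi> \<phi> a 0] by simp

lemma divide_mem: "\<phi> \<in> V \<Longrightarrow> (\<lambda>x. \<phi> x / a) \<in> V"
  using scale_mem[of \<phi> "1/a"] by simp

lemma sum_mem: "finite I \<Longrightarrow> (\<And>i. i \<in> I \<Longrightarrow> u i \<in> V) \<Longrightarrow> (\<lambda>x. \<Sum>i\<in>I. u i x) \<in> V"
  by (induction I rule: finite_induct) (auto intro: zero_mem add_mem)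

lemmas mem_intros = zero_mem diff_mem add_mem scale_mem divide_mem sum_mem

lemma N_zero: "N (\<lambda>_. 0) = 0"
  using N_lin[OF zero_mem zero_mem, of 0 0] N_lin[OF zero_mem zero_mem, of 1 1] by simp

lemma N_nonneg: "\<phi> \<in> V \<Longrightarrow> 0 \<le> N \<phi>"
  using N_lin[of \<phi> \<phi> 1 "-1"] N_zero by simp

lemma N_add: "\<phi> \<in> V \<Longrightarrow> \<psi> \<in> V \<Longrightarrow> N (\<lambda>x. \<phi> x + \<psi> x) \<le> N \<phi> + N \<psi>"
  using N_lin[of \<phi> \<psi> 1 1] by simp

lemma N_scale_le: "\<phi> \<in> V \<Longrightarrow> N (\<lambda>x. a * \<phi> x) \<le> \<bar>a\<bar> * N \<phi>"
  using N_lin[of \<phi> \<phi> a 0] by simp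

lemma N_scale: "\<phi> \<in> V \<Longrightarrow> N (\<lambda>x. a * \<phi> x) = \<bar>a\<bar> * N \<phi>"
proof (cases "a = 0")
  case True
  then show ?thesis by (simp add: N_zero)
next
  case False
  assume V: "\<phi> \<in> V"
  have "\<bar>a\<bar> * N \<phi> \<le> \<bar>a\<bar> * (\<bar>1/a\<bar> * N (\<lambda>x. a * \<phi> x))"
    using N_scale_le[OF scale_mem[OF V, of a], of "1/a"] False by (intro mult_left_mono) auto
  then show ?thesis using N_scale_le[OF V, of a] False by simp
qed

lemma N_triangle:
  "\<phi> \<in> V \<Longrightarrow> \<psi> \<in> V \<Longrightarrow> \<eta> \<in> V \<Longrightarrow> N (\<lambda>x. \<phi> x - \<eta> x) \<le> N (\<lambda>x. \<phi> x - \<psi> x) + N (\<lambda>x. \<psi> x - \<eta> x)"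
  using N_add[OF diff_mem[of \<phi> \<psi>] diff_mem[of \<psi> \<eta>]] by simp

lemma N_diff_commute: "\<phi> \<in> V \<Longrightarrow> \<psi> \<in> V \<Longrightarrow> N (\<lambda>x. \<phi> x - \<psi> x) = N (\<lambda>x. \<psi> x - \<phi> x)"
  using N_scale[OF diff_mem[of \<phi> \<psi>], of "-1"] by simp

lemma N_le_diff: "\<phi> \<in> V \<Longrightarrow> \<psi> \<in> V \<Longrightarrow> N \<phi> \<le> N (\<lambda>x. \<phi> x - \<psi> x) + N \<psi>"
  using N_add[OF diff_mem[of \<phi> \<psi>], of \<psi>] by simp

lemma N_diff_le: "\<phi> \<in> V \<Longrightarrow> \<psi> \<in> V \<Longrightarrow> N (\<lambda>x. \<phi> x - \<psi> x) \<le> N \<phi> + N \<psi>"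
  using N_lin[of \<phi> \<psi> 1 "-1"] by simp

lemma limit_unique:
  assumes "\<phi> \<in> V" "\<psi> \<in> V" "F \<noteq> bot" "\<forall>\<^sub>F h in F. u h \<in> V"
    and "((\<lambda>h. N (\<lambda>x. u h x - \<phi> x)) \<longlongrightarrow> 0) F" "((\<lambda>h. N (\<lambda>x. u h x - \<psi> x)) \<longlongrightarrow> 0) F"
  shows "N (\<lambda>x. \<phi> x - \<psi> x) = 0"
proof -
  have "((\<lambda>h. N (\<lambda>x. u h x - \<phi> x) + N (\<lambda>x. u h x - \<psi> x)) \<longlongrightarrow> 0 + 0) F"
    by (intro tendsto_add assms)
  moreover have "\<forall>\<^sub>F h in F. N (\<lambda>x. \<phi> x - \<psi> x) \<le> N (\<lambda>x. u h x - \<phi> x) + N (\<lambda>x. u h x - \<psi> x)"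
    using assms(4) by eventually_elim
      (use N_triangle[OF assms(1) _ assms(2)] N_diff_commute[OF assms(1)] in fastforce)
  ultimately have "N (\<lambda>x. \<phi> x - \<psi> x) \<le> 0 + 0"
    using assms(3) tendsto_lowerbound by blast
  then show ?thesis using N_nonneg[OF diff_mem[OF assms(1,2)]] by simp
qed

lemma bilinear_lin:
  assumes "bounded_bilinear_form V N B" "\<phi> \<in> V" "\<psi> \<in> V" "\<eta> \<in> V"
  shows "B (\<lambda>x. a * \<phi> x + b * \<psi> x) \<eta> = a * B \<phi> \<eta> + b * B \<psi> \<eta>"
    "B \<eta> (\<lambda>x. a * \<phi> x + b * \<psi> x) = a * B \<eta> \<phi> + b * B \<eta> \<psi>"
  using assms unfolding bounded_bilinear_form_def by blast+

lemma bilinear_diff: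
  assumes "bounded_bilinear_form V N B" "\<phi> \<in> V" "\<psi> \<in> V" "\<eta> \<in> V"
  shows "B (\<lambda>x. \<phi> x - \<psi> x) \<eta> = B \<phi> \<eta> - B \<psi> \<eta>" "B \<eta> (\<lambda>x. \<phi> x - \<psi> x) = B \<eta> \<phi> - B \<eta> \<psi>"
  using bilinear_lin[OF assms, of 1 "-1"] by simp_all

lemma bilinear_divide:
  assumes "bounded_bilinear_form V N B" "\<phi> \<in> V" "\<eta> \<in> V"
  shows "B (\<lambda>x. \<phi> x / a) \<eta> = B \<phi> \<eta> / a" "B \<eta> (\<lambda>x. \<phi> x / a) = B \<eta> \<phi> / a"
  using bilinear_lin[OF assms(1,2,2,3), of "1 / a" 0] by simp_all

lemma bilinear_bound:
  assumes "bounded_bilinear_form V N B"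
  obtains K where "0 \<le> K" "\<And>\<phi> \<psi>. \<phi> \<in> V \<Longrightarrow> \<psi> \<in> V \<Longrightarrow> \<bar>B \<phi> \<psi>\<bar> \<le> K * (N \<phi> * N \<psi>)"
proof -
  obtain K where K: "\<And>\<phi> \<psi>. \<phi> \<in> V \<Longrightarrow> \<psi> \<in> V \<Longrightarrow> \<bar>B \<phi> \<psi>\<bar> \<le> K * N \<phi> * N \<psi>"
    using assms unfolding bounded_bilinear_form_def by blast
  show ?thesis
  proof
    show "0 \<le> max K 0" by simp
    fix \<phi> \<psi> assume V: "\<phi> \<in> V" "\<psi> \<in> V"
    have "K * (N \<phi> * N \<psi>) \<le> max K 0 * (N \<phi> * N \<psi>)"
      using N_nonneg V by (intro mult_right_mono) auto
    then show "\<bar>B \<phi> \<psi>\<bar> \<le> max K 0 * (N \<phi> * N \<psi>)" using K[OF V] by (simp add: mult.assoc)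
  qed
qed

lemma bilinear_form_diff:
  assumes B: "bounded_bilinear_form V N B" and B': "bounded_bilinear_form V N B'"
  shows "bounded_bilinear_form V N (\<lambda>\<phi> \<psi>. B \<phi> \<psi> - B' \<phi> \<psi>)"
proof -
  obtain K where "0 \<le> K" and K: "\<And>\<phi> \<psi>. \<phi> \<in> V \<Longrightarrow> \<psi> \<in> V \<Longrightarrow> \<bar>B \<phi> \<psi>\<bar> \<le> K * (N \<phi> * N \<psi>)"
    using bilinear_bound[OF B] by blast
  obtain K' where "0 \<le> K'" and K': "\<And>\<phi> \<psi>. \<phi> \<in> V \<Longrightarrow> \<psi> \<in> V \<Longrightarrow> \<bar>B' \<phi> \<psi>\<bar> \<le> K' * (N \<phi> * N \<psi>)"
    using bilinear_bound[OF B'] by blast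
  have "\<bar>B \<phi> \<psi> - B' \<phi> \<psi>\<bar> \<le> (K + K') * N \<phi> * N \<psi>" if "\<phi> \<in> V" "\<psi> \<in> V" for \<phi> \<psi>
    using K[OF that] K'[OF that] by (simp add: algebra_simps)
  moreover have "B (\<lambda>x. a * \<phi> x + b * \<psi> x) \<eta> - B' (\<lambda>x. a * \<phi> x + b * \<psi> x) \<eta> =
        a * (B \<phi> \<eta> - B' \<phi> \<eta>) + b * (B \<psi> \<eta> - B' \<psi> \<eta>) \<and>
      B \<eta> (\<lambda>x. a * \<phi> x + b * \<psi> x) - B' \<eta> (\<lambda>x. a * \<phi> x + b * \<psi> x) =
        a * (B \<eta> \<phi> - B' \<eta> \<phi>) + b * (B \<eta> \<psi> - B' \<eta> \<psi>)"
    if "\<phi> \<in> V" "\<psi> \<in> V" "\<eta> \<in> V" for \<phi> \<psi> \<eta> a b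
    unfolding bilinear_lin[OF B that] bilinear_lin[OF B' that] by (simp add: algebra_simps)
  ultimately show ?thesis unfolding bounded_bilinear_form_def by blast
qed

lemma symmetric_form_determined_by_diagonal:
  assumes B: "bounded_bilinear_form V N B" "\<And>\<phi> \<psi>. \<phi> \<in> V \<Longrightarrow> \<psi> \<in> V \<Longrightarrow> B \<phi> \<psi> = B \<psi> \<phi>"
    and B': "bounded_bilinear_form V N B'" "\<And>\<phi> \<psi>. \<phi> \<in> V \<Longrightarrow> \<psi> \<in> V \<Longrightarrow> B' \<phi> \<psi> = B' \<psi> \<phi>"
    and diag: "\<And>\<phi>. \<phi> \<in> V \<Longrightarrow> B \<phi> \<phi> = B' \<phi> \<phi>" and V: "\<phi> \<in> V" "\<psi> \<in> V"
  shows "B \<phi> \<psi> = B' \<phi> \<psi>"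
proof -
  let ?d = "\<lambda>x. \<phi> x - \<psi> x"
  have d: "?d \<in> V" by (intro diff_mem V)
  have expand: "A ?d ?d = A \<phi> \<phi> - 2 * A \<phi> \<psi> + A \<psi> \<psi>"
    if A: "bounded_bilinear_form V N A" "A \<phi> \<psi> = A \<psi> \<phi>" for A
    using bilinear_diff(1)[OF A(1) V d] bilinear_diff(2)[OF A(1) V V(1)] bilinear_diff(2)[OF A(1) V V(2)] A(2)
    by simp
  show ?thesis
    using expand[OF B(1) B(2)[OF V]] expand[OF B'(1) B'(2)[OF V]] diag[OF d] diag[OF V(1)] diag[OF V(2)]
    by simp
qed

text \<open>Linearity of a form is required for pointwise combinations only; that it does not see the choice
  of representatives is a consequence of boundedness.\<close>

lemma bilinear_eq:
  assumes B: "bounded_bilinear_form V N B"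
    and V: "\<phi> \<in> V" "\<phi>' \<in> V" "\<psi> \<in> V" "\<psi>' \<in> V"
    and z: "N (\<lambda>x. \<phi> x - \<phi>' x) = 0" "N (\<lambda>x. \<psi> x - \<psi>' x) = 0"
  shows "B \<phi> \<psi> = B \<phi>' \<psi>'"
proof -
  obtain K where K: "0 \<le> K" "\<And>\<phi> \<psi>. \<phi> \<in> V \<Longrightarrow> \<psi> \<in> V \<Longrightarrow> \<bar>B \<phi> \<psi>\<bar> \<le> K * (N \<phi> * N \<psi>)"
    using bilinear_bound[OF B] by blast
  have "B (\<lambda>x. \<phi> x - \<phi>' x) \<psi> = 0" "B \<phi>' (\<lambda>x. \<psi> x - \<psi>' x) = 0"
    using K(2)[OF diff_mem[OF V(1,2)] V(3)] K(2)[OF V(2) diff_mem[OF V(3,4)]] z by auto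
  then show ?thesis
    using bilinear_diff[OF B V(1,2,3)] bilinear_diff[OF B V(3,4,2)] by simp
qed

lemma N_diff_AE_zero:
  assumes "\<phi> \<in> V" "\<psi> \<in> V" "AE x in lebesgue_on \<Omega>. \<phi> x = \<psi> x"
  shows "N (\<lambda>x. \<phi> x - \<psi> x) = 0"
proof -
  have "N (\<lambda>x. \<phi> x - \<psi> x) = N (\<lambda>_. 0)"
    using assms(3) by (intro N_cong mem_intros assms) auto
  then show ?thesis by (simp add: N_zero)
qed

lemma bilinear_cong:
  assumes "bounded_bilinear_form V N B" "\<phi> \<in> V" "\<phi>' \<in> V" "\<psi> \<in> V" "\<psi>' \<in> V"
    and "AE x in lebesgue_on \<Omega>. \<phi> x = \<phi>' x" "AE x in lebesgue_on \<Omega>. \<psi> x = \<psi>' x"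
  shows "B \<phi> \<psi> = B \<phi>' \<psi>'"
  using bilinear_eq[OF assms(1-5)] N_diff_AE_zero assms by blast

lemma bilinear_tendsto:
  assumes B: "bounded_bilinear_form V N B"
    and V: "\<phi> \<in> V" "\<psi> \<in> V" and ev: "\<forall>\<^sub>F h in F. u h \<in> V" "\<forall>\<^sub>F h in F. v h \<in> V"
    and u: "((\<lambda>h. N (\<lambda>x. u h x - \<phi> x)) \<longlongrightarrow> 0) F" and v: "((\<lambda>h. N (\<lambda>x. v h x - \<psi> x)) \<longlongrightarrow> 0) F"
  shows "((\<lambda>h. B (u h) (v h)) \<longlongrightarrow> B \<phi> \<psi>) F"
proof -
  obtain K where K: "0 \<le> K" "\<And>\<phi> \<psi>. \<phi> \<in> V \<Longrightarrow> \<psi> \<in> V \<Longrightarrow> \<bar>B \<phi> \<psi>\<bar> \<le> K * (N \<phi> * N \<psi>)"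
    using bilinear_bound[OF B] by blast
  let ?p = "\<lambda>h. N (\<lambda>x. u h x - \<phi> x)" and ?q = "\<lambda>h. N (\<lambda>x. v h x - \<psi> x)"
  have "((\<lambda>h. K * (?p h * (?q h + N \<psi>)) + K * (N \<phi> * ?q h)) \<longlongrightarrow> K * (0 * (0 + N \<psi>)) + K * (N \<phi> * 0)) F"
    by (intro tendsto_intros u v)
  then have lim: "((\<lambda>h. K * (?p h * (?q h + N \<psi>)) + K * (N \<phi> * ?q h)) \<longlongrightarrow> 0) F" by simp
  have "\<forall>\<^sub>F h in F. norm (B (u h) (v h) - B \<phi> \<psi>) \<le> K * (?p h * (?q h + N \<psi>)) + K * (N \<phi> * ?q h)"
    using ev
  proof eventually_elim
    case (elim h)
    have "B (u h) (v h) - B \<phi> \<psi> = B (\<lambda>x. u h x - \<phi> x) (v h) + B \<phi> (\<lambda>x. v h x - \<psi> x)"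
      using bilinear_diff[OF B elim(1) V(1) elim(2)] bilinear_diff[OF B elim(2) V(2) V(1)] by simp
    moreover have "\<bar>B (\<lambda>x. u h x - \<phi> x) (v h)\<bar> \<le> K * (?p h * N (v h))"
      by (intro K diff_mem elim V)
    moreover have "K * (?p h * N (v h)) \<le> K * (?p h * (?q h + N \<psi>))"
      using N_le_diff[OF elim(2) V(2)] K(1) N_nonneg[OF diff_mem[OF elim(1) V(1)]]
      by (intro mult_left_mono)
    moreover have "\<bar>B \<phi> (\<lambda>x. v h x - \<psi> x)\<bar> \<le> K * (N \<phi> * ?q h)"
      by (intro K diff_mem elim V)
    ultimately show ?case by simp
  qed
  then have "((\<lambda>h. B (u h) (v h) - B \<phi> \<psi>) \<longlongrightarrow> 0) F" by (rule Lim_null_comparison) (rule lim)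
  then show ?thesis by (simp add: LIM_zero_iff)
qed

lemma bilinear_determined_by_dense:
  assumes B: "bounded_bilinear_form V N B" "bounded_bilinear_form V N B'"
    and U: "U \<subseteq> V" "\<And>\<phi>. \<phi> \<in> V \<Longrightarrow> \<exists>u. (\<forall>n. u n \<in> U) \<and> (\<lambda>n. N (\<lambda>x. u n x - \<phi> x)) \<longlonglongrightarrow> 0"
    and eq: "\<And>\<phi> \<psi>. \<phi> \<in> U \<Longrightarrow> \<psi> \<in> U \<Longrightarrow> B \<phi> \<psi> = B' \<phi> \<psi>"
    and V: "\<phi> \<in> V" "\<psi> \<in> V"
  shows "B \<phi> \<psi> = B' \<phi> \<psi>"
proof -
  obtain u v where uv: "\<forall>n. u n \<in> U" "(\<lambda>n. N (\<lambda>x. u n x - \<phi> x)) \<longlonglongrightarrow> 0"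
    "\<forall>n. v n \<in> U" "(\<lambda>n. N (\<lambda>x. v n x - \<psi> x)) \<longlonglongrightarrow> 0"
    using U(2) V by meson
  have lim: "(\<lambda>n. C (u n) (v n)) \<longlonglongrightarrow> C \<phi> \<psi>" if "bounded_bilinear_form V N C" for C
    using uv U(1) by (intro bilinear_tendsto[OF that V]) (auto intro!: always_eventually)
  have "(\<lambda>n. B (u n) (v n)) = (\<lambda>n. B' (u n) (v n))" using uv eq by auto
  then show ?thesis using lim[OF B(1)] lim[OF B(2)] LIMSEQ_unique by metis
qed

lemma operator_mem: "bounded_operator \<Omega> V N T \<Longrightarrow> \<phi> \<in> V \<Longrightarrow> T \<phi> \<in> V"
  unfolding bounded_operator_def by blast

lemma operator_lin:
  "bounded_operator \<Omega> V N T \<Longrightarrow> \<phi> \<in> V \<Longrightarrow> \<psi> \<in> V \<Longrightarrow>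
     AE x in lebesgue_on \<Omega>. T (\<lambda>y. a * \<phi> y + b * \<psi> y) x = a * T \<phi> x + b * T \<psi> x"
  unfolding bounded_operator_def by blast

lemma operator_diff:
  "bounded_operator \<Omega> V N T \<Longrightarrow> \<phi> \<in> V \<Longrightarrow> \<psi> \<in> V \<Longrightarrow>
     AE x in lebesgue_on \<Omega>. T (\<lambda>y. \<phi> y - \<psi> y) x = T \<phi> x - T \<psi> x"
  using operator_lin[of T \<phi> \<psi> 1 "-1"] by simp

lemma operator_add:
  "bounded_operator \<Omega> V N T \<Longrightarrow> \<phi> \<in> V \<Longrightarrow> \<psi> \<in> V \<Longrightarrow>
     AE x in lebesgue_on \<Omega>. T (\<lambda>y. \<phi> y + \<psi> y) x = T \<phi> x + T \<psi> x"
  using operator_lin[of T \<phi> \<psi> 1 1] by simp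

lemma operator_scale:
  "bounded_operator \<Omega> V N T \<Longrightarrow> \<phi> \<in> V \<Longrightarrow> AE x in lebesgue_on \<Omega>. T (\<lambda>y. a * \<phi> y) x = a * T \<phi> x"
  using operator_lin[of T \<phi> \<phi> a 0] by simp

lemma operator_zero: "bounded_operator \<Omega> V N T \<Longrightarrow> AE x in lebesgue_on \<Omega>. T (\<lambda>_. 0) x = 0"
  using operator_lin[of T "\<lambda>_. 0" "\<lambda>_. 0" 0 0] zero_mem by simp

lemma operator_sum:
  assumes T: "bounded_operator \<Omega> V N T" and "finite I" "\<And>i. i \<in> I \<Longrightarrow> u i \<in> V"
  shows "AE x in lebesgue_on \<Omega>. T (\<lambda>y. \<Sum>i\<in>I. u i y) x = (\<Sum>i\<in>I. T (u i) x)"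
  using assms(2,3)
proof (induction I rule: finite_induct)
  case empty
  then show ?case using operator_zero[OF T] by simp
next
  case (insert i I)
  have "AE x in lebesgue_on \<Omega>. T (\<lambda>y. u i y + (\<Sum>i\<in>I. u i y)) x = T (u i) x + T (\<lambda>y. \<Sum>i\<in>I. u i y) x"
    using insert by (intro operator_add[OF T] sum_mem) auto
  moreover have "AE x in lebesgue_on \<Omega>. T (\<lambda>y. \<Sum>i\<in>I. u i y) x = (\<Sum>i\<in>I. T (u i) x)"
    using insert by blast
  ultimately show ?case using insert(1,2) by auto
qed

lemma operator_diff_norm:
  assumes T: "bounded_operator \<Omega> V N T" and V: "\<phi> \<in> V" "\<psi> \<in> V"
  shows "N (\<lambda>x. T \<phi> x - T \<psi> x) = N (T (\<lambda>x. \<phi> x - \<psi> x))"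
  using operator_diff[OF T V] by (intro N_cong mem_intros operator_mem[OF T] V) auto

lemma operator_bound:
  assumes "bounded_operator \<Omega> V N T"
  obtains K where "0 \<le> K" "\<And>\<phi>. \<phi> \<in> V \<Longrightarrow> N (T \<phi>) \<le> K * N \<phi>"
proof -
  obtain K where K: "\<And>\<phi>. \<phi> \<in> V \<Longrightarrow> N (T \<phi>) \<le> K * N \<phi>"
    using assms unfolding bounded_operator_def by blast
  show ?thesis
  proof
    show "0 \<le> max K 0" by simp
    fix \<phi> assume V: "\<phi> \<in> V"
    have "K * N \<phi> \<le> max K 0 * N \<phi>" using N_nonneg[OF V] by (intro mult_right_mono) auto
    then show "N (T \<phi>) \<le> max K 0 * N \<phi>" using K[OF V] by simp
  qed
qed

lemma operator_tendsto:
  assumes T: "bounded_operator \<Omega> V N T" and V: "\<phi> \<in> V" and ev: "\<forall>\<^sub>F h in F. u h \<in> V"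
    and u: "((\<lambda>h. N (\<lambda>x. u h x - \<phi> x)) \<longlongrightarrow> 0) F"
  shows "((\<lambda>h. N (\<lambda>x. T (u h) x - T \<phi> x)) \<longlongrightarrow> 0) F"
proof -
  obtain K where K: "0 \<le> K" "\<And>\<phi>. \<phi> \<in> V \<Longrightarrow> N (T \<phi>) \<le> K * N \<phi>"
    using operator_bound[OF T] by blast
  have "((\<lambda>h. K * N (\<lambda>x. u h x - \<phi> x)) \<longlongrightarrow> K * 0) F" by (intro tendsto_intros u)
  then have lim: "((\<lambda>h. K * N (\<lambda>x. u h x - \<phi> x)) \<longlongrightarrow> 0) F" by simp
  show ?thesis
  proof (rule Lim_null_comparison[OF _ lim])
    show "\<forall>\<^sub>F h in F. norm (N (\<lambda>x. T (u h) x - T \<phi> x)) \<le> K * N (\<lambda>x. u h x - \<phi> x)"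
      using ev
    proof eventually_elim
      case (elim h)
      then show ?case
        using K(2)[OF diff_mem[OF elim V]] operator_diff_norm[OF T elim V]
          N_nonneg[OF operator_mem[OF T diff_mem[OF elim V]]] by simp
    qed
  qed
qed

end

section \<open>Strongly continuous semigroups\<close>

context seminormed_function_space
begin

lemma semigroup_operator: "C0_semigroup \<Omega> V N S \<Longrightarrow> 0 \<le> t \<Longrightarrow> bounded_operator \<Omega> V N (S t)"
  unfolding C0_semigroup_def by blast

lemma semigroup_mem: "C0_semigroup \<Omega> V N S \<Longrightarrow> 0 \<le> t \<Longrightarrow> \<phi> \<in> V \<Longrightarrow> S t \<phi> \<in> V"
  using semigroup_operator operator_mem by blast

lemma semigroup_zero: "C0_semigroup \<Omega> V N S \<Longrightarrow> \<phi> \<in> V \<Longrightarrow> AE x in lebesgue_on \<Omega>. S 0 \<phi> x = \<phi> x"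
  unfolding C0_semigroup_def by blast

lemma semigroup_add:
  "C0_semigroup \<Omega> V N S \<Longrightarrow> 0 \<le> s \<Longrightarrow> 0 \<le> t \<Longrightarrow> \<phi> \<in> V \<Longrightarrow>
     AE x in lebesgue_on \<Omega>. S (s + t) \<phi> x = S s (S t \<phi>) x"
  unfolding C0_semigroup_def by blast

lemma semigroup_tendsto:
  "C0_semigroup \<Omega> V N S \<Longrightarrow> \<phi> \<in> V \<Longrightarrow> ((\<lambda>t. N (\<lambda>x. S t \<phi> x - \<phi> x)) \<longlongrightarrow> 0) (at_right 0)"
  unfolding C0_semigroup_def by blast

text \<open>Including \<open>h = 0\<close>, which the limit from the right leaves out, saves case distinctions for
  increments of orbits.\<close>

lemma semigroup_near_zero:
  assumes S: "C0_semigroup \<Omega> V N S" and V: "\<phi> \<in> V" and e: "0 < e"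
  obtains \<delta> where "0 < \<delta>" "\<And>h. 0 \<le> h \<Longrightarrow> h < \<delta> \<Longrightarrow> N (\<lambda>x. S h \<phi> x - \<phi> x) < e"
proof -
  have "\<forall>\<^sub>F h in at_right 0. N (\<lambda>x. S h \<phi> x - \<phi> x) < e"
    using order_tendstoD(2)[OF semigroup_tendsto[OF S V] e] .
  then obtain \<delta> where \<delta>: "0 < \<delta>" "\<And>h. 0 < h \<Longrightarrow> h < \<delta> \<Longrightarrow> N (\<lambda>x. S h \<phi> x - \<phi> x) < e"
    unfolding eventually_at_right_field by blast
  have "N (\<lambda>x. S 0 \<phi> x - \<phi> x) < e"
    using N_diff_AE_zero[OF semigroup_mem[OF S _ V] V semigroup_zero[OF S V]] e by simp
  then show ?thesis using that[OF \<delta>(1)] \<delta>(2) by (metis less_eq_real_def)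
qed

lemma semigroup_increment:
  assumes S: "C0_semigroup \<Omega> V N S" and V: "\<phi> \<in> V" and "0 \<le> s" "s \<le> t"
  shows "N (\<lambda>x. S t \<phi> x - S s \<phi> x) = N (S s (\<lambda>x. S (t - s) \<phi> x - \<phi> x))"
proof -
  have m: "S (t - s) \<phi> \<in> V" "S s \<phi> \<in> V" "S t \<phi> \<in> V"
    using semigroup_mem[OF S _ V] assms by auto
  have "AE x in lebesgue_on \<Omega>. S (s + (t - s)) \<phi> x = S s (S (t - s) \<phi>) x"
    using assms by (intro semigroup_add[OF S]) auto
  moreover have "AE x in lebesgue_on \<Omega>. S s (\<lambda>x. S (t - s) \<phi> x - \<phi> x) x = S s (S (t - s) \<phi>) x - S s \<phi> x"
    by (intro operator_diff semigroup_operator[OF S] assms m)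
  ultimately show ?thesis
    using m V assms by (intro N_cong mem_intros semigroup_mem[OF S]) auto
qed

lemma generator_value_unique:
  assumes S: "C0_semigroup \<Omega> V N S"
    and "is_generator_value V N S \<phi> \<eta>" "is_generator_value V N S \<phi> \<zeta>"
  shows "N (\<lambda>x. \<eta> x - \<zeta> x) = 0"
proof (rule limit_unique)
  show "\<forall>\<^sub>F h in at_right 0. (\<lambda>x. (S h \<phi> x - \<phi> x) / h) \<in> V"
    using assms(2) unfolding is_generator_value_def
    by (auto simp: eventually_at_right_field intro!: exI[of _ 1] mem_intros semigroup_mem[OF S])
qed (use assms(2,3) in \<open>auto simp: is_generator_value_def\<close>)

lemma generator_value: "\<phi> \<in> generator_domain V N S \<Longrightarrow> is_generator_value V N S \<phi> (generator V N S \<phi>)"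
  using someI_ex[of "is_generator_value V N S \<phi>"] by (simp add: generator_domain_def generator_def)

lemma semigroup_difference_quotient:
  assumes S: "C0_semigroup \<Omega> V N S" and V: "\<phi> \<in> V" "\<eta> \<in> V" and t: "0 \<le> t" and h: "0 < h"
  shows "N (\<lambda>x. (S (t + h) \<phi> x - S t \<phi> x) / h - S t \<eta> x) = N (S t (\<lambda>x. (S h \<phi> x - \<phi> x) / h - \<eta> x))"
proof (rule N_cong)
  note Smem = semigroup_mem[OF S]
  have m: "S h \<phi> \<in> V" "S t \<phi> \<in> V" "S (t + h) \<phi> \<in> V" "S t \<eta> \<in> V"
    using h t V Smem by auto
  show "(\<lambda>x. (S (t + h) \<phi> x - S t \<phi> x) / h - S t \<eta> x) \<in> V"
    "S t (\<lambda>x. (S h \<phi> x - \<phi> x) / h - \<eta> x) \<in> V"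
    by (intro mem_intros m V Smem t)+
  have "AE x in lebesgue_on \<Omega>. S t (\<lambda>x. 1 / h * (S h \<phi> x - \<phi> x) + (-1) * \<eta> x) x =
      1 / h * S t (\<lambda>x. S h \<phi> x - \<phi> x) x + (-1) * S t \<eta> x"
    by (intro operator_lin semigroup_operator[OF S t] diff_mem m V)
  moreover have "AE x in lebesgue_on \<Omega>. S t (\<lambda>x. S h \<phi> x - \<phi> x) x = S t (S h \<phi>) x - S t \<phi> x"
    by (intro operator_diff semigroup_operator[OF S t] m V)
  moreover have "AE x in lebesgue_on \<Omega>. S (t + h) \<phi> x = S t (S h \<phi>) x"
    using h by (intro semigroup_add[OF S] t V) auto
  moreover have "(\<lambda>x. 1 / h * (S h \<phi> x - \<phi> x) + (-1) * \<eta> x) = (\<lambda>x. (S h \<phi> x - \<phi> x) / h - \<eta> x)"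
    by auto
  ultimately show "AE x in lebesgue_on \<Omega>. (S (t + h) \<phi> x - S t \<phi> x) / h - S t \<eta> x =
      S t (\<lambda>x. (S h \<phi> x - \<phi> x) / h - \<eta> x) x"
    by auto
qed

text \<open>The domain of the generator is invariant, and the generator commutes with the semigroup: the
  difference quotients of \<open>S t \<phi>\<close> are the images of those of \<open>\<phi>\<close>.\<close>

lemma semigroup_generator_value:
  assumes S: "C0_semigroup \<Omega> V N S" and g: "is_generator_value V N S \<phi> \<eta>" and t: "0 \<le> t"
  shows "is_generator_value V N S (S t \<phi>) (S t \<eta>)"
proof -
  note Smem = semigroup_mem[OF S]
  have V: "\<phi> \<in> V" "\<eta> \<in> V" and
    gen: "((\<lambda>h. N (\<lambda>x. (S h \<phi> x - \<phi> x) / h - \<eta> x)) \<longlongrightarrow> 0) (at_right 0)"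
    using g unfolding is_generator_value_def by auto
  obtain K where K: "0 \<le> K" "\<And>\<phi>. \<phi> \<in> V \<Longrightarrow> N (S t \<phi>) \<le> K * N \<phi>"
    using operator_bound[OF semigroup_operator[OF S t]] by blast
  have lim: "((\<lambda>h. K * N (\<lambda>x. (S h \<phi> x - \<phi> x) / h - \<eta> x)) \<longlongrightarrow> 0) (at_right 0)"
    using tendsto_mult_left[OF gen, of K] by simp
  have pos: "\<forall>\<^sub>F h in at_right (0::real). 0 < h" by (simp add: eventually_at_right_less)
  have "((\<lambda>h. N (\<lambda>x. (S h (S t \<phi>) x - S t \<phi> x) / h - S t \<eta> x)) \<longlongrightarrow> 0) (at_right 0)"
  proof (rule Lim_null_comparison[OF _ lim])
    show "\<forall>\<^sub>F h in at_right 0. norm (N (\<lambda>x. (S h (S t \<phi>) x - S t \<phi> x) / h - S t \<eta> x)) \<le>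
        K * N (\<lambda>x. (S h \<phi> x - \<phi> x) / h - \<eta> x)"
      using pos
    proof eventually_elim
      case (elim h)
      have m: "S h \<phi> \<in> V" "S t \<phi> \<in> V" "S t \<eta> \<in> V" "S h (S t \<phi>) \<in> V" "S (t + h) \<phi> \<in> V"
        using elim t V Smem by auto
      have "AE x in lebesgue_on \<Omega>. S (h + t) \<phi> x = S h (S t \<phi>) x"
        using elim t V by (intro semigroup_add[OF S]) auto
      then have ae: "AE x in lebesgue_on \<Omega>. (S h (S t \<phi>) x - S t \<phi> x) / h - S t \<eta> x =
          (S (t + h) \<phi> x - S t \<phi> x) / h - S t \<eta> x"
        by eventually_elim (simp add: add.commute)
      have "N (\<lambda>x. (S h (S t \<phi>) x - S t \<phi> x) / h - S t \<eta> x) = N (\<lambda>x. (S (t + h) \<phi> x - S t \<phi> x) / h - S t \<eta> x)"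
        by (intro N_cong diff_mem divide_mem m ae)
      also have "\<dots> \<le> K * N (\<lambda>x. (S h \<phi> x - \<phi> x) / h - \<eta> x)"
        unfolding semigroup_difference_quotient[OF S V t elim] by (intro K diff_mem divide_mem m V)
      finally show ?case using N_nonneg[OF diff_mem[OF divide_mem[OF diff_mem[OF m(4,2)]] m(3)]] by simp
    qed
  qed
  then show ?thesis
    unfolding is_generator_value_def using V t Smem by auto
qed

end

section \<open>Uniform boundedness\<close>

locale complete_function_space = seminormed_function_space +
  assumes complete: "(\<And>n. u n \<in> V) \<Longrightarrow>
    (\<And>e. e > 0 \<Longrightarrow> \<exists>m. \<forall>i\<ge>m. \<forall>j\<ge>m. N (\<lambda>x. u i x - u j x) < e) \<Longrightarrow>
    \<exists>l\<in>V. (\<lambda>n. N (\<lambda>x. u n x - l x)) \<longlonglongrightarrow> 0"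
begin

text \<open>Gliding hump: if the operators were unbounded, choose for each \<open>j\<close> an operator of norm greater
  than \<open>4\<^sup>j\<close> and a vector \<open>\<phi> j\<close> of the unit ball that almost attains its norm. The series of the vectors
  \<open>\<plusminus> \<phi> j / 3\<^sup>j\<close> converges by completeness. For one of the two signs the \<open>j\<close>-th operator is large on
  the sum of the first terms up to the \<open>j\<close>-th, and the remaining terms are too small to undo this, so the
  operators are unbounded on the limit.\<close>

theorem uniform_boundedness:
  assumes T: "\<And>n::nat. bounded_operator \<Omega> V N (T n)"
    and bd: "\<And>\<phi>. \<phi> \<in> V \<Longrightarrow> \<exists>B. \<forall>n. N (T n \<phi>) \<le> B"
  shows "\<exists>L. \<forall>n. \<forall>\<phi>\<in>V. N (T n \<phi>) \<le> L * N \<phi>"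
proof (rule ccontr)
  assume unbounded: "\<not> ?thesis"
  note Tmem = operator_mem[OF T]
  define opn where "opn n = (SUP \<phi>\<in>{\<phi>\<in>V. N \<phi> \<le> 1}. N (T n \<phi>))" for n
  have ne: "{\<phi>\<in>V. N \<phi> \<le> 1} \<noteq> {}" using zero_mem N_zero by force
  have bdd: "bdd_above ((\<lambda>\<phi>. N (T n \<phi>)) ` {\<phi>\<in>V. N \<phi> \<le> 1})" for n
  proof -
    obtain K where K: "0 \<le> K" "\<And>\<phi>. \<phi> \<in> V \<Longrightarrow> N (T n \<phi>) \<le> K * N \<phi>"
      using operator_bound[OF T] by blast
    have "N (T n \<phi>) \<le> K" if "\<phi> \<in> V" "N \<phi> \<le> 1" for \<phi>
      using K(2)[OF that(1)] mult_left_le[OF that(2) K(1)] by simp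
    then show ?thesis by (auto intro!: bdd_aboveI)
  qed
  have opn: "N (T n \<phi>) \<le> opn n * N \<phi>" if V: "\<phi> \<in> V" for n \<phi>
  proof (cases "N \<phi> = 0")
    case True
    then show ?thesis by (metis T V mult_zero_right operator_bound order_refl)
  next
    case False
    then have pos: "0 < N \<phi>" using N_nonneg[OF V] by simp
    have "N (\<lambda>x. 1 / N \<phi> * \<phi> x) \<le> 1" using N_scale[OF V, of "1 / N \<phi>"] pos by simp
    then have "N (T n (\<lambda>x. 1 / N \<phi> * \<phi> x)) \<le> opn n"
      unfolding opn_def using scale_mem[OF V, of "1 / N \<phi>"] by (intro cSUP_upper[OF _ bdd]) simp
    moreover have "N (T n (\<lambda>x. 1 / N \<phi> * \<phi> x)) = N (\<lambda>x. 1 / N \<phi> * T n \<phi> x)"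
      by (intro N_cong operator_scale T scale_mem V Tmem)
    moreover have "\<dots> = 1 / N \<phi> * N (T n \<phi>)"
      using N_scale[OF Tmem[OF V], of "1 / N \<phi>" n] pos by simp
    ultimately have "1 / N \<phi> * N (T n \<phi>) \<le> opn n" by linarith
    then show ?thesis using pos by (simp add: divide_le_eq)
  qed
  have "\<exists>n \<phi>. \<phi> \<in> V \<and> N \<phi> \<le> 1 \<and> 4 ^ j < opn n \<and> 3/4 * opn n < N (T n \<phi>)" for j :: nat
  proof -
    obtain n \<phi> where n: "\<phi> \<in> V" "\<not> N (T n \<phi>) \<le> 4 ^ j * N \<phi>" using unbounded by blast
    have "4 ^ j < opn n"
    proof (rule ccontr)
      assume "\<not> 4 ^ j < opn n"
      then have "opn n * N \<phi> \<le> 4 ^ j * N \<phi>" using N_nonneg[OF n(1)] by (intro mult_right_mono) auto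
      then show False using opn[OF n(1), of n] n(2) by simp
    qed
    moreover from this have "0 < opn n" by (meson less_trans zero_less_numeral zero_less_power)
    then have "3/4 * opn n < opn n" by simp
    then obtain \<psi> where "\<psi> \<in> {\<phi>\<in>V. N \<phi> \<le> 1}" "3/4 * opn n < N (T n \<psi>)"
      unfolding opn_def less_cSUP_iff[OF ne bdd] by blast
    ultimately show ?thesis by blast
  qed
  then obtain n \<phi> where \<phi>: "\<And>j::nat. \<phi> j \<in> V" "\<And>j. N (\<phi> j) \<le> 1" "\<And>j. 4 ^ j < opn (n j)"
    "\<And>j. 3/4 * opn (n j) < N (T (n j) (\<phi> j))"
    by metis
  define step where "step s j y = (\<lambda>x. y x + s * (1/3) ^ j * \<phi> j x)" for s :: real and j :: nat and y
  have step_mem: "y \<in> V \<Longrightarrow> step s j y \<in> V" for s j y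
    unfolding step_def by (intro mem_intros \<phi>)
  \<comment> \<open>The two candidates differ by \<open>2 \<phi> j / 3\<^sup>j\<close>, so their images cannot both be small.\<close>
  have signs: "(1/3) ^ j * N (T (n j) (\<phi> j)) \<le> max (N (T (n j) (step 1 j y))) (N (T (n j) (step (-1) j y)))"
    if y: "y \<in> V" for j y
  proof -
    have lin: "AE x in lebesgue_on \<Omega>. T (n j) (step s j y) x = T (n j) y x + s * (1/3) ^ j * T (n j) (\<phi> j) x" for s
      using operator_lin[OF T y \<phi>(1), of "n j" 1 "s * (1/3) ^ j"] by (simp add: step_def)
    have m: "T (n j) (step s j y) \<in> V" for s by (intro Tmem step_mem y)
    have ae: "AE x in lebesgue_on \<Omega>. 2 * (1/3) ^ j * T (n j) (\<phi> j) x = T (n j) (step 1 j y) x - T (n j) (step (-1) j y) x"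
      using lin[of 1] lin[of "-1"] by eventually_elim simp
    have "2 * (1/3) ^ j * N (T (n j) (\<phi> j)) = N (\<lambda>x. 2 * (1/3) ^ j * T (n j) (\<phi> j) x)"
      using N_scale[OF Tmem[OF \<phi>(1)], of "2 * (1/3) ^ j"] by simp
    also have "\<dots> = N (\<lambda>x. T (n j) (step 1 j y) x - T (n j) (step (-1) j y) x)"
      by (intro N_cong mem_intros m Tmem \<phi> ae)
    also have "\<dots> \<le> N (T (n j) (step 1 j y)) + N (T (n j) (step (-1) j y))"
      by (rule N_diff_le[OF m m])
    finally show ?thesis by simp
  qed
  define x where "x = rec_nat (\<lambda>_. 0) (\<lambda>j y. if (1/3) ^ j * N (T (n j) (\<phi> j)) \<le> N (T (n j) (step 1 j y))
      then step 1 j y else step (-1) j y)"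
  have x_Suc: "x (Suc j) = (if (1/3) ^ j * N (T (n j) (\<phi> j)) \<le> N (T (n j) (step 1 j (x j)))
      then step 1 j (x j) else step (-1) j (x j))" for j
    by (simp add: x_def)
  have xV: "x j \<in> V" for j
  proof (induction j)
    case 0
    then show ?case by (simp add: x_def zero_mem)
  qed (simp add: x_Suc step_mem)
  have big: "(1/3) ^ j * N (T (n j) (\<phi> j)) \<le> N (T (n j) (x (Suc j)))" for j
    using signs[OF xV, of j j] by (auto simp: x_Suc max_def split: if_splits)
  have incr: "N (\<lambda>y. x (Suc j) y - x j y) \<le> (1/3) ^ j" for j
  proof -
    have "N (\<lambda>y. s * (1/3) ^ j * \<phi> j y) \<le> (1/3) ^ j" if "\<bar>s\<bar> = 1" for s
      using N_scale[OF \<phi>(1), of "s * (1/3) ^ j" j] \<phi>(2)[of j] that by (simp add: abs_mult mult_left_le)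
    from this[of 1] this[of "-1"] show ?thesis by (auto simp: x_Suc step_def)
  qed
  have tele: "N (\<lambda>y. x (j + k) y - x j y) \<le> 3/2 * ((1/3) ^ j - (1/3) ^ (j + k))" for j k
  proof (induction k)
    case 0
    then show ?case by (simp add: N_zero)
  next
    case (Suc k)
    have "N (\<lambda>y. x (j + Suc k) y - x j y) \<le> N (\<lambda>y. x (Suc (j + k)) y - x (j + k) y) + N (\<lambda>y. x (j + k) y - x j y)"
      using N_triangle[OF xV xV xV] by simp
    then show ?case using Suc incr[of "j + k"] by (simp add: algebra_simps)
  qed
  have tele': "N (\<lambda>y. x i y - x j y) \<le> 3/2 * (1/3) ^ j" if "j \<le> i" for i j
  proof -
    have "N (\<lambda>y. x i y - x j y) \<le> 3/2 * ((1/3) ^ j - (1/3) ^ i)" using tele[of j "i - j"] that by simp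
    also have "\<dots> \<le> 3/2 * (1/3) ^ j" by simp
    finally show ?thesis .
  qed
  have "\<exists>l\<in>V. (\<lambda>j. N (\<lambda>y. x j y - l y)) \<longlonglongrightarrow> 0"
  proof (rule complete[OF xV])
    fix e :: real assume "e > 0"
    then obtain m where m: "(1/3) ^ m < e / 3" using real_arch_pow_inv[of "e/3" "1/3"] by auto
    have "N (\<lambda>y. x i y - x j y) < e" if "i \<ge> m" "j \<ge> m" for i j
    proof -
      have "N (\<lambda>y. x i y - x j y) \<le> N (\<lambda>y. x i y - x m y) + N (\<lambda>y. x j y - x m y)"
        using N_triangle[OF xV[of i] xV[of m] xV[of j]] N_diff_commute[OF xV[of m] xV[of j]] by simp
      then show ?thesis using tele'[OF that(1)] tele'[OF that(2)] m by simp
    qed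
    then show "\<exists>m. \<forall>i\<ge>m. \<forall>j\<ge>m. N (\<lambda>y. x i y - x j y) < e" by blast
  qed
  then obtain l where l: "l \<in> V" "(\<lambda>j. N (\<lambda>y. x j y - l y)) \<longlonglongrightarrow> 0" by blast
  \<comment> \<open>At index \<open>Suc j\<close> the bound is half of \<open>1 / 3\<^sup>j\<close>, less than the \<open>3 / 4\<close> gained by the hump.\<close>
  have dist: "N (\<lambda>y. x j y - l y) \<le> 3/2 * (1/3) ^ j" for j
  proof -
    have "(\<lambda>i. 3/2 * (1/3) ^ j + N (\<lambda>y. x i y - l y)) \<longlonglongrightarrow> 3/2 * (1/3) ^ j + 0"
      by (intro tendsto_intros l)
    moreover have "N (\<lambda>y. x j y - l y) \<le> 3/2 * (1/3) ^ j + N (\<lambda>y. x i y - l y)" if "i \<ge> j" for i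
      using N_triangle[OF xV[of j] xV[of i] l(1)] tele'[OF that] N_diff_commute[OF xV[of i] xV[of j]] by simp
    ultimately have "N (\<lambda>y. x j y - l y) \<le> 3/2 * (1/3) ^ j + 0"
      using Lim_bounded2 by meson
    then show ?thesis by simp
  qed
  obtain B where B: "\<And>n. N (T n l) \<le> B" using bd[OF l(1)] by blast
  have bounded: "(4/3) ^ j \<le> 4 * B" for j
  proof -
    let ?a = "opn (n j) * (1/3) ^ j"
    have "0 \<le> opn (n j)" using \<phi>(3)[of j] zero_le_power[of "4::real" j] by linarith
    have "N (T (n j) (x (Suc j))) \<le> N (T (n j) (\<lambda>y. x (Suc j) y - l y)) + N (T (n j) l)"
      using N_le_diff[OF Tmem[OF xV] Tmem[OF l(1)]] operator_diff_norm[OF T xV l(1)] by metis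
    also have "N (T (n j) (\<lambda>y. x (Suc j) y - l y)) \<le> opn (n j) * N (\<lambda>y. x (Suc j) y - l y)"
      by (intro opn mem_intros xV l)
    also have "\<dots> \<le> opn (n j) * (3/2 * (1/3) ^ Suc j)"
      using \<open>0 \<le> opn (n j)\<close> by (intro mult_left_mono dist)
    finally have upper: "N (T (n j) (x (Suc j))) \<le> ?a / 2 + B" using B[of "n j"] by simp
    have "(1/3) ^ j * (3/4 * opn (n j)) \<le> (1/3) ^ j * N (T (n j) (\<phi> j))"
      using \<phi>(4)[of j] by (intro mult_left_mono) auto
    then have "3/4 * ?a \<le> (1/3) ^ j * N (T (n j) (\<phi> j))" by (simp only: mult_ac)
    moreover have "a \<le> 4 * B" if "r \<le> a / 2 + B" "3/4 * a \<le> s" "s \<le> r" for a r s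
      using that by linarith
    ultimately have "?a \<le> 4 * B" using big[of j] upper by blast
    moreover have "4 ^ j * (1/3) ^ j \<le> ?a" using \<phi>(3)[of j] by (intro mult_right_mono) auto
    moreover have "(4/3) ^ j = 4 ^ j * (1/3::real) ^ j" by (simp flip: power_mult_distrib)
    ultimately show ?thesis by (metis order_trans)
  qed
  obtain j where "4 * B < (4/3) ^ j" using real_arch_pow[of "4/3" "4 * B"] by auto
  then show False using bounded[of j] by simp
qed

text \<open>Otherwise there are times \<open>t n \<rightarrow> 0\<close> with operators of norm greater than \<open>n\<close>, which contradicts
  uniform boundedness since \<open>S (t n) \<phi> \<rightarrow> \<phi>\<close> for every \<open>\<phi>\<close>.\<close>

lemma semigroup_locally_bounded:
  assumes S: "C0_semigroup \<Omega> V N S"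
  obtains L where "0 \<le> L" "\<And>t \<phi>. 0 \<le> t \<Longrightarrow> t \<le> \<tau> \<Longrightarrow> \<phi> \<in> V \<Longrightarrow> N (S t \<phi>) \<le> L * N \<phi>"
proof -
  note Smem = semigroup_mem[OF S]
  have "\<exists>\<delta>>0. \<exists>L. \<forall>t. 0 \<le> t \<and> t \<le> \<delta> \<longrightarrow> (\<forall>\<phi>\<in>V. N (S t \<phi>) \<le> L * N \<phi>)"
  proof (rule ccontr)
    assume "\<not> ?thesis"
    then have "\<exists>t. 0 \<le> t \<and> t \<le> 1 / real (Suc n) \<and> (\<exists>\<phi>\<in>V. real n * N \<phi> < N (S t \<phi>))" for n
      by (metis not_le of_nat_0_less_iff zero_less_Suc zero_less_divide_1_iff)
    then obtain t where t: "\<And>n. 0 \<le> t n" "\<And>n. t n \<le> 1 / real (Suc n)"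
      "\<And>n. \<exists>\<phi>\<in>V. real n * N \<phi> < N (S (t n) \<phi>)"
      by metis
    have "\<exists>L. \<forall>n. \<forall>\<phi>\<in>V. N (S (t n) \<phi>) \<le> L * N \<phi>"
    proof (rule uniform_boundedness)
      fix \<phi> assume V: "\<phi> \<in> V"
      obtain \<delta> where \<delta>: "0 < \<delta>" "\<And>h. 0 \<le> h \<Longrightarrow> h < \<delta> \<Longrightarrow> N (\<lambda>x. S h \<phi> x - \<phi> x) < 1"
        using semigroup_near_zero[OF S V zero_less_one] by blast
      obtain m where m: "1 / real (Suc m) < \<delta>" using nat_approx_posE[OF \<delta>(1)] by blast
      have "N (S (t n) \<phi>) \<le> 1 + N \<phi>" if "n \<ge> m" for n
      proof -
        have "1 / real (Suc n) \<le> 1 / real (Suc m)" using that by (simp add: frac_le)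
        then have "N (\<lambda>x. S (t n) \<phi> x - \<phi> x) < 1" using t[of n] m by (intro \<delta>) auto
        then show ?thesis using N_le_diff[OF Smem[OF t(1) V] V, of n] by simp
      qed
      moreover have "N (S (t n) \<phi>) \<le> (\<Sum>i<m. N (S (t i) \<phi>))" if "n < m" for n
        using that by (intro member_le_sum) (auto intro!: N_nonneg Smem t V)
      ultimately have "N (S (t n) \<phi>) \<le> max (1 + N \<phi>) (\<Sum>i<m. N (S (t i) \<phi>))" for n
        by (cases "n < m") (auto simp: le_max_iff_disj)
      then show "\<exists>B. \<forall>n. N (S (t n) \<phi>) \<le> B" by blast
    qed (intro semigroup_operator[OF S] t)
    then obtain L where L: "\<And>n \<phi>. \<phi> \<in> V \<Longrightarrow> N (S (t n) \<phi>) \<le> L * N \<phi>" by blast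
    obtain n where n: "L \<le> real n" using real_arch_simple by blast
    obtain \<phi> where "\<phi> \<in> V" "real n * N \<phi> < N (S (t n) \<phi>)" using t(3) by blast
    then show False using L[of \<phi> n] mult_right_mono[OF n N_nonneg[of \<phi>]] by simp
  qed
  then obtain \<delta> L0 where \<delta>: "0 < \<delta>" and L0: "\<And>t \<phi>. 0 \<le> t \<Longrightarrow> t \<le> \<delta> \<Longrightarrow> \<phi> \<in> V \<Longrightarrow> N (S t \<phi>) \<le> L0 * N \<phi>"
    by blast
  define L where "L = max L0 0"
  have L: "N (S t \<phi>) \<le> L * N \<phi>" if "0 \<le> t" "t \<le> \<delta>" "\<phi> \<in> V" for t \<phi>
    using L0[OF that] mult_right_mono[of L0 L "N \<phi>"] N_nonneg[OF that(3)] by (simp add: L_def)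
  have "0 \<le> L" by (simp add: L_def)
  \<comment> \<open>\<open>S(ns) = S(s)\<^sup>n\<close> carries the bound from \<open>[0, \<delta>]\<close> to \<open>[0, n\<delta>]\<close>.\<close>
  have pow: "N (S (real n * s) \<phi>) \<le> max 1 (L ^ n) * N \<phi>" if s: "0 \<le> s" "s \<le> \<delta>" and V: "\<phi> \<in> V" for s \<phi> n
  proof -
    have "N (S (real n * s) \<phi>) \<le> L ^ n * N \<phi>" if "n > 0" for n
      using that
    proof (induction n rule: nat_induct_non_zero)
      case 1
      then show ?case using L[OF s V] by simp
    next
      case (Suc n)
      have "N (S (real (Suc n) * s) \<phi>) = N (S s (S (real n * s) \<phi>))"
        using semigroup_add[OF S s(1) _ V, of "real n * s"] s V
        by (intro N_cong Smem) (auto simp: algebra_simps)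
      also have "\<dots> \<le> L * N (S (real n * s) \<phi>)" using s V by (intro L Smem) auto
      also have "\<dots> \<le> L * (L ^ n * N \<phi>)" using Suc \<open>0 \<le> L\<close> by (intro mult_left_mono) auto
      finally show ?case by simp
    qed
    moreover have "N (S (real 0 * s) \<phi>) = N \<phi>"
      using semigroup_zero[OF S V] by (intro N_cong Smem V) auto
    moreover have "L ^ n * N \<phi> \<le> max 1 (L ^ n) * N \<phi>" using N_nonneg[OF V] by (intro mult_right_mono) auto
    ultimately show ?thesis by (cases "n = 0") (auto intro: order_trans)
  qed
  obtain m where m: "max \<tau> 0 / \<delta> < real m" using reals_Archimedean2 by blast
  then have "0 < real m" using \<delta> by (metis divide_nonneg_pos le_less_trans max.cobounded2)
  show ?thesis
  proof (rule that)
    show "0 \<le> max 1 (L ^ m)" by simp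
    fix t \<phi> assume t: "0 \<le> t" "t \<le> \<tau>" and V: "\<phi> \<in> V"
    have "t < real m * \<delta>" using m t \<delta> by (simp add: pos_divide_less_eq)
    then have "t / real m \<le> \<delta>" using \<open>0 < real m\<close> by (simp add: divide_le_eq mult.commute)
    then show "N (S t \<phi>) \<le> max 1 (L ^ m) * N \<phi>"
      using pow[of "t / real m" \<phi> m] t V \<open>0 < real m\<close> by simp
  qed
qed

lemma orbit_uniformly_continuous:
  assumes S: "C0_semigroup \<Omega> V N S" and V: "\<phi> \<in> V" and e: "0 < e"
  obtains \<delta> where "0 < \<delta>"
    "\<And>s t. 0 \<le> s \<Longrightarrow> s \<le> t \<Longrightarrow> t \<le> \<tau> \<Longrightarrow> t - s < \<delta> \<Longrightarrow> N (\<lambda>x. S t \<phi> x - S s \<phi> x) \<le> e"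
proof -
  obtain L where L: "0 \<le> L" "\<And>t \<phi>. 0 \<le> t \<Longrightarrow> t \<le> \<tau> \<Longrightarrow> \<phi> \<in> V \<Longrightarrow> N (S t \<phi>) \<le> L * N \<phi>"
    using semigroup_locally_bounded[OF S] by blast
  obtain \<delta> where \<delta>: "0 < \<delta>" "\<And>h. 0 \<le> h \<Longrightarrow> h < \<delta> \<Longrightarrow> N (\<lambda>x. S h \<phi> x - \<phi> x) < e / (L + 1)"
    using semigroup_near_zero[OF S V, of "e / (L + 1)"] e L(1) by auto
  show ?thesis
  proof (rule that[OF \<delta>(1)])
    fix s t assume st: "0 \<le> s" "s \<le> t" "t \<le> \<tau>" "t - s < \<delta>"
    have "N (\<lambda>x. S t \<phi> x - S s \<phi> x) \<le> L * N (\<lambda>x. S (t - s) \<phi> x - \<phi> x)"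
      unfolding semigroup_increment[OF S V st(1,2)]
      using st V by (intro L mem_intros semigroup_mem[OF S]) auto
    also have "\<dots> \<le> L * (e / (L + 1))" using \<delta>(2)[of "t - s"] st L(1) by (intro mult_left_mono) auto
    also have "\<dots> \<le> e" using L(1) e by (simp add: field_simps)
    finally show "N (\<lambda>x. S t \<phi> x - S s \<phi> x) \<le> e" .
  qed
qed

end

section \<open>Orbit means and the density of the generator domain\<close>

lemma integral_near_const:
  fixes u :: "real \<Rightarrow> real"
  assumes "a \<le> b" "continuous_on {a..b} u" "\<And>t. a \<le> t \<Longrightarrow> t \<le> b \<Longrightarrow> \<bar>u t - c\<bar> \<le> e"
  shows "\<bar>integral {a..b} u - (b - a) * c\<bar> \<le> (b - a) * e"
proof -
  have "integral {a..b} (\<lambda>t. u t - c) = integral {a..b} u - (b - a) * c"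
    using assms(1) by (subst integral_diff) (auto intro: integrable_continuous_real assms)
  moreover have "norm (integral {a..b} (\<lambda>t. u t - c)) \<le> e * (b - a)"
    using assms by (intro integral_bound continuous_intros) auto
  ultimately show ?thesis by (simp add: mult.commute)
qed

lemma scaled_epsilon:
  fixes e a :: real
  assumes "0 < e" "0 \<le> a"
  obtains e' where "0 < e'" "e' * a < e"
proof -
  have "e / (2 * (a + 1)) * a < e / (2 * (a + 1)) * (2 * (a + 1))"
    using assms by (intro mult_strict_left_mono) auto
  then show ?thesis using assms by (intro that[of "e / (2 * (a + 1))"]) auto
qed

lemma riemann_sum_error:
  fixes u :: "real \<Rightarrow> real"
  assumes h: "0 < h" and n: "0 < n" and u: "continuous_on {0..h} u"
    and osc: "\<And>s t. 0 \<le> s \<Longrightarrow> s \<le> t \<Longrightarrow> t \<le> h \<Longrightarrow> t - s \<le> h / real n \<Longrightarrow> \<bar>u t - u s\<bar> \<le> e"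
  shows "\<bar>(\<Sum>k<n. u (real k * h / real n)) / real n - integral {0..h} u / h\<bar> \<le> e"
proof -
  define p where "p k = real k * h / real n" for k
  define d where "d = h / real n"
  have d: "0 < d" using h n by (simp add: d_def)
  have p_Suc: "p (Suc k) = p k + d" for k
    by (simp add: p_def d_def add_divide_distrib algebra_simps)
  have p0: "0 \<le> p k" for k using h by (simp add: p_def)
  have pn: "p k \<le> h" if "k \<le> n" for k
    using that h n by (simp add: p_def divide_le_eq)
  have "\<bar>d * (\<Sum>k<m. u (p k)) - integral {0..p m} u\<bar> \<le> real m * (d * e)" if "m \<le> n" for m
    using that
  proof (induction m)
    case 0
    then show ?case by (simp add: p_def)
  next
    case (Suc m)
    have le: "p (Suc m) \<le> h" "p m \<le> p (Suc m)" using pn[OF Suc(2)] d p_Suc[of m] by auto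
    have "integral {0..p m} u + integral {p m..p (Suc m)} u = integral {0..p (Suc m)} u"
      using le p0[of m] by (intro Henstock_Kurzweil_Integration.integral_combine integrable_continuous_real
          continuous_on_subset[OF u]) auto
    moreover have "\<bar>integral {p m..p (Suc m)} u - (p (Suc m) - p m) * u (p m)\<bar> \<le> (p (Suc m) - p m) * e"
      using le p0[of m] p_Suc[of m] by (intro integral_near_const continuous_on_subset[OF u] osc)
        (auto simp: d_def[symmetric])
    ultimately show ?case
      using Suc p_Suc[of m] by (simp add: algebra_simps abs_le_iff)
  qed
  from this[of n] have "\<bar>d * (\<Sum>k<n. u (p k)) - integral {0..h} u\<bar> \<le> h * e"
    using n by (simp add: p_def d_def)
  then have "\<bar>(d * (\<Sum>k<n. u (p k)) - integral {0..h} u) / h\<bar> \<le> e"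
    using h by (simp add: pos_divide_le_eq mult.commute)
  moreover have "(d * (\<Sum>k<n. u (p k)) - integral {0..h} u) / h = (\<Sum>k<n. u (p k)) / real n - integral {0..h} u / h"
    using h by (simp add: d_def field_simps)
  ultimately have "\<bar>(\<Sum>k<n. u (p k)) / real n - integral {0..h} u / h\<bar> \<le> e" by (rule back_subst[where P = "\<lambda>z. \<bar>z\<bar> \<le> e"])
  then show ?thesis unfolding p_def .
qed

text \<open>The form \<open>ip\<close> is used to test elements against each other, which turns statements about
  vector-valued integrals into statements about real ones.\<close>

locale hilbert_function_space = complete_function_space +
  fixes ip :: "(real^'n \<Rightarrow> real) \<Rightarrow> (real^'n \<Rightarrow> real) \<Rightarrow> real"
  assumes ip_bilinear: "bounded_bilinear_form V N ip"
    and ip_self: "\<phi> \<in> V \<Longrightarrow> ip \<phi> \<phi> = (N \<phi>)\<^sup>2"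
    and ip_le: "\<phi> \<in> V \<Longrightarrow> \<psi> \<in> V \<Longrightarrow> \<bar>ip \<phi> \<psi>\<bar> \<le> N \<phi> * N \<psi>"
begin

lemmas ip_diff = bilinear_diff[OF ip_bilinear]
lemmas ip_divide = bilinear_divide[OF ip_bilinear]
lemmas ip_cong = bilinear_cong[OF ip_bilinear]

lemma ip_sum:
  assumes "finite I" "\<And>i. i \<in> I \<Longrightarrow> u i \<in> V" "\<psi> \<in> V"
  shows "ip (\<lambda>x. \<Sum>i\<in>I. u i x) \<psi> = (\<Sum>i\<in>I. ip (u i) \<psi>)"
  using assms(1,2)
proof (induction I rule: finite_induct)
  case empty
  then show ?case using ip_diff(1)[OF zero_mem zero_mem assms(3)] by simp
next
  case (insert i I)
  have "ip (\<lambda>x. (u i x + (\<Sum>i\<in>I. u i x)) - u i x) \<psi> = ip (\<lambda>x. u i x + (\<Sum>i\<in>I. u i x)) \<psi> - ip (u i) \<psi>"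
    using insert assms(3) by (intro ip_diff mem_intros) auto
  then show ?case using insert by simp
qed

lemma N_le_by_testing:
  assumes "\<phi> \<in> V" "0 \<le> e" "\<And>\<psi>. \<psi> \<in> V \<Longrightarrow> \<bar>ip \<phi> \<psi>\<bar> \<le> e * N \<psi>"
  shows "N \<phi> \<le> e"
proof (cases "N \<phi> = 0")
  case False
  then have "0 < N \<phi>" using N_nonneg[OF assms(1)] by simp
  moreover have "N \<phi> * N \<phi> \<le> e * N \<phi>"
    using assms(3)[OF assms(1)] ip_self[OF assms(1)] by (simp add: power2_eq_square)
  ultimately show ?thesis by simp
qed (use assms in simp)

lemma weak_orbit_modulus:
  assumes S: "C0_semigroup \<Omega> V N S" and V: "\<phi> \<in> V" "\<psi> \<in> V"
    and "0 \<le> s" "0 \<le> t" "N (\<lambda>x. S t \<phi> x - S s \<phi> x) \<le> e"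
  shows "\<bar>ip (S t \<phi>) \<psi> - ip (S s \<phi>) \<psi>\<bar> \<le> e * N \<psi>"
proof -
  have m: "S t \<phi> \<in> V" "S s \<phi> \<in> V" using assms semigroup_mem[OF S] by auto
  have "ip (S t \<phi>) \<psi> - ip (S s \<phi>) \<psi> = ip (\<lambda>x. S t \<phi> x - S s \<phi> x) \<psi>"
    using ip_diff(1)[OF m V(2)] by simp
  also have "\<bar>\<dots>\<bar> \<le> N (\<lambda>x. S t \<phi> x - S s \<phi> x) * N \<psi>" by (intro ip_le diff_mem m V)
  also have "\<dots> \<le> e * N \<psi>" using assms N_nonneg by (intro mult_right_mono) auto
  finally show ?thesis .
qed

lemma continuous_on_weak_orbit:
  assumes S: "C0_semigroup \<Omega> V N S" and V: "\<phi> \<in> V" "\<psi> \<in> V"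
  shows "continuous_on {0..} (\<lambda>t. ip (S t \<phi>) \<psi>)"
  unfolding continuous_on_iff
proof (intro ballI allI impI)
  fix t e :: real assume t: "t \<in> {0..}" and e: "0 < e"
  obtain e' where pos: "0 < e'" and small: "e' * N \<psi> < e"
    using scaled_epsilon[OF e N_nonneg[OF V(2)]] by blast
  obtain \<delta> where \<delta>: "0 < \<delta>" "\<And>r s. 0 \<le> r \<Longrightarrow> r \<le> s \<Longrightarrow> s \<le> t + 1 \<Longrightarrow> s - r < \<delta> \<Longrightarrow> N (\<lambda>x. S s \<phi> x - S r \<phi> x) \<le> e'"
    using orbit_uniformly_continuous[OF S V(1) pos, of "t + 1"] by blast
  have close: "\<bar>ip (S s \<phi>) \<psi> - ip (S r \<phi>) \<psi>\<bar> < e" if "0 \<le> r" "r \<le> s" "s \<le> t + 1" "s - r < \<delta>" for r s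
    using weak_orbit_modulus[OF S V that(1) _ \<delta>(2)[OF that]] that small by linarith
  show "\<exists>d>0. \<forall>s\<in>{0..}. dist s t < d \<longrightarrow> dist (ip (S s \<phi>) \<psi>) (ip (S t \<phi>) \<psi>) < e"
  proof (intro exI[of _ "min \<delta> 1"] conjI ballI impI)
    fix s assume s: "s \<in> {0..}" "dist s t < min \<delta> 1"
    show "dist (ip (S s \<phi>) \<psi>) (ip (S t \<phi>) \<psi>) < e"
    proof (cases "s \<le> t")
      case True
      then have "\<bar>ip (S t \<phi>) \<psi> - ip (S s \<phi>) \<psi>\<bar> < e"
        using s by (intro close) (auto simp: dist_real_def)
      then show ?thesis by (simp add: dist_real_def abs_minus_commute)
    next
      case False
      then have "\<bar>ip (S s \<phi>) \<psi> - ip (S t \<phi>) \<psi>\<bar> < e"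
        using s t by (intro close) (auto simp: dist_real_def)
      then show ?thesis by (simp add: dist_real_def)
    qed
  qed (use \<delta>(1) in simp)
qed

text \<open>The left Riemann sum, with \<open>n\<close> equal pieces, of the mean of the orbit over \<open>[0, h]\<close>.\<close>

definition orbit_sum :: "(real \<Rightarrow> (real^'n \<Rightarrow> real) \<Rightarrow> (real^'n \<Rightarrow> real)) \<Rightarrow> real \<Rightarrow> (real^'n \<Rightarrow> real) \<Rightarrow> nat \<Rightarrow> real^'n \<Rightarrow> real"
  where "orbit_sum S h \<phi> n = (\<lambda>x. (\<Sum>k<n. S (real k * h / real n) \<phi> x) / real n)"

lemma orbit_sum_mem:
  assumes S: "C0_semigroup \<Omega> V N S" and V: "\<phi> \<in> V" and h: "0 < h"
  shows "orbit_sum S h \<phi> n \<in> V"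
  unfolding orbit_sum_def using h by (intro divide_mem sum_mem semigroup_mem[OF S _ V]) auto

text \<open>After testing with \<open>\<psi>\<close> the Riemann sums differ from the mean value of a real function by at most a
  modulus of continuity times the norm of \<open>\<psi>\<close>. As this is uniform in \<open>\<psi>\<close>, the sums form a Cauchy sequence
  in norm, and their limit has the expected tested values.\<close>

lemma orbit_mean:
  assumes S: "C0_semigroup \<Omega> V N S" and V: "\<phi> \<in> V" and h: "0 < h"
  shows "\<exists>y\<in>V. (\<lambda>n. N (\<lambda>x. orbit_sum S h \<phi> n x - y x)) \<longlonglongrightarrow> 0 \<and>
    (\<forall>\<psi>\<in>V. ip y \<psi> = integral {0..h} (\<lambda>t. ip (S t \<phi>) \<psi>) / h)"
proof -
  let ?R = "orbit_sum S h \<phi>" and ?I = "\<lambda>\<psi>. integral {0..h} (\<lambda>t. ip (S t \<phi>) \<psi>) / h"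
  note R = orbit_sum_mem[OF S V h]
  have ipR: "ip (?R n) \<psi> = (\<Sum>k<n. ip (S (real k * h / real n) \<phi>) \<psi>) / real n" if "\<psi> \<in> V" for n \<psi>
  proof -
    let ?u = "\<lambda>k. S (real k * h / real n) \<phi>"
    have m: "?u k \<in> V" for k using h V by (intro semigroup_mem[OF S]) auto
    have "ip (?R n) \<psi> = ip (\<lambda>x. \<Sum>k<n. ?u k x) \<psi> / real n"
      unfolding orbit_sum_def by (intro ip_divide sum_mem m that finite_lessThan)
    also have "ip (\<lambda>x. \<Sum>k<n. ?u k x) \<psi> = (\<Sum>k<n. ip (?u k) \<psi>)"
      by (intro ip_sum m that finite_lessThan)
    finally show ?thesis .
  qed
  have close: "\<exists>m. \<forall>n\<ge>m. \<forall>\<psi>\<in>V. \<bar>ip (?R n) \<psi> - ?I \<psi>\<bar> \<le> e * N \<psi>" if e: "0 < e" for e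
  proof -
    obtain \<delta> where \<delta>: "0 < \<delta>" "\<And>r s. 0 \<le> r \<Longrightarrow> r \<le> s \<Longrightarrow> s \<le> h \<Longrightarrow> s - r < \<delta> \<Longrightarrow> N (\<lambda>x. S s \<phi> x - S r \<phi> x) \<le> e"
      using orbit_uniformly_continuous[OF S V e, of h] by blast
    obtain m where m: "h / \<delta> < real m" using reals_Archimedean2 by blast
    have "\<bar>ip (?R n) \<psi> - ?I \<psi>\<bar> \<le> e * N \<psi>" if n: "n \<ge> m" and \<psi>: "\<psi> \<in> V" for n \<psi>
    proof -
      have mn: "h / \<delta> < real n" using m n by linarith
      then have "0 < real n" using h \<delta>(1) by (metis divide_pos_pos less_trans)
      then have "h / real n < \<delta>" using mn \<delta>(1) by (simp add: field_simps)
      moreover have "continuous_on {0..h} (\<lambda>t. ip (S t \<phi>) \<psi>)"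
        by (rule continuous_on_subset[OF continuous_on_weak_orbit[OF S V \<psi>]]) auto
      ultimately show ?thesis unfolding ipR[OF \<psi>]
        using \<open>0 < real n\<close> h
        by (intro riemann_sum_error[where u = "\<lambda>t. ip (S t \<phi>) \<psi>"] weak_orbit_modulus[OF S V \<psi>] \<delta>(2)) auto
    qed
    then show ?thesis by blast
  qed
  have "\<exists>y\<in>V. (\<lambda>n. N (\<lambda>x. ?R n x - y x)) \<longlonglongrightarrow> 0"
  proof (rule complete[OF R])
    fix e :: real assume "e > 0"
    then obtain m where m: "\<And>n \<psi>. n \<ge> m \<Longrightarrow> \<psi> \<in> V \<Longrightarrow> \<bar>ip (?R n) \<psi> - ?I \<psi>\<bar> \<le> e / 3 * N \<psi>"
      using close[of "e / 3"] by auto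
    have "N (\<lambda>x. ?R i x - ?R j x) < e" if "i \<ge> m" "j \<ge> m" for i j
    proof -
      have "N (\<lambda>x. ?R i x - ?R j x) \<le> 2 * (e / 3)"
      proof (rule N_le_by_testing)
        fix \<psi> assume \<psi>: "\<psi> \<in> V"
        show "\<bar>ip (\<lambda>x. ?R i x - ?R j x) \<psi>\<bar> \<le> 2 * (e / 3) * N \<psi>"
          unfolding ip_diff(1)[OF R R \<psi>] using m[OF that(1) \<psi>] m[OF that(2) \<psi>] by linarith
      qed (use \<open>e > 0\<close> in \<open>auto intro: diff_mem R\<close>)
      then show ?thesis using \<open>e > 0\<close> by simp
    qed
    then show "\<exists>m. \<forall>i\<ge>m. \<forall>j\<ge>m. N (\<lambda>x. ?R i x - ?R j x) < e" by blast
  qed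
  then obtain y where y: "y \<in> V" "(\<lambda>n. N (\<lambda>x. ?R n x - y x)) \<longlonglongrightarrow> 0" by blast
  have "ip y \<psi> = ?I \<psi>" if \<psi>: "\<psi> \<in> V" for \<psi>
  proof (rule LIMSEQ_unique)
    show "(\<lambda>n. ip (?R n) \<psi>) \<longlonglongrightarrow> ip y \<psi>"
      by (rule bilinear_tendsto[OF ip_bilinear y(1) \<psi> _ _ y(2)]) (simp_all add: R \<psi> N_zero)
    show "(\<lambda>n. ip (?R n) \<psi>) \<longlonglongrightarrow> ?I \<psi>"
    proof (rule LIMSEQ_I)
      fix r :: real assume r: "0 < r"
      obtain e where e: "0 < e" "e * N \<psi> < r"
        using scaled_epsilon[OF r N_nonneg[OF \<psi>]] by blast
      obtain m where m: "\<And>n. n \<ge> m \<Longrightarrow> \<bar>ip (?R n) \<psi> - ?I \<psi>\<bar> \<le> e * N \<psi>"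
        using close[OF e(1)] \<psi> by blast
      then show "\<exists>no. \<forall>n\<ge>no. norm (ip (?R n) \<psi> - ?I \<psi>) < r"
        using le_less_trans[OF m e(2)] by (intro exI[of _ m]) simp
    qed
  qed
  then show ?thesis using y by (intro bexI[of _ y]) simp_all
qed

text \<open>\<open>S s\<close> maps the Riemann sums of \<open>\<phi>\<close> to those of \<open>S s \<phi>\<close>, so it can be moved under the mean.\<close>

lemma operator_orbit_mean:
  assumes S: "C0_semigroup \<Omega> V N S" and V: "\<phi> \<in> V" "y \<in> V" "\<psi> \<in> V" and h: "0 < h" and s: "0 \<le> s"
    and lim: "(\<lambda>n. N (\<lambda>x. orbit_sum S h \<phi> n x - y x)) \<longlonglongrightarrow> 0"
  shows "ip (S s y) \<psi> = integral {0..h} (\<lambda>t. ip (S (s + t) \<phi>) \<psi>) / h"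
proof -
  note Smem = semigroup_mem[OF S] and Ss = semigroup_operator[OF S s]
  obtain z where z: "z \<in> V" "(\<lambda>n. N (\<lambda>x. orbit_sum S h (S s \<phi>) n x - z x)) \<longlonglongrightarrow> 0"
    "\<And>\<psi>. \<psi> \<in> V \<Longrightarrow> ip z \<psi> = integral {0..h} (\<lambda>t. ip (S t (S s \<phi>)) \<psi>) / h"
    using orbit_mean[OF S Smem[OF s V(1)] h] by auto
  have commute: "AE x in lebesgue_on \<Omega>. S t (S s \<phi>) x = S (s + t) \<phi> x"
    "AE x in lebesgue_on \<Omega>. S s (S t \<phi>) x = S (s + t) \<phi> x" if "0 \<le> t" for t
    using semigroup_add[OF S s that V(1)] semigroup_add[OF S that s V(1)] by (auto simp: add.commute)
  have eq: "N (\<lambda>x. orbit_sum S h (S s \<phi>) n x - S s y x) = N (\<lambda>x. S s (orbit_sum S h \<phi> n) x - S s y x)" for n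
  proof -
    let ?t = "\<lambda>k. real k * h / real n"
    have t: "0 \<le> ?t k" for k using h by simp
    have "AE x in lebesgue_on \<Omega>. S s (orbit_sum S h \<phi> n) x = (1 / real n) * S s (\<lambda>x. \<Sum>k<n. S (?t k) \<phi> x) x"
      using operator_scale[OF Ss sum_mem[of "{..<n}" "\<lambda>k. S (?t k) \<phi>"], of "1 / real n"] Smem[OF t V(1)]
      by (simp add: orbit_sum_def)
    moreover have "AE x in lebesgue_on \<Omega>. S s (\<lambda>x. \<Sum>k<n. S (?t k) \<phi> x) x = (\<Sum>k<n. S s (S (?t k) \<phi>) x)"
      by (intro operator_sum[OF Ss] Smem t V) simp
    moreover have "AE x in lebesgue_on \<Omega>. \<forall>k\<in>{..<n}. S (?t k) (S s \<phi>) x = S s (S (?t k) \<phi>) x"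
    proof (rule AE_finite_allI)
      fix k
      show "AE x in lebesgue_on \<Omega>. S (?t k) (S s \<phi>) x = S s (S (?t k) \<phi>) x"
        using commute[OF t[of k]] by auto
    qed simp
    ultimately have ae: "AE x in lebesgue_on \<Omega>. orbit_sum S h (S s \<phi>) n x = S s (orbit_sum S h \<phi> n) x"
      by eventually_elim (simp add: orbit_sum_def)
    show ?thesis
      using ae s h V by (intro N_cong mem_intros Smem orbit_sum_mem[OF S]) auto
  qed
  have "(\<lambda>n. N (\<lambda>x. S s (orbit_sum S h \<phi> n) x - S s y x)) \<longlonglongrightarrow> 0"
    using orbit_sum_mem[OF S V(1) h] by (intro operator_tendsto[OF Ss V(2) _ lim]) simp
  then have "N (\<lambda>x. z x - S s y x) = 0"
    using orbit_sum_mem[OF S Smem[OF s V(1)] h] z(2)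
    by (intro limit_unique[OF z(1) Smem[OF s V(2)], of sequentially "orbit_sum S h (S s \<phi>)"]) (auto simp: eq)
  then have "ip (S s y) \<psi> = ip z \<psi>"
    using N_zero by (intro bilinear_eq[OF ip_bilinear, symmetric] z Smem s V) auto
  also have "\<dots> = integral {0..h} (\<lambda>t. ip (S t (S s \<phi>)) \<psi>) / h" by (rule z(3)[OF V(3)])
  also have "integral {0..h} (\<lambda>t. ip (S t (S s \<phi>)) \<psi>) = integral {0..h} (\<lambda>t. ip (S (s + t) \<phi>) \<psi>)"
    using s V commute by (intro integral_cong ip_cong Smem) auto
  finally show ?thesis .
qed

text \<open>Moving \<open>S s\<close> under the mean shifts the interval of integration, so that \<open>S s y - y\<close> is the
  difference of the integrals over \<open>[h, h + s]\<close> and \<open>[0, s]\<close>, divided by \<open>h\<close>. Divided by \<open>s\<close> these tend to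
  the values of the orbit at \<open>h\<close> and \<open>0\<close>.\<close>

lemma orbit_mean_generator_value:
  assumes S: "C0_semigroup \<Omega> V N S" and V: "\<phi> \<in> V" "y \<in> V" and h: "0 < h"
    and lim: "(\<lambda>n. N (\<lambda>x. orbit_sum S h \<phi> n x - y x)) \<longlonglongrightarrow> 0"
    and mean: "\<And>\<psi>. \<psi> \<in> V \<Longrightarrow> ip y \<psi> = integral {0..h} (\<lambda>t. ip (S t \<phi>) \<psi>) / h"
  shows "is_generator_value V N S y (\<lambda>x. (S h \<phi> x - \<phi> x) / h)"
  unfolding is_generator_value_def
proof (intro conjI)
  note Smem = semigroup_mem[OF S]
  show "y \<in> V" by fact
  show mem: "(\<lambda>x. (S h \<phi> x - \<phi> x) / h) \<in> V" using h V by (intro mem_intros Smem) auto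
  show "((\<lambda>s. N (\<lambda>x. (S s y x - y x) / s - (S h \<phi> x - \<phi> x) / h)) \<longlongrightarrow> 0) (at_right 0)"
  proof (rule tendstoI)
    fix e :: real assume e: "0 < e"
    obtain \<delta> where \<delta>: "0 < \<delta>" "\<And>r t. 0 \<le> r \<Longrightarrow> r \<le> t \<Longrightarrow> t \<le> h + 1 \<Longrightarrow> t - r < \<delta> \<Longrightarrow>
        N (\<lambda>x. S t \<phi> x - S r \<phi> x) \<le> e * h / 4"
      using orbit_uniformly_continuous[OF S V(1), of "e * h / 4" "h + 1"] e h by auto
    have "N (\<lambda>x. (S s y x - y x) / s - (S h \<phi> x - \<phi> x) / h) < e" if s: "0 < s" "s < min \<delta> 1" for s
    proof -
      have m: "S s y \<in> V" "S h \<phi> \<in> V" using s h V Smem by auto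
      let ?z = "\<lambda>x. (S s y x - y x) / s - (S h \<phi> x - \<phi> x) / h"
      have "N ?z \<le> e / 2"
      proof (rule N_le_by_testing)
        fix \<psi> assume \<psi>: "\<psi> \<in> V"
        define u where "u = (\<lambda>t. ip (S t \<phi>) \<psi>)"
        have cont: "continuous_on {a..b} u" if "0 \<le> a" for a b
          unfolding u_def using that by (intro continuous_on_subset[OF continuous_on_weak_orbit[OF S V(1) \<psi>]]) auto
        have int: "u integrable_on {a..b}" if "0 \<le> a" for a b
          by (intro integrable_continuous_real cont that)
        have osc: "\<bar>u t - u r\<bar> \<le> e * h / 4 * N \<psi>" if "0 \<le> r" "r \<le> t" "t \<le> h + 1" "t - r < \<delta>" for r t
          unfolding u_def using that by (intro weak_orbit_modulus[OF S V(1) \<psi>] \<delta>) auto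
        have "ip (S s y) \<psi> = integral {0..h} (u \<circ> (\<lambda>t. t + s)) / h"
          using operator_orbit_mean[OF S V \<psi> h _ lim, of s] s
          by (simp add: u_def o_def add.commute)
        also have "integral {0..h} (u \<circ> (\<lambda>t. t + s)) = integral {s..h + s} u"
          using integral_shift[of 0 s h u] cont[of s "h + s"] s by simp
        finally have A: "ip (S s y) \<psi> = integral {s..h + s} u / h" .
        have B: "ip y \<psi> = integral {0..h} u / h" using mean[OF \<psi>] by (simp add: u_def)
        have "integral {0..s} u + integral {s..h + s} u = integral {0..h + s} u"
          "integral {0..h} u + integral {h..h + s} u = integral {0..h + s} u"
          using s h by (auto intro!: Henstock_Kurzweil_Integration.integral_combine int)
        then have diff: "integral {s..h + s} u - integral {0..h} u = integral {h..h + s} u - integral {0..s} u" by simp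
        have C: "\<bar>integral {h..h + s} u - (h + s - h) * u h\<bar> \<le> (h + s - h) * (e * h / 4 * N \<psi>)"
          using s h by (intro integral_near_const cont osc) auto
        then have C': "\<bar>integral {h..h + s} u - s * u h\<bar> \<le> s * (e * h / 4 * N \<psi>)" by simp
        have D: "\<bar>integral {0..s} u - (s - 0) * u 0\<bar> \<le> (s - 0) * (e * h / 4 * N \<psi>)"
          using s h by (intro integral_near_const cont osc) auto
        then have D': "\<bar>integral {0..s} u - s * u 0\<bar> \<le> s * (e * h / 4 * N \<psi>)" by simp
        have u0: "u 0 = ip \<phi> \<psi>"
          unfolding u_def using semigroup_zero[OF S V(1)] by (intro ip_cong Smem V \<psi>) auto
        have "ip ?z \<psi> = (ip (S s y) \<psi> - ip y \<psi>) / s - (u h - u 0) / h"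
          unfolding u0 using m V \<psi> by (simp add: ip_diff ip_divide mem_intros u_def)
        also have "\<dots> = (integral {s..h + s} u - integral {0..h} u - s * (u h - u 0)) / (s * h)"
        proof -
          have "(a / h - b / h) / s - c / h = (a - b - s * c) / (s * h)" for a b c
            using s h by (simp add: field_simps)
          then show ?thesis unfolding A B by blast
        qed
        also have "\<bar>\<dots>\<bar> \<le> (2 * (s * (e * h / 4 * N \<psi>))) / (s * h)"
        proof -
          have "integral {s..h + s} u - integral {0..h} u - s * (u h - u 0) =
              (integral {h..h + s} u - s * u h) - (integral {0..s} u - s * u 0)"
            unfolding diff by (simp only: right_diff_distrib)
          also have "\<bar>\<dots>\<bar> \<le> 2 * (s * (e * h / 4 * N \<psi>))" using C' D' by linarith
          finally have "\<bar>integral {s..h + s} u - integral {0..h} u - s * (u h - u 0)\<bar> \<le> 2 * (s * (e * h / 4 * N \<psi>))" .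
          moreover have "\<bar>a / (s * h)\<bar> \<le> b / (s * h)" if "\<bar>a\<bar> \<le> b" for a b
            using s h that by (simp add: abs_mult divide_right_mono)
          ultimately show ?thesis by blast
        qed
        also have "\<dots> = e / 2 * N \<psi>" using s h by (simp add: field_simps)
        finally show "\<bar>ip ?z \<psi>\<bar> \<le> e / 2 * N \<psi>" .
      qed (use e m V mem in \<open>auto intro!: mem_intros\<close>)
      then show ?thesis using e by simp
    qed
    moreover have "0 \<le> N (\<lambda>x. (S s y x - y x) / s - (S h \<phi> x - \<phi> x) / h)" if "0 < s" for s
      using that V h by (intro N_nonneg mem_intros Smem) auto
    ultimately show "\<forall>\<^sub>F s in at_right 0. dist (N (\<lambda>x. (S s y x - y x) / s - (S h \<phi> x - \<phi> x) / h)) 0 < e"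
      using \<delta>(1) unfolding eventually_at_right_field
      by (intro exI[of _ "min \<delta> 1"]) (auto simp: dist_real_def)
  qed
qed

text \<open>The mean of the orbit of \<open>\<phi>\<close> over \<open>[0, h]\<close> is as close to \<open>\<phi>\<close> as the orbit is during that time.\<close>

theorem generator_domain_dense:
  assumes S: "C0_semigroup \<Omega> V N S" and V: "\<phi> \<in> V"
  shows "\<exists>u. (\<forall>n. u n \<in> generator_domain V N S) \<and> (\<lambda>n. N (\<lambda>x. u n x - \<phi> x)) \<longlonglongrightarrow> 0"
proof -
  note Smem = semigroup_mem[OF S]
  have "\<exists>y\<in>generator_domain V N S. N (\<lambda>x. y x - \<phi> x) \<le> e" if e: "0 < e" for e
  proof -
    obtain \<delta> where \<delta>: "0 < \<delta>" "\<And>h. 0 \<le> h \<Longrightarrow> h < \<delta> \<Longrightarrow> N (\<lambda>x. S h \<phi> x - \<phi> x) < e"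
      using semigroup_near_zero[OF S V e] by blast
    define h where "h = \<delta> / 2"
    have h: "0 < h" "h < \<delta>" using \<delta>(1) by (auto simp: h_def)
    obtain y where y: "y \<in> V" "(\<lambda>n. N (\<lambda>x. orbit_sum S h \<phi> n x - y x)) \<longlonglongrightarrow> 0"
      "\<And>\<psi>. \<psi> \<in> V \<Longrightarrow> ip y \<psi> = integral {0..h} (\<lambda>t. ip (S t \<phi>) \<psi>) / h"
      using orbit_mean[OF S V h(1)] by auto
    have "y \<in> generator_domain V N S"
      using orbit_mean_generator_value[OF S V y(1) h(1) y(2,3)] unfolding generator_domain_def by blast
    moreover have "N (\<lambda>x. y x - \<phi> x) \<le> e"
    proof (rule N_le_by_testing)
      fix \<psi> assume \<psi>: "\<psi> \<in> V"
      have "\<bar>integral {0..h} (\<lambda>t. ip (S t \<phi>) \<psi>) - (h - 0) * ip \<phi> \<psi>\<bar> \<le> (h - 0) * (e * N \<psi>)"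
      proof (rule integral_near_const)
        fix t assume t: "0 \<le> t" "t \<le> h"
        have m: "S t \<phi> \<in> V" using Smem t V by auto
        have "\<bar>ip (\<lambda>x. S t \<phi> x - \<phi> x) \<psi>\<bar> \<le> N (\<lambda>x. S t \<phi> x - \<phi> x) * N \<psi>"
          by (intro ip_le mem_intros m V \<psi>)
        also have "\<dots> \<le> e * N \<psi>"
          using \<delta>(2)[of t] t h N_nonneg[OF \<psi>] by (intro mult_right_mono) auto
        finally show "\<bar>ip (S t \<phi>) \<psi> - ip \<phi> \<psi>\<bar> \<le> e * N \<psi>" using ip_diff(1)[OF m V \<psi>] by simp
      qed (use h in \<open>auto intro: continuous_on_subset[OF continuous_on_weak_orbit[OF S V \<psi>]]\<close>)
      moreover have "integral {0..h} (\<lambda>t. ip (S t \<phi>) \<psi>) = h * ip y \<psi>"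
        unfolding y(3)[OF \<psi>] using h by simp
      ultimately have "\<bar>h * (ip y \<psi> - ip \<phi> \<psi>)\<bar> \<le> h * (e * N \<psi>)"
        by (simp add: right_diff_distrib)
      then show "\<bar>ip (\<lambda>x. y x - \<phi> x) \<psi>\<bar> \<le> e * N \<psi>"
        using h ip_diff(1)[OF y(1) V \<psi>] by (simp add: abs_mult)
    qed (use e y V in \<open>auto intro: mem_intros\<close>)
    ultimately show ?thesis by blast
  qed
  then have "\<exists>y. y \<in> generator_domain V N S \<and> N (\<lambda>x. y x - \<phi> x) \<le> 1 / real (Suc n)" for n
    by (metis of_nat_0_less_iff zero_less_Suc zero_less_divide_1_iff)
  then obtain u where u: "\<And>n. u n \<in> generator_domain V N S" "\<And>n. N (\<lambda>x. u n x - \<phi> x) \<le> 1 / real (Suc n)"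
    by metis
  have "u n \<in> V" for n using u(1) unfolding generator_domain_def is_generator_value_def by blast
  then have "(\<lambda>n. N (\<lambda>x. u n x - \<phi> x)) \<longlonglongrightarrow> 0"
    using u(2) N_nonneg[OF diff_mem[OF _ V]]
    by (intro Lim_null_comparison[OF _ LIMSEQ_inverse_real_of_nat]) (auto simp: inverse_eq_divide)
  then show ?thesis using u(1) by blast
qed

end

section \<open>Solutions of the homogeneous Lyapunov equation\<close>

context complete_function_space
begin

text \<open>The derivative of \<open>D (S t \<phi>) (S t \<phi>)\<close> from the right vanishes by the homogeneous equation at
  \<open>S t \<phi>\<close>. The local bound on the semigroup makes the convergence of the difference quotients uniform in
  \<open>t\<close>, so that increments over short steps of length \<open>h\<close> are at most \<open>h\<close> times an arbitrarily small constant, and can simply be added up.\<close>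

lemma homogeneous_form_constant_on_orbit:
  assumes S: "C0_semigroup \<Omega> V N S" and D: "bounded_bilinear_form V N D"
    and hom: "\<And>\<phi> \<eta>. is_generator_value V N S \<phi> \<eta> \<Longrightarrow> D \<eta> \<phi> + D \<phi> \<eta> = 0"
    and g: "is_generator_value V N S \<phi> \<eta>" and \<tau>: "0 < \<tau>"
  shows "D (S \<tau> \<phi>) (S \<tau> \<phi>) = D \<phi> \<phi>"
proof -
  note Smem = semigroup_mem[OF S]
  have V: "\<phi> \<in> V" "\<eta> \<in> V" and gen: "((\<lambda>h. N (\<lambda>x. (S h \<phi> x - \<phi> x) / h - \<eta> x)) \<longlongrightarrow> 0) (at_right 0)"
    using g unfolding is_generator_value_def by auto
  obtain L where L: "0 \<le> L" "\<And>t \<phi>. 0 \<le> t \<Longrightarrow> t \<le> 2 * \<tau> \<Longrightarrow> \<phi> \<in> V \<Longrightarrow> N (S t \<phi>) \<le> L * N \<phi>"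
    using semigroup_locally_bounded[OF S] by blast
  obtain K where K: "0 \<le> K" "\<And>\<phi> \<psi>. \<phi> \<in> V \<Longrightarrow> \<psi> \<in> V \<Longrightarrow> \<bar>D \<phi> \<psi>\<bar> \<le> K * (N \<phi> * N \<psi>)"
    using bilinear_bound[OF D] by blast
  define r where "r t = D (S t \<phi>) (S t \<phi>)" for t
  define e where "e h = N (\<lambda>x. (S h \<phi> x - \<phi> x) / h - \<eta> x)" for h
  define i where "i h = N (\<lambda>x. S h \<phi> x - \<phi> x)" for h
  define \<rho> where "\<rho> h = K * ((L * e h) * (L * N \<phi>)) + K * ((L * N \<eta>) * (L * i h)) + K * ((L * N \<phi>) * (L * e h))" for h
  have "(\<rho> \<longlongrightarrow> K * ((L * 0) * (L * N \<phi>)) + K * ((L * N \<eta>) * (L * 0)) + K * ((L * N \<phi>) * (L * 0))) (at_right 0)"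
    unfolding \<rho>_def e_def i_def by (intro tendsto_intros gen semigroup_tendsto[OF S V(1)])
  then have \<rho>: "(\<rho> \<longlongrightarrow> 0) (at_right 0)" by simp
  have step: "\<bar>r (t + h) - r t\<bar> \<le> h * \<rho> h" if t: "0 \<le> t" "t \<le> \<tau>" and h: "0 < h" "h \<le> \<tau>" for t h
  proof -
    let ?a = "S t \<phi>" and ?b = "S (t + h) \<phi>" and ?c = "S t \<eta>"
    let ?z = "\<lambda>x. (?b x - ?a x) / h" and ?y = "\<lambda>x. (S h \<phi> x - \<phi> x) / h - \<eta> x"
    have m: "?a \<in> V" "?b \<in> V" "?c \<in> V" "S h \<phi> \<in> V" using t h V Smem by auto
    have z: "?z \<in> V" and zc: "(\<lambda>x. ?z x - ?c x) \<in> V" and ba: "(\<lambda>x. ?b x - ?a x) \<in> V" and y: "?y \<in> V"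
      by (intro mem_intros m V)+
    have Nzc: "N (\<lambda>x. ?z x - ?c x) \<le> L * e h"
      unfolding semigroup_difference_quotient[OF S V t(1) h(1)] e_def using t h by (intro L y) auto
    have Nba: "N (\<lambda>x. ?b x - ?a x) \<le> L * i h"
      using semigroup_increment[OF S V(1) t(1), of "t + h"] L(2)[OF t(1) _ diff_mem[OF m(4) V(1)]] t h
      by (simp add: i_def)
    have Na: "N ?a \<le> L * N \<phi>" and Nb: "N ?b \<le> L * N \<phi>" and Nc: "N ?c \<le> L * N \<eta>"
      using t h by (auto intro!: L V)
    have "(r (t + h) - r t) / h = (D ?b ?b - D ?a ?b) / h + (D ?a ?b - D ?a ?a) / h"
      by (simp add: r_def diff_divide_distrib)
    also have "\<dots> = D ?z ?b + D ?a ?z"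
      using m by (simp add: bilinear_divide[OF D] bilinear_diff[OF D] diff_mem)
    \<comment> \<open>The omitted terms \<open>D ?c ?a + D ?a ?c\<close> cancel, because \<open>?c\<close> is a generator value of \<open>?a\<close>.\<close>
    also have "\<dots> = D (\<lambda>x. ?z x - ?c x) ?b + D ?c (\<lambda>x. ?b x - ?a x) + D ?a (\<lambda>x. ?z x - ?c x)"
      using hom[OF semigroup_generator_value[OF S g t(1)]]
        bilinear_diff(1)[OF D z m(3) m(2)] bilinear_diff(2)[OF D m(2,1,3)] bilinear_diff(2)[OF D z m(3) m(1)]
      by simp
    finally have eq: "(r (t + h) - r t) / h = \<dots>" .
    have "\<bar>D (\<lambda>x. ?z x - ?c x) ?b\<bar> \<le> K * ((L * e h) * (L * N \<phi>))"
      using K(2)[OF zc m(2)] mult_left_mono[OF mult_mono[OF Nzc Nb] K(1)] L(1) N_nonneg m V y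
      by (simp add: e_def)
    moreover have "\<bar>D ?c (\<lambda>x. ?b x - ?a x)\<bar> \<le> K * ((L * N \<eta>) * (L * i h))"
      using K(2)[OF m(3) ba] mult_left_mono[OF mult_mono[OF Nc Nba] K(1)] L(1) N_nonneg m V ba
      by (simp add: i_def)
    moreover have "\<bar>D ?a (\<lambda>x. ?z x - ?c x)\<bar> \<le> K * ((L * N \<phi>) * (L * e h))"
      using K(2)[OF m(1) zc] mult_left_mono[OF mult_mono[OF Na Nzc] K(1)] L(1) N_nonneg m V zc
      by (simp add: e_def)
    ultimately have "\<bar>(r (t + h) - r t) / h\<bar> \<le> \<rho> h" unfolding eq \<rho>_def by linarith
    then show ?thesis using h by (simp add: abs_divide pos_divide_le_eq mult.commute)
  qed
  have "\<bar>r \<tau> - r 0\<bar> \<le> \<epsilon>" if \<epsilon>: "0 < \<epsilon>" for \<epsilon>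
  proof -
    have "\<forall>\<^sub>F h in at_right 0. \<rho> h < \<epsilon> / \<tau>" using \<epsilon> \<tau> by (intro order_tendstoD(2)[OF \<rho>]) simp
    then obtain \<delta> where \<delta>: "0 < \<delta>" "\<And>h. 0 < h \<Longrightarrow> h < \<delta> \<Longrightarrow> \<rho> h < \<epsilon> / \<tau>"
      unfolding eventually_at_right_field by blast
    obtain n where n: "\<tau> / \<delta> < real n" using reals_Archimedean2 by blast
    then have "0 < real n" using \<tau> \<delta>(1) by (meson divide_pos_pos less_trans)
    define h where "h = \<tau> / real n"
    have h: "0 < h" "real n * h = \<tau>" using \<tau> \<open>0 < real n\<close> by (auto simp: h_def)
    have "\<tau> < real n * \<delta>" using n \<delta>(1) by (simp add: pos_divide_less_eq)
    then have "h < \<delta>" using \<open>0 < real n\<close> h(2) by (metis mult_less_cancel_left_pos)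
    moreover have "1 * h \<le> real n * h" using \<open>0 < real n\<close> h(1) by (intro mult_right_mono) auto
    ultimately have h: "0 < h" "h < \<delta>" "h \<le> \<tau>" "real n * h = \<tau>"
      using h by auto
    have "\<bar>r (real k * h) - r 0\<bar> \<le> real k * (h * (\<epsilon> / \<tau>))" if "k \<le> n" for k
      using that
    proof (induction k)
      case (Suc k)
      have "real k * h \<le> real n * h" using Suc(2) h(1) by (intro mult_right_mono) auto
      then have "\<bar>r (real k * h + h) - r (real k * h)\<bar> \<le> h * \<rho> h" using h by (intro step) auto
      also have "\<dots> \<le> h * (\<epsilon> / \<tau>)" using \<delta>(2)[OF h(1,2)] h(1) by (intro mult_left_mono) auto
      finally have "\<bar>r (real (Suc k) * h) - r (real k * h)\<bar> \<le> h * (\<epsilon> / \<tau>)" by (simp add: distrib_right add.commute)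
      moreover have "\<bar>r (real k * h) - r 0\<bar> \<le> real k * (h * (\<epsilon> / \<tau>))" using Suc by simp
      moreover have "real (Suc k) * (h * (\<epsilon> / \<tau>)) = real k * (h * (\<epsilon> / \<tau>)) + h * (\<epsilon> / \<tau>)"
        by (simp only: of_nat_Suc distrib_right mult_1_left add.commute)
      ultimately show ?case by linarith
    qed simp
    from this[of n] show ?thesis using h(4) \<tau> by (simp flip: mult.assoc)
  qed
  then have "\<bar>r \<tau> - r 0\<bar> \<le> 0" by (rule field_le_epsilon) simp
  moreover have "r 0 = D \<phi> \<phi>"
    unfolding r_def using semigroup_zero[OF S V(1)] by (intro bilinear_cong[OF D] Smem V) auto
  ultimately show ?thesis by (simp add: r_def)
qed

end

section \<open>The value form of an exponentially stable semigroup\<close>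

lemma ell2_inner_self_nonneg: "a \<in> ell2 \<Longrightarrow> 0 \<le> ell2_inner a a"
  unfolding ell2_def ell2_inner_def by (auto intro!: suminf_nonneg simp: power2_eq_square)

lemma ell2_inner_commute: "ell2_inner a b = ell2_inner b a"
  unfolding ell2_inner_def by (simp add: mult.commute)

lemma set_integrable_exp_decay:
  fixes \<omega> :: real
  assumes "\<omega> < 0"
  shows "set_integrable lborel {0..} (\<lambda>t. exp (\<omega> * t))"
proof -
  have "(\<lambda>t. exp (\<omega> * t)) absolutely_integrable_on {0..}"
    using integrable_on_exp_minus_to_infinity[of "-\<omega>" 0] assms
    by (intro nonnegative_absolutely_integrable_1) auto
  then show ?thesis
    unfolding set_integrable_def by (subst (asm) integrable_completion) auto
qed

text \<open>The semigroup is strongly continuous on the Hilbert space \<open>V\<close>, but observation and stability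
  live on a larger space \<open>W\<close> with a weaker norm, in which \<open>V\<close> is dense. The Lyapunov equation is posed on
  \<open>V\<close>.\<close>

locale stable_observation =
  hilbert_function_space \<Omega> V N ip + X: seminormed_function_space \<Omega> W NW
  for \<Omega> :: "(real^'n) set" and V N ip W NW +
  fixes S :: "real \<Rightarrow> (real^'n \<Rightarrow> real) \<Rightarrow> (real^'n \<Rightarrow> real)"
    and C :: "(real^'n \<Rightarrow> real) \<Rightarrow> nat \<Rightarrow> real"
    and \<kappa> M \<omega> :: real
  assumes V_subset: "V \<subseteq> W"
    and NW_le: "\<phi> \<in> V \<Longrightarrow> NW \<phi> \<le> \<kappa> * N \<phi>"
    and dense: "\<phi> \<in> W \<Longrightarrow> \<exists>u. (\<forall>n. u n \<in> V) \<and> (\<lambda>n. NW (\<lambda>x. u n x - \<phi> x)) \<longlonglongrightarrow> 0"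
    and S: "C0_semigroup \<Omega> V N S"
    and S_W: "0 \<le> t \<Longrightarrow> bounded_operator \<Omega> W NW (S t)"
    and stable: "0 \<le> t \<Longrightarrow> \<phi> \<in> W \<Longrightarrow> NW (S t \<phi>) \<le> M * exp (\<omega> * t) * NW \<phi>"
    and M: "1 \<le> M" and \<omega>: "\<omega> < 0" and \<kappa>: "0 \<le> \<kappa>"
    and C_ell2: "\<phi> \<in> W \<Longrightarrow> C \<phi> \<in> ell2"
    and C_form: "bounded_bilinear_form W NW (\<lambda>\<phi> \<psi>. ell2_inner (C \<phi>) (C \<psi>))"
begin

abbreviation "F \<phi> \<psi> \<equiv> (\<lambda>t. ell2_inner (C (S t \<phi>)) (C (S t \<psi>)))"

lemma S_W_mem: "0 \<le> t \<Longrightarrow> \<phi> \<in> W \<Longrightarrow> S t \<phi> \<in> W"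
  using X.operator_mem[OF S_W] by blast

lemma S_W_bounded:
  assumes "0 \<le> t" "\<phi> \<in> W"
  shows "NW (S t \<phi>) \<le> M * NW \<phi>"
proof -
  have "exp (\<omega> * t) \<le> 1" using \<omega> assms(1) by (simp add: mult_nonpos_nonneg)
  then have "M * exp (\<omega> * t) * NW \<phi> \<le> M * 1 * NW \<phi>"
    using M X.N_nonneg[OF assms(2)] by (intro mult_right_mono mult_left_mono) auto
  then show ?thesis using stable[OF assms] by simp
qed

text \<open>All \<open>S t\<close> are bounded by \<open>M\<close> on the larger space, which carries strong continuity over from the
  dense subspace, and uniformly in time because an increment over \<open>[s, t]\<close> is the image under \<open>S s\<close> of an
  increment over \<open>[0, t - s]\<close>.\<close>

lemma orbit_W_uniformly_continuous:
  assumes W: "\<phi> \<in> W" and e: "0 < e"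
  shows "\<exists>\<delta>>0. \<forall>s t. 0 \<le> s \<and> s \<le> t \<and> t - s < \<delta> \<longrightarrow> NW (\<lambda>x. S t \<phi> x - S s \<phi> x) \<le> e"
proof -
  have on_V: "\<exists>\<delta>>0. \<forall>s t. 0 \<le> s \<and> s \<le> t \<and> t - s < \<delta> \<longrightarrow> NW (\<lambda>x. S t \<phi> x - S s \<phi> x) \<le> e"
    if V: "\<phi> \<in> V" and e: "0 < e" for \<phi> e
  proof -
    define e' where "e' = e / (M * \<kappa> + 1)"
    have pos: "0 < M * \<kappa> + 1" using M \<kappa> by (simp add: add_nonneg_pos)
    then have e': "0 < e'" using e by (simp add: e'_def)
    obtain \<delta> where \<delta>: "0 < \<delta>" "\<And>h. 0 \<le> h \<Longrightarrow> h < \<delta> \<Longrightarrow> N (\<lambda>x. S h \<phi> x - \<phi> x) < e'"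
      using semigroup_near_zero[OF S V e'] by blast
    have "NW (\<lambda>x. S t \<phi> x - S s \<phi> x) \<le> e" if st: "0 \<le> s" "s \<le> t" "t - s < \<delta>" for s t
    proof -
      have m: "S (t - s) \<phi> \<in> V" "S s \<phi> \<in> V" "S t \<phi> \<in> V"
        using semigroup_mem[OF S _ V] st by auto
      note mW = subsetD[OF V_subset]
      have "AE x in lebesgue_on \<Omega>. S (s + (t - s)) \<phi> x = S s (S (t - s) \<phi>) x"
        using st V by (intro semigroup_add[OF S]) auto
      moreover have "AE x in lebesgue_on \<Omega>. S s (\<lambda>x. S (t - s) \<phi> x - \<phi> x) x = S s (S (t - s) \<phi>) x - S s \<phi> x"
        by (intro operator_diff semigroup_operator[OF S] st m V)
      ultimately have "NW (\<lambda>x. S t \<phi> x - S s \<phi> x) = NW (S s (\<lambda>x. S (t - s) \<phi> x - \<phi> x))"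
        by (intro X.N_cong mW diff_mem m V semigroup_mem[OF S st(1)]) auto
      also have "\<dots> \<le> M * NW (\<lambda>x. S (t - s) \<phi> x - \<phi> x)"
        by (intro S_W_bounded st mW diff_mem m V)
      also have "\<dots> \<le> M * (\<kappa> * N (\<lambda>x. S (t - s) \<phi> x - \<phi> x))"
        using M by (intro mult_left_mono NW_le diff_mem m V) auto
      also have "\<dots> \<le> M * (\<kappa> * e')"
        using M \<kappa> \<delta>(2)[of "t - s"] st by (intro mult_left_mono) auto
      also have "\<dots> \<le> (M * \<kappa> + 1) * e'" using e' by (simp add: algebra_simps)
      also have "\<dots> = e" using pos by (simp add: e'_def)
      finally show ?thesis .
    qed
    then show ?thesis using \<delta>(1) by blast
  qed
  have pos: "0 < e / (4 * M)" using e M by simp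
  obtain u where u: "\<And>n. u n \<in> V" "(\<lambda>n. NW (\<lambda>x. u n x - \<phi> x)) \<longlonglongrightarrow> 0" using dense[OF W] by blast
  obtain n where n: "NW (\<lambda>x. u n x - \<phi> x) < e / (4 * M)"
    using order_tendstoD(2)[OF u(2) pos] by (meson eventually_sequentially order_refl)
  let ?u = "u n"
  have uW: "?u \<in> W" using u(1) V_subset by blast
  have far: "NW (\<lambda>x. S t ?u x - S t \<phi> x) \<le> e / 4" if "0 \<le> t" for t
  proof -
    have "NW (\<lambda>x. S t ?u x - S t \<phi> x) \<le> M * NW (\<lambda>x. ?u x - \<phi> x)"
      unfolding X.operator_diff_norm[OF S_W[OF that] uW W] by (intro S_W_bounded that X.diff_mem uW W)
    also have "\<dots> \<le> M * (e / (4 * M))" using n M by (intro mult_left_mono) auto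
    finally show ?thesis using M by simp
  qed
  obtain \<delta> where \<delta>: "0 < \<delta>"
    "\<And>s t. 0 \<le> s \<Longrightarrow> s \<le> t \<Longrightarrow> t - s < \<delta> \<Longrightarrow> NW (\<lambda>x. S t ?u x - S s ?u x) \<le> e / 2"
    using on_V[OF u(1), of "e / 2" n] e by auto
  have "NW (\<lambda>x. S t \<phi> x - S s \<phi> x) \<le> e" if st: "0 \<le> s" "s \<le> t" "t - s < \<delta>" for s t
  proof -
    have t: "0 \<le> t" using st by simp
    have m: "S t \<phi> \<in> W" "S s \<phi> \<in> W" "S t ?u \<in> W" "S s ?u \<in> W"
      using S_W_mem st t W uW by auto
    show ?thesis
      using X.N_triangle[OF m(1,3,2)] X.N_triangle[OF m(3,4,2)] X.N_diff_commute[OF m(1,3)]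
        far[OF t] far[OF st(1)] \<delta>(2)[OF st] by simp
  qed
  then show ?thesis using \<delta>(1) by blast
qed

lemma orbit_W_tendsto:
  assumes W: "\<phi> \<in> W" and t: "0 \<le> t"
  shows "((\<lambda>s. NW (\<lambda>x. S s \<phi> x - S t \<phi> x)) \<longlongrightarrow> 0) (at t within {0..})"
proof (rule tendstoI)
  fix e :: real assume e: "0 < e"
  obtain \<delta> where \<delta>: "0 < \<delta>"
    "\<And>s t. 0 \<le> s \<Longrightarrow> s \<le> t \<Longrightarrow> t - s < \<delta> \<Longrightarrow> NW (\<lambda>x. S t \<phi> x - S s \<phi> x) \<le> e / 2"
    using orbit_W_uniformly_continuous[OF W, of "e / 2"] e by auto
  have "dist (NW (\<lambda>x. S s \<phi> x - S t \<phi> x)) 0 < e" if s: "0 \<le> s" "dist s t < \<delta>" for s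
  proof -
    have m: "S s \<phi> \<in> W" "S t \<phi> \<in> W" using S_W_mem W s t by auto
    have "NW (\<lambda>x. S s \<phi> x - S t \<phi> x) \<le> e / 2"
    proof (cases "s \<le> t")
      case True
      then show ?thesis
        using \<delta>(2)[OF s(1) True] s(2) X.N_diff_commute[OF m] by (simp add: dist_real_def)
    next
      case False
      then show ?thesis using \<delta>(2)[OF t, of s] s(2) by (simp add: dist_real_def)
    qed
    then show ?thesis using e X.N_nonneg[OF X.diff_mem[OF m]] by (simp add: dist_real_def)
  qed
  then show "\<forall>\<^sub>F s in at t within {0..}. dist (NW (\<lambda>x. S s \<phi> x - S t \<phi> x)) 0 < e"
    unfolding eventually_at using \<delta>(1) by (intro exI[of _ \<delta>]) auto
qed

lemma F_continuous:
  assumes W: "\<phi> \<in> W" "\<psi> \<in> W"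
  shows "continuous_on {0..} (F \<phi> \<psi>)"
  unfolding continuous_on_def
proof
  fix t :: real assume "t \<in> {0..}"
  then have t: "0 \<le> t" by simp
  have ev: "\<forall>\<^sub>F s in at t within {0..}. S s \<phi> \<in> W" if "\<phi> \<in> W" for \<phi>
    unfolding eventually_at using S_W_mem that by (intro exI[of _ 1]) auto
  show "(F \<phi> \<psi> \<longlongrightarrow> F \<phi> \<psi> t) (at t within {0..})"
    by (rule X.bilinear_tendsto[OF C_form S_W_mem[OF t W(1)] S_W_mem[OF t W(2)] ev[OF W(1)] ev[OF W(2)]
          orbit_W_tendsto[OF W(1) t] orbit_W_tendsto[OF W(2) t]])
qed

lemma F_bound:
  obtains K where "0 \<le> K"
    "\<And>\<phi> \<psi> t. \<phi> \<in> W \<Longrightarrow> \<psi> \<in> W \<Longrightarrow> 0 \<le> t \<Longrightarrow> \<bar>F \<phi> \<psi> t\<bar> \<le> K * (NW \<phi> * NW \<psi>) * exp (2 * \<omega> * t)"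
proof -
  obtain K where K: "0 \<le> K" "\<And>\<phi> \<psi>. \<phi> \<in> W \<Longrightarrow> \<psi> \<in> W \<Longrightarrow> \<bar>ell2_inner (C \<phi>) (C \<psi>)\<bar> \<le> K * (NW \<phi> * NW \<psi>)"
    using X.bilinear_bound[OF C_form] by blast
  show ?thesis
  proof
    show "0 \<le> K * M\<^sup>2" using K(1) by simp
    fix \<phi> \<psi> t assume W: "\<phi> \<in> W" "\<psi> \<in> W" and t: "0 \<le> (t::real)"
    have "\<bar>F \<phi> \<psi> t\<bar> \<le> K * (NW (S t \<phi>) * NW (S t \<psi>))"
      by (intro K S_W_mem t W)
    also have "\<dots> \<le> K * ((M * exp (\<omega> * t) * NW \<phi>) * (M * exp (\<omega> * t) * NW \<psi>))"
      using K(1) M W t by (intro mult_left_mono mult_mono stable X.N_nonneg S_W_mem mult_nonneg_nonneg) auto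
    also have "\<dots> = K * M\<^sup>2 * (NW \<phi> * NW \<psi>) * exp (2 * \<omega> * t)"
    proof -
      have "exp (2 * \<omega> * t) = exp (\<omega> * t) * exp (\<omega> * t)" by (simp flip: exp_add)
      then show ?thesis by (simp add: power2_eq_square)
    qed
    finally show "\<bar>F \<phi> \<psi> t\<bar> \<le> K * M\<^sup>2 * (NW \<phi> * NW \<psi>) * exp (2 * \<omega> * t)" .
  qed
qed

lemma F_integrable:
  assumes W: "\<phi> \<in> W" "\<psi> \<in> W"
  shows "set_integrable lborel {0..} (F \<phi> \<psi>)"
proof -
  obtain K where "0 \<le> K" and K: "\<And>\<phi> \<psi> t. \<phi> \<in> W \<Longrightarrow> \<psi> \<in> W \<Longrightarrow> 0 \<le> t \<Longrightarrow> \<bar>F \<phi> \<psi> t\<bar> \<le> K * (NW \<phi> * NW \<psi>) * exp (2 * \<omega> * t)"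
    using F_bound by blast
  have "set_integrable lborel {0..} (\<lambda>t. K * (NW \<phi> * NW \<psi>) * exp (2 * \<omega> * t))"
    using \<omega> by (intro set_integrable_mult_right set_integrable_exp_decay) auto
  then show ?thesis
  proof (rule set_integrable_bound)
    show "set_borel_measurable lborel {0..} (F \<phi> \<psi>)"
      using borel_measurable_continuous_on_indicator[OF _ F_continuous[OF W]]
      unfolding set_borel_measurable_def by simp
    show "AE t in lborel. t \<in> {0..} \<longrightarrow> norm (F \<phi> \<psi> t) \<le> norm (K * (NW \<phi> * NW \<psi>) * exp (2 * \<omega> * t))"
      using K[OF W] by (auto intro!: AE_I2 intro: order_trans[OF _ abs_ge_self])
  qed
qed

lemma value_form_bounded: "bounded_bilinear_form W NW (value_form C S)"
proof -
  obtain K where K: "0 \<le> K" "\<And>\<phi> \<psi> t. \<phi> \<in> W \<Longrightarrow> \<psi> \<in> W \<Longrightarrow> 0 \<le> t \<Longrightarrow> \<bar>F \<phi> \<psi> t\<bar> \<le> K * (NW \<phi> * NW \<psi>) * exp (2 * \<omega> * t)"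
    using F_bound by blast
  define I where "I = (LINT t:{0..}|lborel. exp (2 * \<omega> * t))"
  have int: "set_integrable lborel {0..} (\<lambda>t. exp (2 * \<omega> * t))"
    using \<omega> by (intro set_integrable_exp_decay) auto
  have "\<bar>value_form C S \<phi> \<psi>\<bar> \<le> (K * I) * NW \<phi> * NW \<psi>" if W: "\<phi> \<in> W" "\<psi> \<in> W" for \<phi> \<psi>
  proof -
    have "\<bar>value_form C S \<phi> \<psi>\<bar> \<le> (LINT t:{0..}|lborel. \<bar>F \<phi> \<psi> t\<bar>)"
      unfolding value_form_def using set_integral_norm_bound[OF F_integrable[OF W]] by simp
    also have "\<dots> \<le> (LINT t:{0..}|lborel. K * (NW \<phi> * NW \<psi>) * exp (2 * \<omega> * t))"
      by (intro set_integral_mono set_integrable_abs F_integrable W set_integrable_mult_right int K) auto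
    also have "\<dots> = (K * I) * NW \<phi> * NW \<psi>" by (simp add: I_def)
    finally show ?thesis .
  qed
  moreover have "value_form C S (\<lambda>x. a * \<phi> x + b * \<psi> x) \<eta> = a * value_form C S \<phi> \<eta> + b * value_form C S \<psi> \<eta> \<and>
      value_form C S \<eta> (\<lambda>x. a * \<phi> x + b * \<psi> x) = a * value_form C S \<eta> \<phi> + b * value_form C S \<eta> \<psi>"
    if W: "\<phi> \<in> W" "\<psi> \<in> W" "\<eta> \<in> W" for \<phi> \<psi> \<eta> a b
  proof -
    have "F (\<lambda>x. a * \<phi> x + b * \<psi> x) \<eta> t = a * F \<phi> \<eta> t + b * F \<psi> \<eta> t \<and>
        F \<eta> (\<lambda>x. a * \<phi> x + b * \<psi> x) t = a * F \<eta> \<phi> t + b * F \<eta> \<psi> t" if t: "0 \<le> t" for t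
    proof -
      have m: "S t \<phi> \<in> W" "S t \<psi> \<in> W" "S t \<eta> \<in> W" "S t (\<lambda>x. a * \<phi> x + b * \<psi> x) \<in> W"
        using W t by (auto intro!: S_W_mem X.lin_mem)
      have ae: "AE x in lebesgue_on \<Omega>. S t (\<lambda>x. a * \<phi> x + b * \<psi> x) x = a * S t \<phi> x + b * S t \<psi> x"
        by (intro X.operator_lin S_W t W)
      show ?thesis
        using X.bilinear_cong[OF C_form m(4) X.lin_mem[OF m(1,2)] m(3) m(3) ae]
          X.bilinear_cong[OF C_form m(3) m(3) m(4) X.lin_mem[OF m(1,2)] _ ae]
          X.bilinear_lin[OF C_form m(1,2,3)] by simp
    qed
    then have "value_form C S (\<lambda>x. a * \<phi> x + b * \<psi> x) \<eta> = (LINT t:{0..}|lborel. a * F \<phi> \<eta> t + b * F \<psi> \<eta> t)"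
      "value_form C S \<eta> (\<lambda>x. a * \<phi> x + b * \<psi> x) = (LINT t:{0..}|lborel. a * F \<eta> \<phi> t + b * F \<eta> \<psi> t)"
      unfolding value_form_def by (auto intro!: set_lebesgue_integral_cong)
    then show ?thesis
      using W by (simp add: value_form_def set_integral_add F_integrable)
  qed
  ultimately show ?thesis unfolding bounded_bilinear_form_def by blast
qed

lemma form_restrict:
  assumes B: "bounded_bilinear_form W NW B"
  shows "bounded_bilinear_form V N B"
proof -
  obtain K where K: "0 \<le> K" "\<And>\<phi> \<psi>. \<phi> \<in> W \<Longrightarrow> \<psi> \<in> W \<Longrightarrow> \<bar>B \<phi> \<psi>\<bar> \<le> K * (NW \<phi> * NW \<psi>)"
    using X.bilinear_bound[OF B] by blast
  have "\<bar>B \<phi> \<psi>\<bar> \<le> (K * \<kappa>\<^sup>2) * N \<phi> * N \<psi>" if V: "\<phi> \<in> V" "\<psi> \<in> V" for \<phi> \<psi>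
  proof -
    have W: "\<phi> \<in> W" "\<psi> \<in> W" using V V_subset by auto
    have "\<bar>B \<phi> \<psi>\<bar> \<le> K * (NW \<phi> * NW \<psi>)" by (rule K(2)[OF W])
    also have "\<dots> \<le> K * ((\<kappa> * N \<phi>) * (\<kappa> * N \<psi>))"
      using K(1) \<kappa> W V by (intro mult_left_mono mult_mono NW_le X.N_nonneg mult_nonneg_nonneg N_nonneg)
    also have "\<dots> = (K * \<kappa>\<^sup>2) * N \<phi> * N \<psi>" by (simp add: power2_eq_square)
    finally show ?thesis .
  qed
  moreover have "B (\<lambda>x. a * \<phi> x + b * \<psi> x) \<eta> = a * B \<phi> \<eta> + b * B \<psi> \<eta> \<and>
      B \<eta> (\<lambda>x. a * \<phi> x + b * \<psi> x) = a * B \<eta> \<phi> + b * B \<eta> \<psi>"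
    if "\<phi> \<in> V" "\<psi> \<in> V" "\<eta> \<in> V" for \<phi> \<psi> \<eta> a b
    using X.bilinear_lin[OF B subsetD[OF V_subset that(1)] subsetD[OF V_subset that(2)]
        subsetD[OF V_subset that(3)]] by blast
  ultimately show ?thesis unfolding bounded_bilinear_form_def by blast
qed

lemma value_form_shift:
  assumes V: "\<phi> \<in> V" "\<psi> \<in> V" and h: "0 \<le> h"
  shows "value_form C S (S h \<phi>) (S h \<psi>) = (LINT t:{h..}|lborel. F \<phi> \<psi> t)"
proof -
  have "F (S h \<phi>) (S h \<psi>) t = F \<phi> \<psi> (h + t)" if t: "0 \<le> t" for t
  proof -
    have "AE x in lebesgue_on \<Omega>. S t (S h \<phi>) x = S (h + t) \<phi> x" if "\<phi> \<in> V" for \<phi>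
      using semigroup_add[OF S t h that] by (auto simp: add.commute)
    then show ?thesis
      using V V_subset t h by (intro X.bilinear_cong[OF C_form] S_W_mem) auto
  qed
  then have "value_form C S (S h \<phi>) (S h \<psi>) = (LINT t:{0..}|lborel. F \<phi> \<psi> (h + t))"
    unfolding value_form_def by (intro set_lebesgue_integral_cong) auto
  also have "\<dots> = (LINT t|lborel. indicator {h..} (h + 1 * t) *\<^sub>R F \<phi> \<psi> (h + 1 * t))"
    unfolding set_lebesgue_integral_def by (intro Bochner_Integration.integral_cong) (auto simp: indicator_def)
  also have "\<dots> = (LINT t:{h..}|lborel. F \<phi> \<psi> t)"
    unfolding set_lebesgue_integral_def
    using lborel_integral_real_affine[of 1 "\<lambda>t. indicator {h..} t *\<^sub>R F \<phi> \<psi> t" h] by simp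
  finally show ?thesis .
qed

text \<open>The decrement is minus the integral of the continuous function \<open>F \<phi> \<psi>\<close> over \<open>[0, h]\<close>.\<close>

lemma value_form_decrement:
  assumes V: "\<phi> \<in> V" "\<psi> \<in> V"
  shows "((\<lambda>h. (value_form C S (S h \<phi>) (S h \<psi>) - value_form C S \<phi> \<psi>) / h) \<longlongrightarrow> - ell2_inner (C \<phi>) (C \<psi>)) (at_right 0)"
proof (rule tendstoI)
  fix e :: real assume e: "0 < e"
  have W: "\<phi> \<in> W" "\<psi> \<in> W" using V V_subset by auto
  have F0: "F \<phi> \<psi> 0 = ell2_inner (C \<phi>) (C \<psi>)"
    using semigroup_zero[OF S] V W by (intro X.bilinear_cong[OF C_form] S_W_mem) auto
  obtain \<delta> where \<delta>: "0 < \<delta>" "\<And>t. 0 \<le> t \<Longrightarrow> t < \<delta> \<Longrightarrow> \<bar>F \<phi> \<psi> t - F \<phi> \<psi> 0\<bar> < e / 2"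
  proof -
    have "\<exists>\<delta>>0. \<forall>t\<in>{0..}. dist t 0 < \<delta> \<longrightarrow> dist (F \<phi> \<psi> t) (F \<phi> \<psi> 0) < e / 2"
      using F_continuous[OF W, unfolded continuous_on_iff, rule_format, of 0 "e / 2"] e by simp
    then obtain \<delta> where "0 < \<delta>" "\<forall>t\<in>{0..}. dist t 0 < \<delta> \<longrightarrow> dist (F \<phi> \<psi> t) (F \<phi> \<psi> 0) < e / 2" by blast
    then show ?thesis by (intro that[of \<delta>]) (auto simp: dist_real_def)
  qed
  have "dist ((value_form C S (S h \<phi>) (S h \<psi>) - value_form C S \<phi> \<psi>) / h) (- ell2_inner (C \<phi>) (C \<psi>)) < e"
    if h: "0 < h" "h < \<delta>" for h
  proof -
    have int: "set_integrable lborel {0..<h} (F \<phi> \<psi>)" "set_integrable lborel {h..} (F \<phi> \<psi>)"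
      using h by (auto intro!: set_integrable_subset[OF F_integrable[OF W]])
    have "{0..} = {0..<h} \<union> {h..}" using h by auto
    then have "value_form C S \<phi> \<psi> = (LINT t:{0..<h}|lborel. F \<phi> \<psi> t) + (LINT t:{h..}|lborel. F \<phi> \<psi> t)"
      unfolding value_form_def using set_integral_Un[OF _ int] by (auto simp: disjoint_iff)
    then have dec: "value_form C S (S h \<phi>) (S h \<psi>) - value_form C S \<phi> \<psi> = - (LINT t:{0..<h}|lborel. F \<phi> \<psi> t)"
      using value_form_shift[OF V, of h] h by simp
    have const: "(LINT t:{0..<h}|lborel. c) = h * c" "set_integrable lborel {0..<h} (\<lambda>_. c)" for c :: real
      using h by (auto simp: set_lebesgue_integral_def set_integrable_def)
    have near: "\<bar>F \<phi> \<psi> t - F \<phi> \<psi> 0\<bar> < e / 2" if "t \<in> {0..<h}" for t using \<delta>(2) that h by simp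
    have "F \<phi> \<psi> t \<le> F \<phi> \<psi> 0 + e / 2" "F \<phi> \<psi> 0 - e / 2 \<le> F \<phi> \<psi> t" if "t \<in> {0..<h}" for t
      using near[OF that] by linarith+
    then have "(LINT t:{0..<h}|lborel. F \<phi> \<psi> t) \<le> h * (F \<phi> \<psi> 0 + e / 2)"
      "h * (F \<phi> \<psi> 0 - e / 2) \<le> (LINT t:{0..<h}|lborel. F \<phi> \<psi> t)"
      unfolding const(1)[symmetric] by (intro set_integral_mono int const; blast)+
    then have "(LINT t:{0..<h}|lborel. F \<phi> \<psi> t) / h \<le> F \<phi> \<psi> 0 + e / 2"
      "F \<phi> \<psi> 0 - e / 2 \<le> (LINT t:{0..<h}|lborel. F \<phi> \<psi> t) / h"
      using h by (auto simp: pos_divide_le_eq pos_le_divide_eq mult.commute)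
    then show ?thesis unfolding dec F0 using e by (simp add: dist_real_def abs_less_iff F0)
  qed
  then show "\<forall>\<^sub>F h in at_right 0. dist ((value_form C S (S h \<phi>) (S h \<psi>) - value_form C S \<phi> \<psi>) / h)
      (- ell2_inner (C \<phi>) (C \<psi>)) < e"
    unfolding eventually_at_right_field using \<delta>(1) by blast
qed

text \<open>The product rule turns the limit of the decrement into the left-hand side of the equation.\<close>

lemma value_form_lyapunov_equation:
  assumes "is_generator_value V N S \<phi> \<eta>" "is_generator_value V N S \<psi> \<zeta>"
  shows "value_form C S \<eta> \<psi> + value_form C S \<phi> \<zeta> + ell2_inner (C \<phi>) (C \<psi>) = 0"
proof -
  let ?P = "value_form C S"
  note P = form_restrict[OF value_form_bounded]
  have V: "\<phi> \<in> V" "\<eta> \<in> V" "\<psi> \<in> V" "\<zeta> \<in> V" and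
    lim: "((\<lambda>h. N (\<lambda>x. (S h \<phi> x - \<phi> x) / h - \<eta> x)) \<longlongrightarrow> 0) (at_right 0)"
    "((\<lambda>h. N (\<lambda>x. (S h \<psi> x - \<psi> x) / h - \<zeta> x)) \<longlongrightarrow> 0) (at_right 0)"
    using assms unfolding is_generator_value_def by auto
  have ev0: "\<forall>\<^sub>F h in at_right (0::real). 0 < h" by (simp add: eventually_at_right_less)
  have ev: "\<forall>\<^sub>F h in at_right 0. S h \<phi> \<in> V" "\<forall>\<^sub>F h in at_right 0. (\<lambda>x. (S h \<phi> x - \<phi> x) / h) \<in> V"
    if "\<phi> \<in> V" for \<phi>
    by (rule eventually_mono[OF ev0], auto intro!: divide_mem diff_mem semigroup_mem[OF S] that)+
  have "((\<lambda>h. ?P (\<lambda>x. (S h \<phi> x - \<phi> x) / h) (S h \<psi>) + ?P \<phi> (\<lambda>x. (S h \<psi> x - \<psi> x) / h)) \<longlongrightarrow> ?P \<eta> \<psi> + ?P \<phi> \<zeta>) (at_right 0)"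
  proof (rule tendsto_add)
    show "((\<lambda>h. ?P (\<lambda>x. (S h \<phi> x - \<phi> x) / h) (S h \<psi>)) \<longlongrightarrow> ?P \<eta> \<psi>) (at_right 0)"
      by (rule bilinear_tendsto[OF P V(2,3) ev(2)[OF V(1)] ev(1)[OF V(3)] lim(1) semigroup_tendsto[OF S V(3)]])
    show "((\<lambda>h. ?P \<phi> (\<lambda>x. (S h \<psi> x - \<psi> x) / h)) \<longlongrightarrow> ?P \<phi> \<zeta>) (at_right 0)"
      by (rule bilinear_tendsto[OF P V(1,4) _ ev(2)[OF V(3)] _ lim(2)]) (simp_all add: V N_zero)
  qed
  moreover have "\<forall>\<^sub>F h in at_right 0. ?P (\<lambda>x. (S h \<phi> x - \<phi> x) / h) (S h \<psi>) + ?P \<phi> (\<lambda>x. (S h \<psi> x - \<psi> x) / h) =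
      (?P (S h \<phi>) (S h \<psi>) - ?P \<phi> \<psi>) / h"
    using ev(1)[OF V(1)] ev(1)[OF V(3)]
    by eventually_elim (simp add: bilinear_divide[OF P] bilinear_diff[OF P] diff_mem V flip: add_divide_distrib)
  ultimately have "((\<lambda>h. (?P (S h \<phi>) (S h \<psi>) - ?P \<phi> \<psi>) / h) \<longlongrightarrow> ?P \<eta> \<psi> + ?P \<phi> \<zeta>) (at_right 0)"
    by (rule Lim_transform_eventually)
  from tendsto_unique[OF _ this value_form_decrement[OF V(1,3)]] show ?thesis by simp
qed

lemma value_form_self_nonneg: "\<phi> \<in> W \<Longrightarrow> 0 \<le> value_form C S \<phi> \<phi>"
  unfolding value_form_def set_lebesgue_integral_def
  by (intro Bochner_Integration.integral_nonneg) (auto simp: indicator_def intro!: ell2_inner_self_nonneg C_ell2 S_W_mem)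

lemma value_form_lyapunov_solution: "lyapunov_solution V N S C (value_form C S)"
  unfolding lyapunov_solution_def
  using form_restrict[OF value_form_bounded] value_form_self_nonneg V_subset
    value_form_lyapunov_equation[OF generator_value generator_value]
  by (auto simp: value_form_def ell2_inner_commute)

text \<open>On the domain of the generator, \<open>D = Q - P\<close> is constant along orbits, and \<open>P\<close> vanishes in the limit
  along them, so the nonnegativity of \<open>Q\<close> is inherited by \<open>D\<close>.\<close>

lemma value_form_le_lyapunov_solution:
  assumes Q: "lyapunov_solution V N S C Q" and V: "\<phi> \<in> V"
  shows "value_form C S \<phi> \<phi> \<le> Q \<phi> \<phi>"
proof -
  let ?P = "value_form C S"
  define D where "D = (\<lambda>\<phi> \<psi>. Q \<phi> \<psi> - ?P \<phi> \<psi>)"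
  have Qb: "bounded_bilinear_form V N Q" using Q unfolding lyapunov_solution_def by blast
  note Pb = form_restrict[OF value_form_bounded]
  have Db: "bounded_bilinear_form V N D" unfolding D_def by (rule bilinear_form_diff[OF Qb Pb])
  have hom: "D \<eta> \<phi> + D \<phi> \<eta> = 0" if g: "is_generator_value V N S \<phi> \<eta>" for \<phi> \<eta>
  proof -
    have dom: "\<phi> \<in> generator_domain V N S" using g unfolding generator_domain_def by blast
    let ?g = "generator V N S \<phi>"
    have g': "is_generator_value V N S \<phi> ?g" by (rule generator_value[OF dom])
    have z: "N (\<lambda>x. \<eta> x - ?g x) = 0" by (rule generator_value_unique[OF S g g'])
    have m: "\<phi> \<in> V" "\<eta> \<in> V" "?g \<in> V" using g g' unfolding is_generator_value_def by auto
    \<comment> \<open>\<open>?g\<close> is a chosen representative; \<open>D\<close> takes the same value at any other.\<close>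
    have "D \<eta> \<phi> = D ?g \<phi>" "D \<phi> \<eta> = D \<phi> ?g"
      by (rule bilinear_eq[OF Db]; simp add: m z N_zero)+
    moreover have "Q ?g \<phi> + Q \<phi> ?g + ell2_inner (C \<phi>) (C \<phi>) = 0"
      using Q dom unfolding lyapunov_solution_def by blast
    ultimately show ?thesis
      using value_form_lyapunov_equation[OF g' g'] by (simp add: D_def)
  qed
  have on_domain: "0 \<le> D \<phi> \<phi>" if "\<phi> \<in> generator_domain V N S" for \<phi>
  proof -
    obtain \<eta> where g: "is_generator_value V N S \<phi> \<eta>" using \<open>\<phi> \<in> generator_domain V N S\<close> unfolding generator_domain_def by blast
    then have V: "\<phi> \<in> V" and W: "\<phi> \<in> W" using V_subset unfolding is_generator_value_def by auto
    obtain K where K: "0 \<le> K" "\<And>\<phi> \<psi>. \<phi> \<in> W \<Longrightarrow> \<psi> \<in> W \<Longrightarrow> \<bar>?P \<phi> \<psi>\<bar> \<le> K * (NW \<phi> * NW \<psi>)"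
      using X.bilinear_bound[OF value_form_bounded] by blast
    let ?b = "\<lambda>n::nat. M * exp (\<omega> * real (Suc n)) * NW \<phi>"
    have lower: "- (K * (?b n * ?b n)) \<le> D \<phi> \<phi>" for n
    proof -
      let ?t = "real (Suc n)"
      have St: "S ?t \<phi> \<in> V" "S ?t \<phi> \<in> W" using semigroup_mem[OF S _ V] S_W_mem[OF _ W] by auto
      have "D \<phi> \<phi> = D (S ?t \<phi>) (S ?t \<phi>)"
        by (rule homogeneous_form_constant_on_orbit[OF S Db hom g, symmetric]) simp_all
      moreover have "0 \<le> Q (S ?t \<phi>) (S ?t \<phi>)" using Q St unfolding lyapunov_solution_def by blast
      moreover have "\<bar>?P (S ?t \<phi>) (S ?t \<phi>)\<bar> \<le> K * (NW (S ?t \<phi>) * NW (S ?t \<phi>))" by (rule K(2)[OF St(2) St(2)])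
      moreover have "K * (NW (S ?t \<phi>) * NW (S ?t \<phi>)) \<le> K * (?b n * ?b n)"
        using K(1) M St W by (intro mult_left_mono mult_mono stable X.N_nonneg mult_nonneg_nonneg) auto
      ultimately show ?thesis unfolding D_def by linarith
    qed
    have "(\<lambda>n. exp (\<omega> * real (Suc n))) \<longlonglongrightarrow> 0"
    proof -
      have "(\<lambda>n. exp \<omega> ^ Suc n) \<longlonglongrightarrow> 0"
        using \<omega> by (intro LIMSEQ_Suc LIMSEQ_realpow_zero) auto
      then show ?thesis by (simp only: exp_of_nat2_mult)
    qed
    then have "(\<lambda>n. - (K * (?b n * ?b n))) \<longlonglongrightarrow> - (K * ((M * 0 * NW \<phi>) * (M * 0 * NW \<phi>)))"
      by (intro tendsto_intros)
    then have "- (K * ((M * 0 * NW \<phi>) * (M * 0 * NW \<phi>))) \<le> D \<phi> \<phi>"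
      by (rule LIMSEQ_le_const2) (use lower in blast)
    then show ?thesis by simp
  qed
  obtain u where u: "\<And>n. u n \<in> generator_domain V N S" "(\<lambda>n. N (\<lambda>x. u n x - \<phi> x)) \<longlonglongrightarrow> 0"
    using generator_domain_dense[OF S V] by blast
  have uV: "u n \<in> V" for n using u(1) unfolding generator_domain_def is_generator_value_def by blast
  have "(\<lambda>n. D (u n) (u n)) \<longlonglongrightarrow> D \<phi> \<phi>"
    by (rule bilinear_tendsto[OF Db V V _ _ u(2) u(2)]) (simp_all add: uV)
  then have "0 \<le> D \<phi> \<phi>" by (rule LIMSEQ_le_const) (use on_domain u(1) in blast)
  then show ?thesis by (simp add: D_def)
qed

theorem value_form_minimal: "minimal_lyapunov_solution V N S C (value_form C S)"
  unfolding minimal_lyapunov_solution_def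
  using value_form_lyapunov_solution value_form_le_lyapunov_solution by blast

lemma minimal_lyapunov_solution_unique:
  assumes Q: "minimal_lyapunov_solution V N S C Q" and V: "\<phi> \<in> V" "\<psi> \<in> V"
  shows "Q \<phi> \<psi> = value_form C S \<phi> \<psi>"
proof (rule symmetric_form_determined_by_diagonal[OF _ _ _ _ _ V])
  show "Q \<phi> \<phi> = value_form C S \<phi> \<phi>" if "\<phi> \<in> V" for \<phi>
    using Q value_form_minimal that unfolding minimal_lyapunov_solution_def by (meson order_antisym)
qed (use Q value_form_minimal in \<open>auto simp: minimal_lyapunov_solution_def lyapunov_solution_def\<close>)

theorem value_form_unique_extension:
  "unique_bounded_extension V W NW (value_form C S) (value_form C S)"
  unfolding unique_bounded_extension_def
proof (intro conjI allI impI ballI)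
  fix B \<phi> \<psi>
  assume B: "bounded_bilinear_form W NW B \<and> (\<forall>\<phi>\<in>V. \<forall>\<psi>\<in>V. B \<phi> \<psi> = value_form C S \<phi> \<psi>)"
    and W: "\<phi> \<in> W" "\<psi> \<in> W"
  show "B \<phi> \<psi> = value_form C S \<phi> \<psi>"
    by (rule X.bilinear_determined_by_dense[OF _ value_form_bounded V_subset dense _ W]) (use B in auto)
qed (use V_subset value_form_bounded in auto)

end

section \<open>Weighted Lebesgue spaces\<close>

locale weighted_domain =
  fixes \<Omega> :: "(real^'n) set" and w :: "real^'n \<Rightarrow> real"
  assumes \<Omega>: "\<Omega> \<in> lmeasurable"
    and w_measurable [measurable]: "w \<in> borel_measurable (lebesgue_on \<Omega>)"
    and w_pos: "AE x in lebesgue_on \<Omega>. 0 < w x"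
begin

sublocale finite_measure "lebesgue_on \<Omega>"
  by (rule finite_measure_lebesgue_on[OF \<Omega>])

abbreviation "\<mu> \<equiv> lebesgue_on \<Omega>"
abbreviation "X \<equiv> X_space \<Omega> w"
abbreviation "H \<equiv> H_space \<Omega> w"
abbreviation "NX \<equiv> X_norm \<Omega> w"
abbreviation "NH \<equiv> H_norm \<Omega> w"
abbreviation "ip \<equiv> pairing \<Omega> w"

lemma mem_X_iff: "\<phi> \<in> X \<longleftrightarrow> \<phi> \<in> borel_measurable \<mu> \<and> integrable \<mu> (\<lambda>x. \<bar>\<phi> x\<bar> * w x)"
  by (simp add: Lp_def)

lemma X_norm_eq: "NX \<phi> = (LINT x|\<mu>. \<bar>\<phi> x\<bar> * w x)"
proof -
  have "0 \<le> (LINT x|\<mu>. \<bar>\<phi> x\<bar> * w x)"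
    using w_pos by (intro integral_nonneg_AE) auto
  then show ?thesis by (simp add: Lp_norm_def)
qed

lemma mem_H_iff: "\<phi> \<in> H \<longleftrightarrow> \<phi> \<in> borel_measurable \<mu> \<and> integrable \<mu> (\<lambda>x. (\<phi> x)\<^sup>2 * (w x)\<^sup>2)"
  by (simp add: Lp_def)

lemma pairing_self: "ip \<phi> \<phi> = (LINT x|\<mu>. (\<phi> x)\<^sup>2 * (w x)\<^sup>2)"
  by (simp add: pairing_def power2_eq_square)

lemma pairing_self_nonneg: "0 \<le> ip \<phi> \<phi>"
  unfolding pairing_self by simp

lemma H_norm_eq: "NH \<phi> = sqrt (ip \<phi> \<phi>)"
  using pairing_self_nonneg[of \<phi>] by (simp add: Lp_norm_def pairing_self powr_half_sqrt)

lemma X_dominated: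
  assumes \<phi>: "\<phi> \<in> borel_measurable \<mu>" and g: "integrable \<mu> g" and le: "AE x in \<mu>. \<bar>\<phi> x\<bar> * w x \<le> g x"
  shows "\<phi> \<in> X" "NX \<phi> \<le> (LINT x|\<mu>. g x)"
proof -
  have [measurable]: "\<phi> \<in> borel_measurable \<mu>" by (rule \<phi>)
  have ae: "AE x in \<mu>. norm (\<bar>\<phi> x\<bar> * w x) \<le> norm (g x)"
    using le w_pos by eventually_elim auto
  have int: "integrable \<mu> (\<lambda>x. \<bar>\<phi> x\<bar> * w x)"
    by (rule Bochner_Integration.integrable_bound[OF g _ ae]) measurable
  then show "\<phi> \<in> X" using \<phi> by (simp add: mem_X_iff)
  show "NX \<phi> \<le> (LINT x|\<mu>. g x)"
    unfolding X_norm_eq by (rule integral_mono_AE[OF int g le])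
qed

lemma X_lin:
  assumes "\<phi> \<in> X" "\<psi> \<in> X"
  shows "(\<lambda>x. a * \<phi> x + b * \<psi> x) \<in> X" "NX (\<lambda>x. a * \<phi> x + b * \<psi> x) \<le> \<bar>a\<bar> * NX \<phi> + \<bar>b\<bar> * NX \<psi>"
proof -
  let ?g = "\<lambda>x. \<bar>a\<bar> * (\<bar>\<phi> x\<bar> * w x) + \<bar>b\<bar> * (\<bar>\<psi> x\<bar> * w x)"
  have [measurable]: "\<phi> \<in> borel_measurable \<mu>" "\<psi> \<in> borel_measurable \<mu>" using assms by (auto simp: mem_X_iff)
  have int: "integrable \<mu> (\<lambda>x. \<bar>\<phi> x\<bar> * w x)" "integrable \<mu> (\<lambda>x. \<bar>\<psi> x\<bar> * w x)" using assms by (auto simp: mem_X_iff)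
  have g: "integrable \<mu> ?g" using int by auto
  have le: "AE x in \<mu>. \<bar>a * \<phi> x + b * \<psi> x\<bar> * w x \<le> ?g x"
    using w_pos
  proof eventually_elim
    case (elim x)
    have "\<bar>a * \<phi> x + b * \<psi> x\<bar> * w x \<le> (\<bar>a\<bar> * \<bar>\<phi> x\<bar> + \<bar>b\<bar> * \<bar>\<psi> x\<bar>) * w x"
      using elim abs_triangle_ineq[of "a * \<phi> x" "b * \<psi> x"] by (intro mult_right_mono) (auto simp: abs_mult)
    then show ?case by (simp add: distrib_right mult.assoc)
  qed
  show "(\<lambda>x. a * \<phi> x + b * \<psi> x) \<in> X"
    by (rule X_dominated(1)[OF _ g le]) measurable
  have "NX (\<lambda>x. a * \<phi> x + b * \<psi> x) \<le> (LINT x|\<mu>. ?g x)"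
    by (rule X_dominated(2)[OF _ g le]) measurable
  also have "\<dots> = \<bar>a\<bar> * NX \<phi> + \<bar>b\<bar> * NX \<psi>" unfolding X_norm_eq using int by simp
  finally show "NX (\<lambda>x. a * \<phi> x + b * \<psi> x) \<le> \<bar>a\<bar> * NX \<phi> + \<bar>b\<bar> * NX \<psi>" .
qed

lemma X_seminormed: "seminormed_function_space \<Omega> X NX"
proof
  show "(\<lambda>_. 0) \<in> X" by (simp add: mem_X_iff)
  fix \<phi> \<psi> assume \<phi>\<psi>: "\<phi> \<in> X" "\<psi> \<in> X"
  show "(\<lambda>x. a * \<phi> x + b * \<psi> x) \<in> X" "NX (\<lambda>x. a * \<phi> x + b * \<psi> x) \<le> \<bar>a\<bar> * NX \<phi> + \<bar>b\<bar> * NX \<psi>" for a b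
    using X_lin[OF \<phi>\<psi>] by auto
  have [measurable]: "\<phi> \<in> borel_measurable \<mu>" "\<psi> \<in> borel_measurable \<mu>" using \<phi>\<psi> by (auto simp: mem_X_iff)
  show "NX \<phi> = NX \<psi>" if "AE x in \<mu>. \<phi> x = \<psi> x"
    unfolding X_norm_eq
  proof (rule integral_cong_AE)
    show "AE x in \<mu>. \<bar>\<phi> x\<bar> * w x = \<bar>\<psi> x\<bar> * w x" using that by eventually_elim simp
  qed measurable
qed

lemma pairing_integrable:
  assumes "\<phi> \<in> H" "\<psi> \<in> H"
  shows "integrable \<mu> (\<lambda>x. \<phi> x * \<psi> x * (w x)\<^sup>2)"
proof -
  have [measurable]: "\<phi> \<in> borel_measurable \<mu>" "\<psi> \<in> borel_measurable \<mu>" using assms by (auto simp: mem_H_iff)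
  have int: "integrable \<mu> (\<lambda>x. (\<phi> x)\<^sup>2 * (w x)\<^sup>2 + (\<psi> x)\<^sup>2 * (w x)\<^sup>2)" using assms by (auto simp: mem_H_iff)
  have "norm (\<phi> x * \<psi> x * (w x)\<^sup>2) \<le> norm ((\<phi> x)\<^sup>2 * (w x)\<^sup>2 + (\<psi> x)\<^sup>2 * (w x)\<^sup>2)" for x
  proof -
    have "\<bar>\<phi> x * \<psi> x\<bar> \<le> (\<phi> x)\<^sup>2 + (\<psi> x)\<^sup>2"
      using sum_squares_bound[of "\<bar>\<phi> x\<bar>" "\<bar>\<psi> x\<bar>"] mult_nonneg_nonneg[OF abs_ge_zero abs_ge_zero, of "\<phi> x" "\<psi> x"]
      unfolding abs_mult power2_abs by linarith
    then have "\<bar>\<phi> x * \<psi> x\<bar> * (w x)\<^sup>2 \<le> ((\<phi> x)\<^sup>2 + (\<psi> x)\<^sup>2) * (w x)\<^sup>2" by (intro mult_right_mono) auto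
    then show ?thesis by (simp add: abs_mult distrib_right)
  qed
  then show ?thesis by (intro Bochner_Integration.integrable_bound[OF int]) auto
qed

lemma H_lin_mem:
  assumes "\<phi> \<in> H" "\<psi> \<in> H"
  shows "(\<lambda>x. a * \<phi> x + b * \<psi> x) \<in> H"
proof -
  have "integrable \<mu> (\<lambda>x. a\<^sup>2 * ((\<phi> x)\<^sup>2 * (w x)\<^sup>2) + 2 * a * b * (\<phi> x * \<psi> x * (w x)\<^sup>2) + b\<^sup>2 * ((\<psi> x)\<^sup>2 * (w x)\<^sup>2))"
    using assms pairing_integrable[OF assms] by (auto simp: mem_H_iff)
  then have "integrable \<mu> (\<lambda>x. (a * \<phi> x + b * \<psi> x)\<^sup>2 * (w x)\<^sup>2)"
    by (rule Bochner_Integration.integrable_cong[THEN iffD1, rotated -1]) (auto simp: power2_eq_square algebra_simps)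
  then show ?thesis using assms by (auto simp: mem_H_iff)
qed

lemma pairing_commute: "ip \<phi> \<psi> = ip \<psi> \<phi>"
  by (simp add: pairing_def mult.commute)

lemma pairing_lin:
  assumes "\<phi> \<in> H" "\<psi> \<in> H" "\<eta> \<in> H"
  shows "ip (\<lambda>x. a * \<phi> x + b * \<psi> x) \<eta> = a * ip \<phi> \<eta> + b * ip \<psi> \<eta>"
    "ip \<eta> (\<lambda>x. a * \<phi> x + b * \<psi> x) = a * ip \<eta> \<phi> + b * ip \<eta> \<psi>"
proof -
  have "ip (\<lambda>x. a * \<phi> x + b * \<psi> x) \<eta> = (LINT x|\<mu>. a * (\<phi> x * \<eta> x * (w x)\<^sup>2) + b * (\<psi> x * \<eta> x * (w x)\<^sup>2))"
    unfolding pairing_def by (intro Bochner_Integration.integral_cong) (auto simp: algebra_simps)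
  also have "\<dots> = a * ip \<phi> \<eta> + b * ip \<psi> \<eta>"
    using pairing_integrable[OF assms(1,3)] pairing_integrable[OF assms(2,3)] by (simp add: pairing_def)
  finally show "ip (\<lambda>x. a * \<phi> x + b * \<psi> x) \<eta> = a * ip \<phi> \<eta> + b * ip \<psi> \<eta>" .
  then show "ip \<eta> (\<lambda>x. a * \<phi> x + b * \<psi> x) = a * ip \<eta> \<phi> + b * ip \<eta> \<psi>"
    by (simp add: pairing_commute)
qed

lemma pairing_square:
  assumes "\<phi> \<in> H" "\<psi> \<in> H"
  shows "ip (\<lambda>x. a * \<phi> x + b * \<psi> x) (\<lambda>x. a * \<phi> x + b * \<psi> x) = a\<^sup>2 * ip \<phi> \<phi> + 2 * a * b * ip \<phi> \<psi> + b\<^sup>2 * ip \<psi> \<psi>"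
proof -
  note m = H_lin_mem[OF assms, of a b]
  have "ip (\<lambda>x. a * \<phi> x + b * \<psi> x) (\<lambda>x. a * \<phi> x + b * \<psi> x) =
      a * (a * ip \<phi> \<phi> + b * ip \<phi> \<psi>) + b * (a * ip \<psi> \<phi> + b * ip \<psi> \<psi>)"
    unfolding pairing_lin(1)[OF assms m] pairing_lin(2)[OF assms assms(1)] pairing_lin(2)[OF assms assms(2)] ..
  then show ?thesis by (simp add: pairing_commute[of \<psi> \<phi>] power2_eq_square algebra_simps)
qed

text \<open>The Cauchy--Schwarz inequality: the quadratic form of the pairing on the span of \<open>\<phi>\<close> and \<open>\<psi>\<close> is
  nonnegative.\<close>

lemma pairing_le:
  assumes "\<phi> \<in> H" "\<psi> \<in> H"
  shows "\<bar>ip \<phi> \<psi>\<bar> \<le> NH \<phi> * NH \<psi>"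
proof -
  let ?a = "ip \<phi> \<phi>" and ?b = "ip \<phi> \<psi>" and ?c = "ip \<psi> \<psi>"
  have q: "0 \<le> s\<^sup>2 * ?a + 2 * s * t * ?b + t\<^sup>2 * ?c" for s t
    using pairing_self_nonneg[of "\<lambda>x. s * \<phi> x + t * \<psi> x"] unfolding pairing_square[OF assms] .
  have "?b\<^sup>2 \<le> ?a * ?c"
  proof (cases "?c = 0")
    case True
    have "0 \<le> ?a - 2 * t * ?b" for t using q[of 1 "-t"] True by simp
    from this[of "(?a + 1) / (2 * ?b)"] have "?b = 0" by (cases "?b = 0") auto
    then show ?thesis using True by simp
  next
    case False
    then have c: "0 < ?c" using pairing_self_nonneg[of \<psi>] by simp
    have "0 \<le> ?c * (?a * ?c - ?b\<^sup>2)"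
      using q[of ?c "- ?b"] by (simp add: power2_eq_square algebra_simps)
    then show ?thesis using c by (simp add: zero_le_mult_iff)
  qed
  then have "sqrt (?b\<^sup>2) \<le> sqrt (?a * ?c)" by (rule real_sqrt_le_mono)
  then show ?thesis by (simp add: H_norm_eq real_sqrt_mult)
qed

lemma H_seminormed: "seminormed_function_space \<Omega> H NH"
proof
  show "(\<lambda>_. 0) \<in> H" by (simp add: mem_H_iff)
  fix \<phi> \<psi> assume \<phi>\<psi>: "\<phi> \<in> H" "\<psi> \<in> H"
  fix a b
  show "(\<lambda>x. a * \<phi> x + b * \<psi> x) \<in> H" by (rule H_lin_mem[OF \<phi>\<psi>])
  show "NH (\<lambda>x. a * \<phi> x + b * \<psi> x) \<le> \<bar>a\<bar> * NH \<phi> + \<bar>b\<bar> * NH \<psi>"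
  proof -
    have "2 * a * b * ip \<phi> \<psi> \<le> 2 * \<bar>a\<bar> * \<bar>b\<bar> * (NH \<phi> * NH \<psi>)"
    proof -
      have "2 * a * b * ip \<phi> \<psi> \<le> \<bar>2 * a * b * ip \<phi> \<psi>\<bar>" by (rule abs_ge_self)
      also have "\<dots> = (2 * \<bar>a\<bar> * \<bar>b\<bar>) * \<bar>ip \<phi> \<psi>\<bar>" by (simp add: abs_mult)
      also have "\<dots> \<le> (2 * \<bar>a\<bar> * \<bar>b\<bar>) * (NH \<phi> * NH \<psi>)" by (intro mult_left_mono pairing_le[OF \<phi>\<psi>]) auto
      finally show ?thesis .
    qed
    moreover have "ip \<phi> \<phi> = (NH \<phi>)\<^sup>2" "ip \<psi> \<psi> = (NH \<psi>)\<^sup>2"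
      using pairing_self_nonneg by (auto simp: H_norm_eq)
    ultimately have "ip (\<lambda>x. a * \<phi> x + b * \<psi> x) (\<lambda>x. a * \<phi> x + b * \<psi> x) \<le> (\<bar>a\<bar> * NH \<phi> + \<bar>b\<bar> * NH \<psi>)\<^sup>2"
      unfolding pairing_square[OF \<phi>\<psi>] by (simp add: power2_sum power_mult_distrib mult_ac)
    then show ?thesis
      unfolding H_norm_eq[of "\<lambda>x. a * \<phi> x + b * \<psi> x"]
      by (intro real_le_lsqrt) (auto simp: H_norm_eq pairing_self_nonneg)
  qed
next
  fix \<phi> \<psi> assume \<phi>\<psi>: "\<phi> \<in> H" "\<psi> \<in> H" and eq: "AE x in \<mu>. \<phi> x = \<psi> x"
  have [measurable]: "\<phi> \<in> borel_measurable \<mu>" "\<psi> \<in> borel_measurable \<mu>" using \<phi>\<psi> by (auto simp: mem_H_iff)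
  have "ip \<phi> \<phi> = ip \<psi> \<psi>"
    unfolding pairing_def
  proof (rule integral_cong_AE)
    show "AE x in \<mu>. \<phi> x * \<phi> x * (w x)\<^sup>2 = \<psi> x * \<psi> x * (w x)\<^sup>2" using eq by eventually_elim simp
  qed measurable
  then show "NH \<phi> = NH \<psi>" by (simp add: H_norm_eq)
qed

definition embedding_constant :: real
  where "embedding_constant = sqrt (measure \<mu> (space \<mu>))"

text \<open>The norm of \<open>X\<close> is the pairing of \<open>\<bar>\<phi>\<bar>\<close> with \<open>1 / w\<close>, and the norm of \<open>1 / w\<close> in \<open>H\<close> is the square
  root of the volume of the domain.\<close>

lemma H_subset_X:
  assumes "\<phi> \<in> H"
  shows "\<phi> \<in> X" "NX \<phi> \<le> embedding_constant * NH \<phi>"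
proof -
  have [measurable]: "\<phi> \<in> borel_measurable \<mu>" using assms by (auto simp: mem_H_iff)
  have int: "integrable \<mu> (\<lambda>x. (\<phi> x)\<^sup>2 * (w x)\<^sup>2 + 1)" using assms by (auto simp: mem_H_iff)
  have "AE x in \<mu>. \<bar>\<phi> x\<bar> * w x \<le> (\<phi> x)\<^sup>2 * (w x)\<^sup>2 + 1"
    using w_pos
  proof eventually_elim
    case (elim x)
    then have "0 \<le> \<bar>\<phi> x\<bar> * w x" by simp
    then have "\<bar>\<phi> x\<bar> * w x \<le> (\<bar>\<phi> x\<bar> * w x)\<^sup>2 + 1\<^sup>2"
      using sum_squares_bound[of "\<bar>\<phi> x\<bar> * w x" 1] by linarith
    then show ?case by (simp add: power_mult_distrib)
  qed
  then show "\<phi> \<in> X" by (intro X_dominated(1)[OF _ int]) auto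
  have one: "AE x in \<mu>. 1 = (inverse (w x))\<^sup>2 * (w x)\<^sup>2"
    using w_pos by eventually_elim (simp flip: power_mult_distrib)
  have "integrable \<mu> (\<lambda>x. (inverse (w x))\<^sup>2 * (w x)\<^sup>2)"
    by (rule integrable_cong_AE_imp[of _ "\<lambda>_. 1"]) (use one in auto)
  then have inv: "(\<lambda>x. inverse (w x)) \<in> H" by (simp add: mem_H_iff)
  have "(LINT x|\<mu>. 1) = (LINT x|\<mu>. (inverse (w x))\<^sup>2 * (w x)\<^sup>2)"
    by (rule integral_cong_AE) (use one in auto)
  then have inv_norm: "NH (\<lambda>x. inverse (w x)) = embedding_constant"
    by (simp add: H_norm_eq pairing_self embedding_constant_def)
  have abs: "(\<lambda>x. \<bar>\<phi> x\<bar>) \<in> H" "NH (\<lambda>x. \<bar>\<phi> x\<bar>) = NH \<phi>"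
    using assms by (auto simp: mem_H_iff H_norm_eq pairing_self)
  have "NX \<phi> = ip (\<lambda>x. \<bar>\<phi> x\<bar>) (\<lambda>x. inverse (w x))"
    unfolding X_norm_eq pairing_def
  proof (rule integral_cong_AE)
    show "AE x in \<mu>. \<bar>\<phi> x\<bar> * w x = \<bar>\<phi> x\<bar> * inverse (w x) * (w x)\<^sup>2"
      using w_pos by eventually_elim (simp add: power2_eq_square)
  qed measurable
  then show "NX \<phi> \<le> embedding_constant * NH \<phi>"
    using pairing_le[OF abs(1) inv] abs(2) inv_norm by (simp add: mult.commute)
qed

text \<open>Cutting \<open>\<phi>\<close> off where \<open>\<phi> w\<close> is large gives elements of \<open>H\<close>, as the domain has finite measure.\<close>

lemma H_dense_in_X:
  assumes "\<phi> \<in> X"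
  shows "\<exists>u. (\<forall>n. u n \<in> H) \<and> (\<lambda>n. NX (\<lambda>x. u n x - \<phi> x)) \<longlonglongrightarrow> 0"
proof -
  have [measurable]: "\<phi> \<in> borel_measurable \<mu>" using assms by (auto simp: mem_X_iff)
  have int: "integrable \<mu> (\<lambda>x. \<bar>\<phi> x\<bar> * w x)" using assms by (auto simp: mem_X_iff)
  define u where "u n = (\<lambda>x. if \<bar>\<phi> x * w x\<bar> \<le> real n then \<phi> x else 0)" for n :: nat
  have [measurable]: "u n \<in> borel_measurable \<mu>" for n unfolding u_def by measurable
  have "u n \<in> H" for n
  proof -
    have le: "norm ((u n x)\<^sup>2 * (w x)\<^sup>2) \<le> norm ((real n)\<^sup>2)" for x
    proof (cases "\<bar>\<phi> x * w x\<bar> \<le> real n")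
      case True
      then have "\<bar>\<phi> x * w x\<bar>\<^sup>2 \<le> (real n)\<^sup>2" by (rule power_mono) simp
      with True show ?thesis by (simp add: u_def power_mult_distrib)
    qed (simp add: u_def)
    have "integrable \<mu> (\<lambda>x. (u n x)\<^sup>2 * (w x)\<^sup>2)"
    proof (rule Bochner_Integration.integrable_bound[of \<mu> "\<lambda>_. (real n)\<^sup>2"])
      show "AE x in \<mu>. norm ((u n x)\<^sup>2 * (w x)\<^sup>2) \<le> norm ((real n)\<^sup>2)" by (intro AE_I2 le)
    qed simp_all
    then show ?thesis by (simp add: mem_H_iff)
  qed
  moreover have "(\<lambda>n. NX (\<lambda>x. u n x - \<phi> x)) \<longlonglongrightarrow> (LINT x|\<mu>. 0)"
    unfolding X_norm_eq
  proof (rule integral_dominated_convergence[OF _ _ int])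
    show "AE x in \<mu>. (\<lambda>n. \<bar>u n x - \<phi> x\<bar> * w x) \<longlonglongrightarrow> 0"
    proof (rule AE_I2)
      fix x
      obtain m where m: "\<bar>\<phi> x * w x\<bar> \<le> real m" using real_arch_simple by blast
      have "\<bar>u n x - \<phi> x\<bar> * w x = 0" if "n \<ge> m" for n
      proof -
        have "real m \<le> real n" using that by simp
        then show ?thesis using m by (simp add: u_def)
      qed
      then show "(\<lambda>n. \<bar>u n x - \<phi> x\<bar> * w x) \<longlonglongrightarrow> 0"
        by (intro tendsto_eventually) (auto simp: eventually_sequentially)
    qed
    show "AE x in \<mu>. norm (\<bar>u n x - \<phi> x\<bar> * w x) \<le> \<bar>\<phi> x\<bar> * w x" for n
      using w_pos by eventually_elim (auto simp: u_def)
  qed auto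
  ultimately show ?thesis by auto
qed

text \<open>Multiplication by \<open>w\<close> turns a Cauchy sequence of \<open>H\<close> into one of the unweighted \<open>L\<^sup>1\<close>, by the
  embedding of \<open>H\<close> into \<open>X\<close>. A subsequence therefore converges almost everywhere, and Fatou's lemma
  shows that its limit is also the limit in \<open>H\<close>.\<close>

lemma H_complete:
  assumes u: "\<And>n. u n \<in> H"
    and cauchy: "\<And>e. e > 0 \<Longrightarrow> \<exists>m. \<forall>i\<ge>m. \<forall>j\<ge>m. NH (\<lambda>x. u i x - u j x) < e"
  shows "\<exists>l\<in>H. (\<lambda>n. NH (\<lambda>x. u n x - l x)) \<longlonglongrightarrow> 0"
proof -
  interpret H: seminormed_function_space \<Omega> H NH by (rule H_seminormed)
  have [measurable]: "u n \<in> borel_measurable \<mu>" for n using u[of n] by (simp add: mem_H_iff)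
  have abs_int: "integrable \<mu> (\<lambda>x. \<bar>u n x\<bar> * w x)" for n using H_subset_X(1)[OF u] by (simp add: mem_X_iff)
  have int: "integrable \<mu> (\<lambda>x. u n x * w x)" for n
    by (rule Bochner_Integration.integrable_bound[OF abs_int[of n]]) (auto simp: abs_mult)
  have L1: "\<exists>m. \<forall>i\<ge>m. \<forall>j\<ge>m. (LINT x|\<mu>. norm (u i x * w x - u j x * w x)) < e" if e: "0 < e" for e
  proof -
    let ?k = "embedding_constant + 1"
    have k: "0 < ?k" by (simp add: embedding_constant_def add_nonneg_pos)
    then obtain m where m: "\<And>i j. i \<ge> m \<Longrightarrow> j \<ge> m \<Longrightarrow> NH (\<lambda>x. u i x - u j x) < e / ?k"
      using cauchy[of "e / ?k"] e by auto
    have "(LINT x|\<mu>. norm (u i x * w x - u j x * w x)) < e" if "i \<ge> m" "j \<ge> m" for i j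
    proof -
      have "(LINT x|\<mu>. norm (u i x * w x - u j x * w x)) = NX (\<lambda>x. u i x - u j x)"
        unfolding X_norm_eq
      proof (rule integral_cong_AE)
        show "AE x in \<mu>. norm (u i x * w x - u j x * w x) = \<bar>u i x - u j x\<bar> * w x"
          using w_pos by eventually_elim (simp add: abs_mult flip: left_diff_distrib)
      qed measurable
      also have "\<dots> \<le> embedding_constant * NH (\<lambda>x. u i x - u j x)"
        by (intro H_subset_X H.diff_mem u)
      also have "\<dots> \<le> ?k * NH (\<lambda>x. u i x - u j x)"
        using H.N_nonneg[OF H.diff_mem[OF u u]] by (intro mult_right_mono) auto
      also have "\<dots> < e" using m[OF that] k by (simp add: pos_less_divide_eq mult.commute)
      finally show ?thesis .
    qed
    then show ?thesis by blast
  qed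
  obtain r where r: "strict_mono r" "AE x in \<mu>. Cauchy (\<lambda>i. u (r i) x * w x)"
    using cauchy_L1_AE_cauchy_subseq[of \<mu> "\<lambda>n x. u n x * w x", OF int L1] by blast
  define l where "l x = lim (\<lambda>i. u (r i) x)" for x
  have [measurable]: "l \<in> borel_measurable \<mu>" unfolding l_def by measurable
  have lim: "AE x in \<mu>. (\<lambda>i. u (r i) x) \<longlonglongrightarrow> l x"
    using r(2) w_pos
  proof eventually_elim
    case (elim x)
    then obtain y where "(\<lambda>i. u (r i) x * w x) \<longlonglongrightarrow> y" by (auto simp: Cauchy_convergent_iff convergent_def)
    then have "(\<lambda>i. u (r i) x * w x / w x) \<longlonglongrightarrow> y / w x" using elim by (intro tendsto_divide tendsto_const) auto
    then have "(\<lambda>i. u (r i) x) \<longlonglongrightarrow> y / w x" using elim by simp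
    then show ?case unfolding l_def by (metis limI)
  qed
  have close: "(\<lambda>x. l x - u n x) \<in> H \<and> NH (\<lambda>x. l x - u n x) \<le> e"
    if e: "0 < e" and m: "\<And>i j. i \<ge> m \<Longrightarrow> j \<ge> m \<Longrightarrow> NH (\<lambda>x. u i x - u j x) < e" and n: "n \<ge> m" for e m n
  proof -
    let ?d = "\<lambda>v x. (v x - u n x)\<^sup>2 * (w x)\<^sup>2"
    have le: "(\<integral>\<^sup>+x. ennreal (?d (u (r i)) x) \<partial>\<mu>) \<le> ennreal (e\<^sup>2)" if "i \<ge> m" for i
    proof -
      have "r i \<ge> m" using seq_suble[OF r(1), of i] that by simp
      then have "NH (\<lambda>x. u (r i) x - u n x) < e" using m n by blast
      then have "(NH (\<lambda>x. u (r i) x - u n x))\<^sup>2 \<le> e\<^sup>2"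
        using H.N_nonneg[OF H.diff_mem[OF u u]] by (intro power_mono) auto
      then have "(LINT x|\<mu>. ?d (u (r i)) x) \<le> e\<^sup>2"
        by (simp add: H_norm_eq pairing_self_nonneg) (simp add: pairing_self)
      moreover have "integrable \<mu> (?d (u (r i)))"
        using H.diff_mem[OF u u] by (simp add: mem_H_iff)
      ultimately show ?thesis by (subst nn_integral_eq_integral) (auto intro: ennreal_leI)
    qed
    have "(\<integral>\<^sup>+x. ennreal (?d l x) \<partial>\<mu>) = (\<integral>\<^sup>+x. liminf (\<lambda>i. ennreal (?d (u (r i)) x)) \<partial>\<mu>)"
    proof (rule nn_integral_cong_AE)
      show "AE x in \<mu>. ennreal (?d l x) = liminf (\<lambda>i. ennreal (?d (u (r i)) x))"
        using lim
      proof eventually_elim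
        case (elim x)
        have "(\<lambda>i. ennreal (?d (u (r i)) x)) \<longlonglongrightarrow> ennreal (?d l x)"
          by (intro tendsto_ennrealI tendsto_intros elim)
        then show ?case by (intro lim_imp_Liminf[symmetric]) simp_all
      qed
    qed
    also have "\<dots> \<le> liminf (\<lambda>i. \<integral>\<^sup>+x. ennreal (?d (u (r i)) x) \<partial>\<mu>)"
      by (rule nn_integral_liminf) measurable
    also have "\<dots> \<le> limsup (\<lambda>i. \<integral>\<^sup>+x. ennreal (?d (u (r i)) x) \<partial>\<mu>)" by (rule Liminf_le_Limsup) simp
    also have "\<dots> \<le> ennreal (e\<^sup>2)"
      using le by (intro Limsup_bounded) (auto simp: eventually_sequentially)
    finally have fatou: "(\<integral>\<^sup>+x. ennreal (?d l x) \<partial>\<mu>) \<le> ennreal (e\<^sup>2)" .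
    then have int: "integrable \<mu> (?d l)"
      by (intro integrableI_nonneg) (auto intro: le_less_trans)
    have "ennreal (LINT x|\<mu>. ?d l x) \<le> ennreal (e\<^sup>2)"
      using fatou by (subst nn_integral_eq_integral[OF int, symmetric]) auto
    then have "(LINT x|\<mu>. ?d l x) \<le> e\<^sup>2" by (simp add: ennreal_le_iff)
    then have "NH (\<lambda>x. l x - u n x) \<le> e"
      using e by (simp add: H_norm_eq pairing_self real_le_lsqrt)
    then show ?thesis using int by (simp add: mem_H_iff)
  qed
  obtain m1 where "\<And>i j. i \<ge> m1 \<Longrightarrow> j \<ge> m1 \<Longrightarrow> NH (\<lambda>x. u i x - u j x) < 1"
    using cauchy[OF zero_less_one] by blast
  then have "(\<lambda>x. (l x - u m1 x) + u m1 x) \<in> H"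
    using close[OF zero_less_one, of m1 m1] by (intro H.add_mem u) auto
  then have l: "l \<in> H" by simp
  moreover have "(\<lambda>n. NH (\<lambda>x. u n x - l x)) \<longlonglongrightarrow> 0"
  proof (rule LIMSEQ_I)
    fix e :: real assume "0 < e"
    then have e: "0 < e / 2" by simp
    obtain m where m: "\<And>i j. i \<ge> m \<Longrightarrow> j \<ge> m \<Longrightarrow> NH (\<lambda>x. u i x - u j x) < e / 2"
      using cauchy[OF e] by blast
    have "norm (NH (\<lambda>x. u n x - l x) - 0) < e" if "n \<ge> m" for n
      using close[OF e m that] \<open>0 < e\<close> H.N_diff_commute[OF u l, of n] H.N_nonneg[OF H.diff_mem[OF u l], of n] by simp
    then show "\<exists>m. \<forall>n\<ge>m. norm (NH (\<lambda>x. u n x - l x) - 0) < e" by blast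
  qed
  ultimately show ?thesis by blast
qed

lemma H_hilbert: "hilbert_function_space \<Omega> H NH ip"
proof -
  interpret H: seminormed_function_space \<Omega> H NH by (rule H_seminormed)
  show ?thesis
  proof
    show "\<exists>l\<in>H. (\<lambda>n. NH (\<lambda>x. u n x - l x)) \<longlonglongrightarrow> 0"
      if "\<And>n. u n \<in> H" "\<And>e. e > 0 \<Longrightarrow> \<exists>m. \<forall>i\<ge>m. \<forall>j\<ge>m. NH (\<lambda>x. u i x - u j x) < e" for u
      by (rule H_complete[OF that])
    have "\<forall>\<phi>\<in>H. \<forall>\<psi>\<in>H. \<bar>ip \<phi> \<psi>\<bar> \<le> 1 * NH \<phi> * NH \<psi>" using pairing_le by simp
    then show "bounded_bilinear_form H NH ip"
      unfolding bounded_bilinear_form_def using pairing_lin by blast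
    show "ip \<phi> \<phi> = (NH \<phi>)\<^sup>2" for \<phi> by (simp add: H_norm_eq pairing_self_nonneg)
    show "\<bar>ip \<phi> \<psi>\<bar> \<le> NH \<phi> * NH \<psi>" if "\<phi> \<in> H" "\<psi> \<in> H" for \<phi> \<psi> by (rule pairing_le[OF that])
  qed
qed

section \<open>The observation operator\<close>

lemma Linf_AE_le:
  assumes "c \<in> Linf \<Omega> w"
  shows "AE x in \<mu>. \<bar>c x\<bar> * w x \<le> Linf_norm \<Omega> w c"
proof -
  let ?s = "esssup \<mu> (\<lambda>x. ereal \<bar>c x * w x\<bar>)"
  have fin: "?s < \<infinity>" using assms by (simp add: Linf_def)
  show ?thesis
    using esssup_AE[of "\<lambda>x. ereal \<bar>c x * w x\<bar>" \<mu>] w_pos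
  proof eventually_elim
    case (elim x)
    then show ?case using fin by (cases ?s) (auto simp: Linf_norm_def abs_mult)
  qed
qed

lemma pairing_X_Linf:
  assumes "\<phi> \<in> X" "c \<in> Linf \<Omega> w"
  shows "integrable \<mu> (\<lambda>x. \<phi> x * c x * (w x)\<^sup>2)" "\<bar>ip \<phi> c\<bar> \<le> Linf_norm \<Omega> w c * NX \<phi>"
proof -
  have [measurable]: "\<phi> \<in> borel_measurable \<mu>" "c \<in> borel_measurable \<mu>" using assms by (auto simp: mem_X_iff Linf_def)
  let ?g = "\<lambda>x. Linf_norm \<Omega> w c * (\<bar>\<phi> x\<bar> * w x)"
  have int: "integrable \<mu> ?g" using assms by (auto simp: mem_X_iff)
  have le: "AE x in \<mu>. \<bar>\<phi> x * c x * (w x)\<^sup>2\<bar> \<le> ?g x"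
    using Linf_AE_le[OF assms(2)] w_pos
  proof eventually_elim
    case (elim x)
    have "\<bar>\<phi> x * c x * (w x)\<^sup>2\<bar> = (\<bar>c x\<bar> * w x) * (\<bar>\<phi> x\<bar> * w x)"
      using elim by (simp add: abs_mult power2_eq_square)
    also have "\<dots> \<le> ?g x" using elim by (intro mult_right_mono) auto
    finally show ?case .
  qed
  show I: "integrable \<mu> (\<lambda>x. \<phi> x * c x * (w x)\<^sup>2)"
    by (rule Bochner_Integration.integrable_bound[OF int]) (use le in \<open>auto elim!: eventually_mono\<close>)
  have "\<bar>ip \<phi> c\<bar> \<le> (LINT x|\<mu>. \<bar>\<phi> x * c x * (w x)\<^sup>2\<bar>)"
    unfolding pairing_def using integral_norm_bound[of \<mu> "\<lambda>x. \<phi> x * c x * (w x)\<^sup>2"] by simp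
  also have "\<dots> \<le> (LINT x|\<mu>. ?g x)" by (intro integral_mono_AE integrable_abs I int le)
  finally show "\<bar>ip \<phi> c\<bar> \<le> Linf_norm \<Omega> w c * NX \<phi>" by (simp add: X_norm_eq)
qed

lemma observation_bound:
  assumes c: "\<And>i. c i \<in> Linf \<Omega> w" "summable (\<lambda>i. (Linf_norm \<Omega> w (c i))\<^sup>2)" and \<phi>: "\<phi> \<in> X" and \<psi>: "\<psi> \<in> X"
  shows "summable (\<lambda>i. observation \<Omega> w c \<phi> i * observation \<Omega> w c \<psi> i)"
    and "\<bar>ell2_inner (observation \<Omega> w c \<phi>) (observation \<Omega> w c \<psi>)\<bar> \<le>
      (\<Sum>i. (Linf_norm \<Omega> w (c i))\<^sup>2) * NX \<phi> * NX \<psi>"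
proof -
  interpret X: seminormed_function_space \<Omega> X NX by (rule X_seminormed)
  let ?C = "observation \<Omega> w c" and ?n = "\<lambda>i. Linf_norm \<Omega> w (c i)"
  have le: "norm (?C \<phi> i * ?C \<psi> i) \<le> (?n i)\<^sup>2 * (NX \<phi> * NX \<psi>)" for i
  proof -
    have "\<bar>?C \<phi> i\<bar> * \<bar>?C \<psi> i\<bar> \<le> (?n i * NX \<phi>) * (?n i * NX \<psi>)"
      unfolding observation_def
      by (intro mult_mono' pairing_X_Linf \<phi> \<psi> c) auto
    then show ?thesis by (simp add: abs_mult power2_eq_square algebra_simps)
  qed
  have dom: "summable (\<lambda>i. (?n i)\<^sup>2 * (NX \<phi> * NX \<psi>))" by (intro summable_mult2 c)
  show "summable (\<lambda>i. ?C \<phi> i * ?C \<psi> i)"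
    by (rule summable_comparison_test'[OF dom, of 0]) (rule le)
  have "norm (\<Sum>i. ?C \<phi> i * ?C \<psi> i) \<le> (\<Sum>i. (?n i)\<^sup>2 * (NX \<phi> * NX \<psi>))"
    by (rule norm_suminf_le[OF le dom])
  also have "\<dots> = (\<Sum>i. (?n i)\<^sup>2) * (NX \<phi> * NX \<psi>)" by (rule suminf_mult2[OF c(2), symmetric])
  finally show "\<bar>ell2_inner (?C \<phi>) (?C \<psi>)\<bar> \<le> (\<Sum>i. (?n i)\<^sup>2) * NX \<phi> * NX \<psi>"
    by (simp add: ell2_inner_def mult.assoc)
qed

lemma observation_ell2:
  assumes "\<And>i. c i \<in> Linf \<Omega> w" "summable (\<lambda>i. (Linf_norm \<Omega> w (c i))\<^sup>2)" "\<phi> \<in> X"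
  shows "observation \<Omega> w c \<phi> \<in> ell2"
  using observation_bound(1)[OF assms assms(3)] by (simp add: ell2_def power2_eq_square)

lemma observation_form:
  assumes c: "\<And>i. c i \<in> Linf \<Omega> w" "summable (\<lambda>i. (Linf_norm \<Omega> w (c i))\<^sup>2)"
  shows "bounded_bilinear_form X NX (\<lambda>\<phi> \<psi>. ell2_inner (observation \<Omega> w c \<phi>) (observation \<Omega> w c \<psi>))"
proof -
  let ?C = "observation \<Omega> w c"
  have C: "?C (\<lambda>x. a * \<phi> x + b * \<psi> x) i = a * ?C \<phi> i + b * ?C \<psi> i" if "\<phi> \<in> X" "\<psi> \<in> X" for \<phi> \<psi> a b i
  proof -
    have "?C (\<lambda>x. a * \<phi> x + b * \<psi> x) i = (LINT x|\<mu>. a * (\<phi> x * c i x * (w x)\<^sup>2) + b * (\<psi> x * c i x * (w x)\<^sup>2))"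
      unfolding observation_def pairing_def by (intro Bochner_Integration.integral_cong) (auto simp: algebra_simps)
    also have "\<dots> = a * ?C \<phi> i + b * ?C \<psi> i"
      using pairing_X_Linf(1)[OF that(1) c(1)] pairing_X_Linf(1)[OF that(2) c(1)]
      by (simp add: observation_def pairing_def)
    finally show ?thesis .
  qed
  have lin: "ell2_inner (?C (\<lambda>x. a * \<phi> x + b * \<psi> x)) (?C \<eta>) = a * ell2_inner (?C \<phi>) (?C \<eta>) + b * ell2_inner (?C \<psi>) (?C \<eta>)"
    if X: "\<phi> \<in> X" "\<psi> \<in> X" "\<eta> \<in> X" for \<phi> \<psi> \<eta> a b
  proof -
    have s: "summable (\<lambda>i. ?C \<phi> i * ?C \<eta> i)" "summable (\<lambda>i. ?C \<psi> i * ?C \<eta> i)"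
      by (intro observation_bound(1) c X)+
    have "ell2_inner (?C (\<lambda>x. a * \<phi> x + b * \<psi> x)) (?C \<eta>) =
        (\<Sum>i. a * (?C \<phi> i * ?C \<eta> i) + b * (?C \<psi> i * ?C \<eta> i))"
      unfolding ell2_inner_def C[OF X(1,2)] by (simp add: algebra_simps)
    also have "\<dots> = (\<Sum>i. a * (?C \<phi> i * ?C \<eta> i)) + (\<Sum>i. b * (?C \<psi> i * ?C \<eta> i))"
      by (intro suminf_add[symmetric] summable_mult s)
    also have "\<dots> = a * ell2_inner (?C \<phi>) (?C \<eta>) + b * ell2_inner (?C \<psi>) (?C \<eta>)"
      unfolding ell2_inner_def using s by (simp add: suminf_mult)
    finally show ?thesis .
  qed
  have lin': "ell2_inner (?C \<eta>) (?C (\<lambda>x. a * \<phi> x + b * \<psi> x)) = a * ell2_inner (?C \<eta>) (?C \<phi>) + b * ell2_inner (?C \<eta>) (?C \<psi>)"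
    if "\<phi> \<in> X" "\<psi> \<in> X" "\<eta> \<in> X" for \<phi> \<psi> \<eta> a b
    using lin[OF that] by (simp add: ell2_inner_commute)
  show ?thesis
    unfolding bounded_bilinear_form_def
  proof (intro conjI ballI allI exI)
    show "\<bar>ell2_inner (?C \<phi>) (?C \<psi>)\<bar> \<le> (\<Sum>i. (Linf_norm \<Omega> w (c i))\<^sup>2) * NX \<phi> * NX \<psi>"
      if "\<phi> \<in> X" "\<psi> \<in> X" for \<phi> \<psi>
      by (rule observation_bound(2)[OF c that])
  qed (fact lin lin')+
qed

end

section \<open>The value form and the Lyapunov equation\<close>

theorem theorem4p1:
  fixes \<Omega> :: "(real^'n) set"
    and \<nu> f Dv :: "real^'n \<Rightarrow> real^'n"
    and w g :: "real^'n \<Rightarrow> real"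
    and c :: "nat \<Rightarrow> real^'n \<Rightarrow> real"
    and S :: "real \<Rightarrow> (real^'n \<Rightarrow> real) \<Rightarrow> (real^'n \<Rightarrow> real)"
    and C :: "(real^'n \<Rightarrow> real) \<Rightarrow> nat \<Rightarrow> real"
  assumes "open \<Omega>" "bounded \<Omega>" "C1_boundary \<Omega>"
    and "\<forall>x\<in>frontier \<Omega>. outer_unit_normal \<Omega> x (\<nu> x)"
    and "\<forall>i. Ck_on 1 UNIV (\<lambda>x. f x $ i)"
    and "\<forall>x\<in>frontier \<Omega>. \<nu> x \<bullet> f x \<le> 0"
    and "w \<in> borel_measurable (lebesgue_on \<Omega>)" "AE x in lebesgue_on \<Omega>. 0 < w x"
    and "(\<lambda>x. inverse (w x)) \<in> W1inf \<Omega>" "weak_gradient \<Omega> (\<lambda>x. inverse (w x)) Dv"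
    and "\<forall>i. (\<lambda>x. f x $ i) \<in> Linf \<Omega> w"
    and "esssup (lebesgue_on \<Omega>) (\<lambda>x. ereal (- (f x \<bullet> (- (w x)\<^sup>2 *\<^sub>R Dv x)) / w x)) < \<infinity>"
    \<comment> \<open>\<open>S\<close> is the preadjoint of the composition semigroup, over \<open>X\<close> and (by restriction) over \<open>H\<close>\<close>
    and "\<forall>t\<ge>0. preadjoint \<Omega> w (X_space \<Omega> w) (X_norm \<Omega> w) (Linf \<Omega> w) (S t) (composition_semigroup f t)"
    and "\<forall>t\<ge>0. preadjoint \<Omega> w (H_space \<Omega> w) (H_norm \<Omega> w) (H_space \<Omega> w) (S t) (composition_semigroup f t)"
    and "C0_semigroup \<Omega> (H_space \<Omega> w) (H_norm \<Omega> w) S"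
    and "\<forall>i. c i \<in> Linf \<Omega> w" "summable (\<lambda>i. (Linf_norm \<Omega> w (c i))\<^sup>2)"
    and "AE x in lebesgue_on \<Omega>. (\<lambda>i. (c i x)\<^sup>2) sums g x"
    and "C = observation \<Omega> w c"
    and "exponentially_stable (X_space \<Omega> w) (X_norm \<Omega> w) S"
  shows "(\<forall>\<phi>\<in>X_space \<Omega> w. C \<phi> \<in> ell2) \<and>
    (\<forall>\<phi>\<in>X_space \<Omega> w. \<forall>\<psi>\<in>X_space \<Omega> w.
       set_integrable lborel {0..} (\<lambda>t. ell2_inner (C (S t \<phi>)) (C (S t \<psi>)))) \<and>
    (\<exists>Q. minimal_lyapunov_solution (H_space \<Omega> w) (H_norm \<Omega> w) S C Q \<and>
       (\<forall>Q'. minimal_lyapunov_solution (H_space \<Omega> w) (H_norm \<Omega> w) S C Q' \<longrightarrow>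
          (\<forall>\<phi>\<in>H_space \<Omega> w. \<forall>\<psi>\<in>H_space \<Omega> w. Q' \<phi> \<psi> = Q \<phi> \<psi>)) \<and>
       unique_bounded_extension (H_space \<Omega> w) (X_space \<Omega> w) (X_norm \<Omega> w) Q (value_form C S))"
proof -
  interpret D: weighted_domain \<Omega> w
    using assms(1,2,7,8) by unfold_locales (auto intro: lmeasurable_open)
  interpret H: hilbert_function_space \<Omega> "H_space \<Omega> w" "H_norm \<Omega> w" "pairing \<Omega> w" by (rule D.H_hilbert)
  interpret X: seminormed_function_space \<Omega> "X_space \<Omega> w" "X_norm \<Omega> w" by (rule D.X_seminormed)
  have c: "\<And>i. c i \<in> Linf \<Omega> w" using assms(16) by blast
  obtain M \<omega> where M: "1 \<le> M" "\<omega> < 0"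
    "\<And>t \<phi>. 0 \<le> t \<Longrightarrow> \<phi> \<in> X_space \<Omega> w \<Longrightarrow> X_norm \<Omega> w (S t \<phi>) \<le> M * exp (\<omega> * t) * X_norm \<Omega> w \<phi>"
    using assms(20) unfolding exponentially_stable_def by blast
  interpret stable_observation \<Omega> "H_space \<Omega> w" "H_norm \<Omega> w" "pairing \<Omega> w" "X_space \<Omega> w" "X_norm \<Omega> w" S C
    D.embedding_constant M \<omega>
  proof
    show "H_space \<Omega> w \<subseteq> X_space \<Omega> w" using D.H_subset_X(1) by blast
    show "bounded_operator \<Omega> (X_space \<Omega> w) (X_norm \<Omega> w) (S t)" if "0 \<le> t" for t
      using assms(13) that unfolding preadjoint_def by blast
    show "C \<phi> \<in> ell2" if "\<phi> \<in> X_space \<Omega> w" for \<phi>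
      unfolding assms(19) by (rule D.observation_ell2[OF c assms(17) that])
    show "bounded_bilinear_form (X_space \<Omega> w) (X_norm \<Omega> w) (\<lambda>\<phi> \<psi>. ell2_inner (C \<phi>) (C \<psi>))"
      unfolding assms(19) by (rule D.observation_form[OF c assms(17)])
  qed (use D.H_subset_X(2) D.H_dense_in_X assms(15) M in \<open>auto simp: D.embedding_constant_def\<close>)
  show ?thesis
  proof (intro conjI ballI exI allI impI)
    show "minimal_lyapunov_solution (H_space \<Omega> w) (H_norm \<Omega> w) S C (value_form C S)" by (rule value_form_minimal)
    show "unique_bounded_extension (H_space \<Omega> w) (X_space \<Omega> w) (X_norm \<Omega> w) (value_form C S) (value_form C S)"
      by (rule value_form_unique_extension)
  qed (auto intro: C_ell2 F_integrable minimal_lyapunov_solution_unique)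
qed

end
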